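(* Let $W$ be the Weyl group of a complex semisimple Lie algebra with positive roots $\Delta^+\subset\mathfrak{t}^*$. For $u\in W$ let $\tau_u^{sym}=\frac{1}{|W|}\sum_{w\in W}\tau_u^w$, and write $\tau_u^{sym}=\sum_{v\in W}a_{u,v}\tau_v$ with $a_{u,v}\in\mathbb{S}(\mathfrak{t}^* )$ (expansion in the Schubert basis). Then (1) $a_{u,v}\ne0$ implies $v\le_L u$; (2) $a_{u,u}=1$ for all $u\in W$; (3) $\{\tau_u^{sym}:u\in W\}$ is a basis of the $\mathbb{S}(\mathfrak{t}^* )$-module $H_\alpha^*(W)$.
   Context: $\ell$ is the length function on $W$; $v\le_L u$ (left weak order) iff $\ell(uv^{-1})=\ell(u)-\ell(v)$. $H_\alpha^*(W)$ is the ring of maps $f\colon W\to\mathbb{S}(\mathfrak{t}^* )$ with $f(ws_\beta)-f(w)\in(w\beta)\mathbb{S}(\mathfrak{t}^* )$ for all $w\in W$, $\beta\in\Delta^+$. For $f\in H_\alpha^*(W)$, $f^w(v)=w^{-1}\cdot f(wv)$. For each $u\in W$ the equivariant Schubert class $\tau_u$ is the unique class in $H_\alpha^*(W)$ homogeneous of polynomial degree $\ell(u)$, supported on $\{v:u\preccurlyeq v\}$ ($\preccurlyeq$ the strong Bruhat order), with $\tau_u(u)=\prod\{\beta\in\Delta^+:u^{-1}\beta\in-\Delta^+\}$; the $\tau_u$ form an $\mathbb{S}(\mathfrak{t}^* )$-basis of $H_\alpha^*(W)$. *)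

theory Defs
  imports "HOL-Analysis.Analysis" "HOL-Library.Function_Algebras"
begin

text \<open>
  The Cartan subalgebra \<open>t\<close> is \<open>'k^'n\<close> over a field \<open>'k\<close> of characteristic 0; taking \<open>'k\<close> to
  be \<^typ>\<open>complex\<close> gives the Cartan subalgebra itself, \<^typ>\<open>real\<close> gives its split (or, up to
  a factor \<open>i\<close>, compact) real form. Elements of the dual space are linear functionals on
  \<open>'k^'n\<close>, and all function spaces carry the pointwise ring operations.
\<close>

definition dual_space :: "('k::field_char_0 ^ 'n \<Rightarrow> 'k) set" where
  "dual_space = {\<phi>. Vector_Spaces.linear (*s) (*) \<phi>}"

text \<open>
  The symmetric algebra of the dual space, realised as the algebra of polynomial functions on
  \<open>'k^'n\<close> (the two are canonically isomorphic since \<open>'k\<close> is infinite).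
\<close>

inductive_set sym_algebra :: "('k::field_char_0 ^ 'n \<Rightarrow> 'k) set" where
  const: "(\<lambda>x. c) \<in> sym_algebra"
| linear: "\<phi> \<in> dual_space \<Longrightarrow> \<phi> \<in> sym_algebra"
| add: "p \<in> sym_algebra \<Longrightarrow> q \<in> sym_algebra \<Longrightarrow> p + q \<in> sym_algebra"
| mult: "p \<in> sym_algebra \<Longrightarrow> q \<in> sym_algebra \<Longrightarrow> p * q \<in> sym_algebra"

definition homogeneous :: "nat \<Rightarrow> ('k::field_char_0 ^ 'n \<Rightarrow> 'k) \<Rightarrow> bool" where
  "homogeneous d p \<longleftrightarrow> p \<in> sym_algebra \<and> (\<forall>c x. p (c *s x) = c ^ d * p x)"


subsection \<open>Root systems\<close>

definition reflection :: "('k::field_char_0 ^ 'n \<Rightarrow> 'k) \<Rightarrow> 'k ^ 'n \<Rightarrow> 'k ^ 'n \<Rightarrow> 'k ^ 'n" where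
  "reflection \<beta> h x = x - \<beta> x *s h"

text \<open>
  The reflection induced on the dual space is \<open>\<phi> \<mapsto> \<phi> \<circ> reflection \<beta> h\<close>, that is,
  \<open>\<phi> \<mapsto> \<phi> - \<phi>(h) \<beta>\<close>. For a finite spanning set \<open>\<Phi>\<close> there is at most one such \<open>h\<close>.
\<close>

definition is_coroot ::
    "('k::field_char_0 ^ 'n \<Rightarrow> 'k) set \<Rightarrow> ('k ^ 'n \<Rightarrow> 'k) \<Rightarrow> 'k ^ 'n \<Rightarrow> bool" where
  "is_coroot \<Phi> \<beta> h \<longleftrightarrow> \<beta> h = 2 \<and> (\<lambda>\<phi>. \<phi> \<circ> reflection \<beta> h) ` \<Phi> = \<Phi>"

text \<open>
  Reduced root systems in the dual space, in Bourbaki's formulation, which makes sense over any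
  field of characteristic 0: for the complex numbers these are precisely the root systems of
  complex semisimple Lie algebras.
\<close>

definition root_system :: "('k::field_char_0 ^ 'n \<Rightarrow> 'k) set \<Rightarrow> bool" where
  "root_system \<Phi> \<longleftrightarrow>
     finite \<Phi> \<and> \<Phi> \<subseteq> dual_space \<and> 0 \<notin> \<Phi> \<and>
     (\<forall>\<phi>\<in>dual_space. \<exists>c. \<phi> = (\<lambda>x. \<Sum>\<beta>\<in>\<Phi>. c \<beta> * \<beta> x)) \<and>
     (\<forall>\<alpha>\<in>\<Phi>. \<exists>h. is_coroot \<Phi> \<alpha> h \<and> (\<forall>\<beta>\<in>\<Phi>. \<beta> h \<in> \<int>)) \<and>
     (\<forall>\<alpha>\<in>\<Phi>. \<forall>c. (\<lambda>x. c * \<alpha> x) \<in> \<Phi> \<longrightarrow> c = 1 \<or> c = - 1)"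

definition root_base ::
    "('k::field_char_0 ^ 'n \<Rightarrow> 'k) set \<Rightarrow> ('k ^ 'n \<Rightarrow> 'k) set \<Rightarrow> bool" where
  "root_base \<Phi> B \<longleftrightarrow>
     B \<subseteq> \<Phi> \<and>
     (\<forall>c. (\<lambda>x. \<Sum>\<alpha>\<in>B. c \<alpha> * \<alpha> x) = 0 \<longrightarrow> (\<forall>\<alpha>\<in>B. c \<alpha> = 0)) \<and>
     (\<forall>\<beta>\<in>\<Phi>. \<exists>m :: _ \<Rightarrow> nat.
        \<beta> = (\<lambda>x. \<Sum>\<alpha>\<in>B. of_nat (m \<alpha>) * \<alpha> x) \<or> - \<beta> = (\<lambda>x. \<Sum>\<alpha>\<in>B. of_nat (m \<alpha>) * \<alpha> x))"

definition pos_roots ::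
    "('k::field_char_0 ^ 'n \<Rightarrow> 'k) set \<Rightarrow> ('k ^ 'n \<Rightarrow> 'k) set \<Rightarrow> ('k ^ 'n \<Rightarrow> 'k) set" where
  "pos_roots \<Phi> B =
     {\<beta> \<in> \<Phi>. \<exists>m :: _ \<Rightarrow> nat. \<beta> = (\<lambda>x. \<Sum>\<alpha>\<in>B. of_nat (m \<alpha>) * \<alpha> x)}"


subsection \<open>The Weyl group\<close>

definition root_refl ::
    "('k::field_char_0 ^ 'n \<Rightarrow> 'k) set \<Rightarrow> ('k ^ 'n \<Rightarrow> 'k) \<Rightarrow> 'k ^ 'n \<Rightarrow> 'k ^ 'n" where
  "root_refl \<Phi> \<beta> = reflection \<beta> (THE h. is_coroot \<Phi> \<beta> h)"

text \<open>The Weyl group, as a group of transformations of \<open>'k^'n\<close> under composition.\<close>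

inductive_set weyl_group ::
    "('k::field_char_0 ^ 'n \<Rightarrow> 'k) set \<Rightarrow> ('k ^ 'n \<Rightarrow> 'k ^ 'n) set"
  for \<Phi> :: "('k ^ 'n \<Rightarrow> 'k) set" where
  one: "id \<in> weyl_group \<Phi>"
| step: "w \<in> weyl_group \<Phi> \<Longrightarrow> \<beta> \<in> \<Phi> \<Longrightarrow> w \<circ> root_refl \<Phi> \<beta> \<in> weyl_group \<Phi>"

text \<open>The contragredient action on polynomial functions, in particular on linear functionals.\<close>

definition act :: "('a \<Rightarrow> 'a) \<Rightarrow> ('a \<Rightarrow> 'b) \<Rightarrow> 'a \<Rightarrow> 'b" where
  "act w p = p \<circ> inv w"

definition weyl_length ::
    "('k::field_char_0 ^ 'n \<Rightarrow> 'k) set \<Rightarrow> ('k ^ 'n \<Rightarrow> 'k) set \<Rightarrow> ('k ^ 'n \<Rightarrow> 'k ^ 'n) \<Rightarrow> nat" where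
  "weyl_length \<Phi> B w =
     (LEAST k. \<exists>\<alpha>s. length \<alpha>s = k \<and> set \<alpha>s \<subseteq> B \<and> w = foldr (\<circ>) (map (root_refl \<Phi>) \<alpha>s) id)"

definition left_weak_le ::
    "('k::field_char_0 ^ 'n \<Rightarrow> 'k) set \<Rightarrow> ('k ^ 'n \<Rightarrow> 'k) set \<Rightarrow>
     ('k ^ 'n \<Rightarrow> 'k ^ 'n) \<Rightarrow> ('k ^ 'n \<Rightarrow> 'k ^ 'n) \<Rightarrow> bool" where
  "left_weak_le \<Phi> B v u \<longleftrightarrow>
     int (weyl_length \<Phi> B (u \<circ> inv v)) = int (weyl_length \<Phi> B u) - int (weyl_length \<Phi> B v)"

definition bruhat_le ::
    "('k::field_char_0 ^ 'n \<Rightarrow> 'k) set \<Rightarrow> ('k ^ 'n \<Rightarrow> 'k) set \<Rightarrow>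
     ('k ^ 'n \<Rightarrow> 'k ^ 'n) \<Rightarrow> ('k ^ 'n \<Rightarrow> 'k ^ 'n) \<Rightarrow> bool" where
  "bruhat_le \<Phi> B =
     (\<lambda>u v. \<exists>\<beta>\<in>pos_roots \<Phi> B.
        v = u \<circ> root_refl \<Phi> \<beta> \<and> weyl_length \<Phi> B u < weyl_length \<Phi> B v)\<^sup>*\<^sup>*"


subsection \<open>The ring of classes and its Schubert basis\<close>

text \<open>Maps on the Weyl group are extended by 0 to all transformations of \<open>'k^'n\<close>.\<close>

definition graph_cohomology ::
    "('k::field_char_0 ^ 'n \<Rightarrow> 'k) set \<Rightarrow> ('k ^ 'n \<Rightarrow> 'k) set \<Rightarrow>
     (('k ^ 'n \<Rightarrow> 'k ^ 'n) \<Rightarrow> 'k ^ 'n \<Rightarrow> 'k) set" where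
  "graph_cohomology \<Phi> B =
     {f. (\<forall>w\<in>weyl_group \<Phi>. f w \<in> sym_algebra) \<and> (\<forall>w. w \<notin> weyl_group \<Phi> \<longrightarrow> f w = 0) \<and>
         (\<forall>w\<in>weyl_group \<Phi>. \<forall>\<beta>\<in>pos_roots \<Phi> B.
            \<exists>g\<in>sym_algebra. f (w \<circ> root_refl \<Phi> \<beta>) - f w = act w \<beta> * g)}"

definition twist :: "(('a \<Rightarrow> 'a) \<Rightarrow> 'a \<Rightarrow> 'b) \<Rightarrow> ('a \<Rightarrow> 'a) \<Rightarrow> ('a \<Rightarrow> 'a) \<Rightarrow> 'a \<Rightarrow> 'b" where
  "twist f w v = act (inv w) (f (w \<circ> v))"

definition is_schubert_class ::
    "('k::field_char_0 ^ 'n \<Rightarrow> 'k) set \<Rightarrow> ('k ^ 'n \<Rightarrow> 'k) set \<Rightarrow> ('k ^ 'n \<Rightarrow> 'k ^ 'n) \<Rightarrow>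
     (('k ^ 'n \<Rightarrow> 'k ^ 'n) \<Rightarrow> 'k ^ 'n \<Rightarrow> 'k) \<Rightarrow> bool" where
  "is_schubert_class \<Phi> B u f \<longleftrightarrow>
     f \<in> graph_cohomology \<Phi> B \<and>
     (\<forall>v\<in>weyl_group \<Phi>. homogeneous (weyl_length \<Phi> B u) (f v)) \<and>
     (\<forall>v\<in>weyl_group \<Phi>. f v \<noteq> 0 \<longrightarrow> bruhat_le \<Phi> B u v) \<and>
     f u = \<Prod>{\<beta> \<in> pos_roots \<Phi> B. act (inv u) \<beta> \<in> uminus ` pos_roots \<Phi> B}"

definition schubert_class ::
    "('k::field_char_0 ^ 'n \<Rightarrow> 'k) set \<Rightarrow> ('k ^ 'n \<Rightarrow> 'k) set \<Rightarrow> ('k ^ 'n \<Rightarrow> 'k ^ 'n) \<Rightarrow>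
     ('k ^ 'n \<Rightarrow> 'k ^ 'n) \<Rightarrow> 'k ^ 'n \<Rightarrow> 'k" where
  "schubert_class \<Phi> B u = (THE f. is_schubert_class \<Phi> B u f)"

definition sym_schubert_class ::
    "('k::field_char_0 ^ 'n \<Rightarrow> 'k) set \<Rightarrow> ('k ^ 'n \<Rightarrow> 'k) set \<Rightarrow> ('k ^ 'n \<Rightarrow> 'k ^ 'n) \<Rightarrow>
     ('k ^ 'n \<Rightarrow> 'k ^ 'n) \<Rightarrow> 'k ^ 'n \<Rightarrow> 'k" where
  "sym_schubert_class \<Phi> B u =
     (\<lambda>v x. 1 / of_nat (card (weyl_group \<Phi>)) *
            (\<Sum>w\<in>weyl_group \<Phi>. twist (schubert_class \<Phi> B u) w v x))"

definition lin_comb ::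
    "'i set \<Rightarrow> ('i \<Rightarrow> 'a \<Rightarrow> 'k::comm_ring_1) \<Rightarrow> ('i \<Rightarrow> 'w \<Rightarrow> 'a \<Rightarrow> 'k) \<Rightarrow> 'w \<Rightarrow> 'a \<Rightarrow> 'k" where
  "lin_comb I c b = (\<lambda>w. \<Sum>i\<in>I. c i * b i w)"

text \<open>The family \<open>b\<close>, indexed by a finite set \<open>I\<close>, is a basis of \<open>M\<close> over the symmetric algebra.\<close>

definition sym_basis ::
    "(('w \<Rightarrow> 'k::field_char_0 ^ 'n \<Rightarrow> 'k)) set \<Rightarrow> 'i set \<Rightarrow> ('i \<Rightarrow> 'w \<Rightarrow> 'k ^ 'n \<Rightarrow> 'k) \<Rightarrow> bool" where
  "sym_basis M I b \<longleftrightarrow>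
     b \<in> I \<rightarrow> M \<and>
     (\<forall>f\<in>M. \<exists>c \<in> I \<rightarrow> sym_algebra. f = lin_comb I c b) \<and>
     (\<forall>c \<in> I \<rightarrow> sym_algebra. lin_comb I c b = 0 \<longrightarrow> (\<forall>i\<in>I. c i = 0))"

definition schubert_coeff ::
    "('k::field_char_0 ^ 'n \<Rightarrow> 'k) set \<Rightarrow> ('k ^ 'n \<Rightarrow> 'k) set \<Rightarrow> ('k ^ 'n \<Rightarrow> 'k ^ 'n) \<Rightarrow>
     ('k ^ 'n \<Rightarrow> 'k ^ 'n) \<Rightarrow> 'k ^ 'n \<Rightarrow> 'k" where
  "schubert_coeff \<Phi> B u =
     (THE a. a \<in> weyl_group \<Phi> \<rightarrow>\<^sub>E sym_algebra \<and>
             sym_schubert_class \<Phi> B u = lin_comb (weyl_group \<Phi>) a (schubert_class \<Phi> B))"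

end

theory Submission
  imports Defs "HOL-Computational_Algebra.Polynomial"
begin

text \<open>
  For a simple root \<open>\<alpha>\<close> the left divided difference \<open>(f - f\<^sup>s) / \<alpha>\<close>, with \<open>s\<close> the reflection
  along \<open>\<alpha>\<close>, maps classes to classes. By a degree and support argument it sends the Schubert class
  of \<open>u\<close> to that of \<open>s u\<close> if \<open>s u\<close> is shorter than \<open>u\<close>, and to 0 otherwise; this also
  constructs all Schubert classes from the class concentrated at an element of maximal length.
  Hence twisting \<open>\<tau>\<^sub>u\<close> by \<open>s\<close> either fixes it or subtracts \<open>\<alpha> \<tau>\<^bsub>s u\<^esub>\<close>, so every twist of
  \<open>\<tau>\<^sub>u\<close>, and therefore their average, is \<open>\<tau>\<^sub>u\<close> plus a combination of classes strictly below \<open>u\<close>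
  in the left weak order. The transition matrix to the Schubert basis is unitriangular.
\<close>

section \<open>Polynomial functions\<close>

text \<open>Polynomials are functions here, so divisibility by a linear form is vanishing on its
  kernel; cancellation and coprimality come from restricting to lines, where a nonzero polynomial
  has finitely many roots. The field \<open>'k\<close> carries no order, so sign arguments about
  roots are moved to natural or integer coefficients. Since \<open>act w\<close> is composition with
  \<open>inv w\<close>, the functional \<open>\<beta> \<circ> w\<close> is the image of \<beta>
  under \<open>inv w\<close>. Reflections are therefore multiplied on the left, and the sign of
  \<open>\<beta> \<circ> w\<close> decides whether the length grows. Twisting also multiplies on the
  left, which is why the left divided difference controls it. The delicate point is that the
  quotient by \<alpha> is again a class: along the edges of \<alpha> itself, \<alpha> vanishes on
  the hyperplane in question and cannot be cancelled there. Twisting is only semilinear, as it also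
  moves scalars. This does not disturb triangularity, because the scalar in front of
  \<open>\<tau> u\<close> stays 1.\<close>

lemma sum_fun_apply: "(\<Sum>i\<in>A. f i) x = (\<Sum>i\<in>A. f i x)"
  by (induction A rule: infinite_finite_induct) auto

lemma prod_fun_apply: "(\<Prod>i\<in>A. f i) x = (\<Prod>i\<in>A. f i x)"
  by (induction A rule: infinite_finite_induct) auto

section \<open>Linear functionals and closure properties of the symmetric algebra\<close>

lemma dual_space_iff:
  "\<phi> \<in> dual_space \<longleftrightarrow> (\<forall>x y. \<phi> (x + y) = \<phi> x + \<phi> y) \<and> (\<forall>c x. \<phi> (c *s x) = c * \<phi> x)"
  unfolding dual_space_def Vector_Spaces.linear_iff
  using vector_space_over_itself.vector_space_axioms vec.vector_space_axioms by blast

lemma dual_add: "\<phi> \<in> dual_space \<Longrightarrow> \<phi> (x + y) = \<phi> x + \<phi> y"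
  and dual_scale: "\<phi> \<in> dual_space \<Longrightarrow> \<phi> (c *s x) = c * \<phi> x"
  by (auto simp: dual_space_iff)

lemma dual_zero: "\<phi> \<in> dual_space \<Longrightarrow> \<phi> 0 = 0"
  using dual_scale[of \<phi> 0 0] by simp

lemma dual_minus: "\<phi> \<in> dual_space \<Longrightarrow> \<phi> (- x) = - \<phi> x"
  using dual_scale[of \<phi> "-1" x] by simp

lemma dual_diff: "\<phi> \<in> dual_space \<Longrightarrow> \<phi> (x - y) = \<phi> x - \<phi> y"
  using dual_add[of \<phi> x "- y"] by (simp add: dual_minus)

lemma dual_coordinate: "(\<lambda>x. x $ i) \<in> dual_space"
  by (simp add: dual_space_iff)

lemma sym_algebra_zero: "0 \<in> sym_algebra"
  using sym_algebra.const[of 0] by (simp add: zero_fun_def)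

lemma sym_algebra_one: "1 \<in> sym_algebra"
  using sym_algebra.const[of 1] by (simp add: one_fun_def)

lemma sym_algebra_minus:
  assumes "p \<in> sym_algebra" shows "- p \<in> sym_algebra"
proof -
  have "- p = (\<lambda>x. - 1) * p" by (simp add: fun_eq_iff)
  then show ?thesis by (metis assms sym_algebra.const sym_algebra.mult)
qed

lemma sym_algebra_diff:
  "p \<in> sym_algebra \<Longrightarrow> q \<in> sym_algebra \<Longrightarrow> p - q \<in> sym_algebra"
  using sym_algebra.add[of p "- q"] sym_algebra_minus[of q] by simp

lemma sym_algebra_sum:
  "(\<And>i. i \<in> A \<Longrightarrow> f i \<in> sym_algebra) \<Longrightarrow> (\<Sum>i\<in>A. f i) \<in> sym_algebra"
  by (induction A rule: infinite_finite_induct) (auto intro: sym_algebra_zero sym_algebra.add)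

lemma sym_algebra_prod:
  "(\<And>i. i \<in> A \<Longrightarrow> f i \<in> sym_algebra) \<Longrightarrow> (\<Prod>i\<in>A. f i) \<in> sym_algebra"
  by (induction A rule: infinite_finite_induct) (auto intro: sym_algebra_one sym_algebra.mult)

lemma sym_algebra_comp_linear:
  assumes "p \<in> sym_algebra" and "\<And>\<phi>. \<phi> \<in> dual_space \<Longrightarrow> \<phi> \<circ> w \<in> dual_space"
  shows "p \<circ> w \<in> sym_algebra"
  using assms(1)
proof induction
  case (const c)
  then show ?case using sym_algebra.const[of c] by (simp add: o_def)
next
  case (linear \<phi>)
  then show ?case using assms(2) sym_algebra.linear by blast
next
  case (add p q)
  have "(p + q) \<circ> w = (p \<circ> w) + (q \<circ> w)" by (simp add: fun_eq_iff)
  then show ?case using add sym_algebra.add by metis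
next
  case (mult p q)
  have "(p * q) \<circ> w = (p \<circ> w) * (q \<circ> w)" by (simp add: fun_eq_iff)
  then show ?case using mult sym_algebra.mult by metis
qed

section \<open>Restriction to lines and divisibility by linear forms\<close>

lemma sym_algebra_on_line:
  assumes "p \<in> sym_algebra"
  shows "\<exists>q. \<forall>t. p (x + t *s y) = poly q t"
  using assms
proof induction
  case (const c)
  then show ?case by (intro exI[of _ "[:c:]"]) simp
next
  case (linear \<phi>)
  then show ?case by (intro exI[of _ "[:\<phi> x, \<phi> y:]"]) (simp add: dual_add dual_scale)
next
  case (add p q)
  then obtain a b where "\<forall>t. p (x + t *s y) = poly a t" "\<forall>t. q (x + t *s y) = poly b t" by blast
  then show ?case by (intro exI[of _ "a + b"]) simp
next
  case (mult p q)
  then obtain a b where "\<forall>t. p (x + t *s y) = poly a t" "\<forall>t. q (x + t *s y) = poly b t" by blast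
  then show ?case by (intro exI[of _ "a * b"]) simp
qed

text \<open>The field is infinite and a nonzero polynomial has finitely many roots. The exceptional
  point is where a linear form vanishes on a line, or the parameter 0 at which a power of the
  parameter cannot be cancelled.\<close>

lemma poly_eq_0_if_zero_except_one_point:
  fixes q :: "'k::field_char_0 poly"
  assumes "\<And>t. t \<noteq> a \<Longrightarrow> poly q t = 0"
  shows "q = 0"
proof (rule ccontr)
  assume "q \<noteq> 0"
  then have "finite {t. poly q t = 0}" by (rule poly_roots_finite)
  then have "finite (insert a {t. poly q t = 0})" by blast
  moreover have "insert a {t. poly q t = 0} = UNIV" using assms by blast
  ultimately show False using infinite_UNIV_char_0 by metis
qed

text \<open>
  On the line through a point of the hyperplane in a direction \<open>y\<close> along it, \<open>\<beta>\<close> has at most one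
  zero, so the other factor vanishes at all but one parameter, hence everywhere.
\<close>

lemma vanishes_cancel_linear:
  assumes "p \<in> sym_algebra" "\<beta> \<in> dual_space" "\<alpha> \<in> dual_space"
    and y: "\<alpha> y = 0" "\<beta> y \<noteq> 0"
    and van: "\<And>x. \<alpha> x = 0 \<Longrightarrow> \<beta> x * p x = 0"
    and "\<alpha> x = 0"
  shows "p x = 0"
proof -
  obtain q where q: "\<forall>t. p (x + t *s y) = poly q t" using sym_algebra_on_line[OF assms(1)] by blast
  have "poly q t = 0" if "t \<noteq> - \<beta> x / \<beta> y" for t
  proof -
    have "\<alpha> (x + t *s y) = 0" using assms by (simp add: dual_add dual_scale)
    then have "\<beta> (x + t *s y) * p (x + t *s y) = 0" by (rule van)
    moreover have "\<beta> (x + t *s y) \<noteq> 0"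
      using that assms(2) y by (auto simp: dual_add dual_scale field_simps eq_neg_iff_add_eq_0)
    ultimately show ?thesis using q by simp
  qed
  then have "q = 0" by (rule poly_eq_0_if_zero_except_one_point)
  then show ?thesis using q[rule_format, of 0] by simp
qed

lemma linear_mult_eq_0:
  assumes "p \<in> sym_algebra" "\<beta> \<in> dual_space" "\<beta> \<noteq> 0" "\<beta> * p = 0"
  shows "p = 0"
proof -
  \<comment> \<open>The zero functional has the whole space as its kernel, so cancellation on a
    kernel becomes cancellation everywhere.\<close>
  have zero: "(0 :: 'a ^ 'b \<Rightarrow> 'a) \<in> dual_space" by (simp add: dual_space_iff)
  obtain y where "\<beta> y \<noteq> 0" using assms(3) by (auto simp: fun_eq_iff)
  moreover have "\<beta> x * p x = 0" for x using assms(4) by (simp add: fun_eq_iff)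
  ultimately have "p x = 0" for x
    using vanishes_cancel_linear[OF assms(1,2) zero] by simp
  then show ?thesis by (simp add: fun_eq_iff)
qed

lemma linear_mult_cancel:
  assumes "p \<in> sym_algebra" "q \<in> sym_algebra" "\<beta> \<in> dual_space" "\<beta> \<noteq> 0" "\<beta> * p = \<beta> * q"
  shows "p = q"
  using linear_mult_eq_0[of "p - q" \<beta>] assms sym_algebra_diff[of p q]
  by (simp add: right_diff_distrib)

lemma prod_linear_mult_eq_0:
  assumes "finite A" "p \<in> sym_algebra" "A \<subseteq> dual_space" "0 \<notin> A" "\<Prod>A * p = 0"
  shows "p = 0"
  using assms
proof (induction A rule: finite_induct)
  case (insert a A)
  have "\<Prod>A * p \<in> sym_algebra"
    using insert by (intro sym_algebra.mult sym_algebra_prod) (auto intro: sym_algebra.linear)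
  moreover have "a * (\<Prod>A * p) = 0"
    using insert.prems(4) unfolding prod.insert[OF insert.hyps] mult.assoc .
  ultimately have "\<Prod>A * p = 0" using linear_mult_eq_0[of "\<Prod>A * p" a] insert.prems by blast
  then show ?case using insert.IH insert.prems by blast
qed auto

text \<open>Shifting the argument by \<open>\<alpha> x\<close> times a fixed vector changes a linear
  functional by a constant multiple of \<alpha>; sums and products inherit a factor \<alpha>. The
  quotient is built along the inductive definition of \<open>sym_algebra\<close>.\<close>

lemma diff_projection_divisible:
  assumes "p \<in> sym_algebra" "\<alpha> \<in> dual_space" and proj: "\<And>x. \<pi> x = x - \<alpha> x *s h"
  shows "\<exists>g\<in>sym_algebra. \<forall>x. p x - p (\<pi> x) = \<alpha> x * g x"
  using assms(1)
proof induction
  case (const c)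
  then show ?case by (intro bexI[of _ 0]) (auto intro: sym_algebra_zero)
next
  case (linear \<phi>)
  then show ?case
    by (intro bexI[of _ "\<lambda>x. \<phi> h"])
      (auto simp: proj dual_diff dual_scale intro: sym_algebra.const)
next
  case (add p q)
  then obtain a b where ab: "a \<in> sym_algebra" "b \<in> sym_algebra"
    "\<forall>x. p x - p (\<pi> x) = \<alpha> x * a x" "\<forall>x. q x - q (\<pi> x) = \<alpha> x * b x" by blast
  have "(p + q) x - (p + q) (\<pi> x) = \<alpha> x * (a + b) x" for x
  proof -
    have "(p + q) x - (p + q) (\<pi> x) = (p x - p (\<pi> x)) + (q x - q (\<pi> x))" by simp
    also have "\<dots> = \<alpha> x * (a + b) x" unfolding ab(3)[rule_format] ab(4)[rule_format] by (simp add: distrib_left)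
    finally show ?thesis .
  qed
  then show ?case using ab(1,2) sym_algebra.add by blast
next
  case (mult p q)
  then obtain a b where ab: "a \<in> sym_algebra" "b \<in> sym_algebra"
    "\<forall>x. p x - p (\<pi> x) = \<alpha> x * a x" "\<forall>x. q x - q (\<pi> x) = \<alpha> x * b x" by blast
  \<comment> \<open>Leibniz rule for differences: expanding
    \<open>p * q - (p - \<alpha> * a) * (q - \<alpha> * b)\<close> leaves the second-order
    correction \<open>\<alpha> * a * b\<close>.\<close>
  define g where "g = a * q + p * b - \<alpha> * a * b"
  have "g \<in> sym_algebra"
    unfolding g_def using ab(1,2) mult.hyps assms(2)
    by (intro sym_algebra_diff sym_algebra.add sym_algebra.mult) (auto intro: sym_algebra.linear)
  moreover have "(p * q) x - (p * q) (\<pi> x) = \<alpha> x * g x" for x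
  proof -
    have "p (\<pi> x) = p x - \<alpha> x * a x" "q (\<pi> x) = q x - \<alpha> x * b x"
      unfolding ab(3)[rule_format, symmetric] ab(4)[rule_format, symmetric] by simp_all
    then have "(p * q) x - (p * q) (\<pi> x) = p x * q x - (p x - \<alpha> x * a x) * (q x - \<alpha> x * b x)"
      by simp
    also have "\<dots> = \<alpha> x * g x" by (simp add: g_def algebra_simps)
    finally show ?thesis .
  qed
  ultimately show ?case by blast
qed

lemma divisible_by_linear_iff:
  assumes "p \<in> sym_algebra" "\<alpha> \<in> dual_space" "\<alpha> \<noteq> 0"
  shows "(\<exists>g\<in>sym_algebra. p = \<alpha> * g) \<longleftrightarrow> (\<forall>x. \<alpha> x = 0 \<longrightarrow> p x = 0)"
proof
  show "\<forall>x. \<alpha> x = 0 \<longrightarrow> p x = 0" if "\<exists>g\<in>sym_algebra. p = \<alpha> * g"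
    using that by auto
next
  assume van: "\<forall>x. \<alpha> x = 0 \<longrightarrow> p x = 0"
  obtain y where y: "\<alpha> y \<noteq> 0" using assms(3) by (auto simp: fun_eq_iff)
  \<comment> \<open>With \<open>\<alpha> h = 1\<close> the map \<open>x - \<alpha> x *s h\<close> is
    a projection onto the kernel of \<alpha>, where \<open>p\<close> vanishes.\<close>
  define h where "h = (1 / \<alpha> y) *s y"
  have h: "\<alpha> h = 1" using y assms(2) by (simp add: h_def dual_scale)
  obtain g where "g \<in> sym_algebra" "\<forall>x. p x - p (x - \<alpha> x *s h) = \<alpha> x * g x"
    using diff_projection_divisible[OF assms(1,2), of "\<lambda>x. x - \<alpha> x *s h" h] by auto
  moreover have "p (x - \<alpha> x *s h) = 0" for x
    using van assms(2) h by (simp add: dual_diff dual_scale)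
  ultimately show "\<exists>g\<in>sym_algebra. p = \<alpha> * g" by (auto simp: fun_eq_iff)
qed

text \<open>No factor vanishes identically on the kernel of \<alpha>, so the factors can be
  cancelled there one at a time.\<close>

lemma vanishes_cancel_prod:
  assumes "finite A" "A \<subseteq> dual_space" "\<alpha> \<in> dual_space" "p \<in> sym_algebra"
    and indep: "\<And>\<beta>. \<beta> \<in> A \<Longrightarrow> \<exists>y. \<alpha> y = 0 \<and> \<beta> y \<noteq> 0"
    and "\<And>x. \<alpha> x = 0 \<Longrightarrow> (\<Prod>A * p) x = 0"
    and "\<alpha> x = 0"
  shows "p x = 0"
  using assms(1,2,5,6,7)
proof (induction A arbitrary: x rule: finite_induct)
  case (insert b A)
  obtain y where y: "\<alpha> y = 0" "b y \<noteq> 0" using insert.prems(2)[of b] by auto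
  have mem: "\<Prod>A * p \<in> sym_algebra"
    using insert.prems assms(4) by (intro sym_algebra.mult sym_algebra_prod) (auto intro: sym_algebra.linear)
  have "b x * (\<Prod>A * p) x = 0" if "\<alpha> x = 0" for x
    using insert.prems(3)[OF that] insert.hyps by (simp add: mult.assoc)
  then have "(\<Prod>A * p) x = 0" if "\<alpha> x = 0" for x
    using vanishes_cancel_linear[of "\<Prod>A * p" b \<alpha> y x] mem assms(3) y that insert.prems(1) by blast
  then show ?case using insert.IH insert.prems by auto
qed auto

text \<open>Takes the place of unique factorisation: no member of \<open>A\<close> vanishes on the
  kernel of another, so after some factors are split off the quotient still vanishes on the kernel
  of the next.\<close>

lemma divisible_by_prod_linear:
  assumes "finite A" "A \<subseteq> dual_space" "0 \<notin> A" "p \<in> sym_algebra"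
    and indep: "\<And>\<alpha> \<beta>. \<alpha> \<in> A \<Longrightarrow> \<beta> \<in> A \<Longrightarrow> \<alpha> \<noteq> \<beta> \<Longrightarrow> \<exists>y. \<alpha> y = 0 \<and> \<beta> y \<noteq> 0"
    and "\<And>\<alpha> x. \<alpha> \<in> A \<Longrightarrow> \<alpha> x = 0 \<Longrightarrow> p x = 0"
  shows "\<exists>g\<in>sym_algebra. p = \<Prod>A * g"
  using assms(1,2,3,5,6)
proof (induction A rule: finite_induct)
  case empty
  then show ?case using assms(4) by auto
next
  case (insert a A)
  have a: "a \<in> dual_space" "a \<noteq> 0" using insert.prems by auto
  have "\<exists>g\<in>sym_algebra. p = \<Prod>A * g"
    by (rule insert.IH) (use insert.prems in auto)
  then obtain g where g: "g \<in> sym_algebra" "p = \<Prod>A * g" by blast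
  have "g x = 0" if "a x = 0" for x
  proof (rule vanishes_cancel_prod[OF insert.hyps(1) _ a(1) g(1) _ _ that])
    show "A \<subseteq> dual_space" using insert.prems by auto
    show "\<exists>y. a y = 0 \<and> b y \<noteq> 0" if "b \<in> A" for b
      using insert.prems(3)[of a b] insert.hyps that by auto
    show "(\<Prod>A * g) x = 0" if "a x = 0" for x
      using insert.prems(4)[of a x] that g(2) by auto
  qed
  then obtain k where "k \<in> sym_algebra" "g = a * k"
    using divisible_by_linear_iff[OF g(1) a] by blast
  then show ?case using g(2) insert.hyps by (auto intro!: bexI[of _ k] simp: ac_simps)
qed

section \<open>Homogeneity and degree\<close>

lemma homogeneous_diff: "homogeneous d p \<Longrightarrow> homogeneous d q \<Longrightarrow> homogeneous d (p - q)"
  by (auto simp: homogeneous_def sym_algebra_diff right_diff_distrib)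

lemma homogeneous_prod_linear:
  assumes "finite A" "A \<subseteq> dual_space"
  shows "homogeneous (card A) (\<Prod>A)"
proof -
  have "\<Prod>A \<in> sym_algebra"
    using assms by (intro sym_algebra_prod) (auto intro: sym_algebra.linear)
  moreover have "(\<Prod>A) (c *s x) = c ^ card A * (\<Prod>A) x" for c x
  proof -
    have "(\<Prod>A) (c *s x) = (\<Prod>\<beta>\<in>A. c * \<beta> x)"
      unfolding prod_fun_apply using assms(2) by (intro prod.cong) (auto simp: dual_scale)
    then show ?thesis by (simp add: prod.distrib prod_fun_apply)
  qed
  ultimately show ?thesis by (simp add: homogeneous_def)
qed

text \<open>Along the ray through \<open>x\<close>, the product contributes
  \<open>t ^ card A\<close> while the whole scales by \<open>t ^ d\<close>. After
  \<open>t ^ d\<close> is cancelled, a constant equals a polynomial divisible by a positive power of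
  \<open>t\<close>, and \<open>t = 0\<close> shows that the constant is 0.\<close>

lemma homogeneous_prod_linear_mult_eq_0:
  assumes "finite A" "A \<subseteq> dual_space" "g \<in> sym_algebra"
    and hom: "homogeneous d (\<Prod>A * g)" and "d < card A"
  shows "\<Prod>A * g = 0"
proof
  fix x
  obtain q where q: "\<forall>t. g (0 + t *s x) = poly q t" using sym_algebra_on_line[OF assms(3)] by blast
  define r where "r = [:(\<Prod>A * g) x:] - smult ((\<Prod>A) x) (monom 1 (card A - d) * q)"
  have "poly r t = 0" if "t \<noteq> 0" for t
  proof -
    have "t ^ d * (\<Prod>A * g) x = (\<Prod>A) (t *s x) * g (t *s x)"
      using hom by (simp add: homogeneous_def)
    also have "\<dots> = t ^ d * (t ^ (card A - d) * (\<Prod>A) x * poly q t)"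
      using homogeneous_prod_linear[OF assms(1,2)] q \<open>d < card A\<close>
      by (simp add: homogeneous_def mult.assoc power_add[symmetric])
    finally show ?thesis using that by (simp add: r_def poly_monom)
  qed
  then have "r = 0" by (rule poly_eq_0_if_zero_except_one_point)
  then have "poly r 0 = 0" by simp
  then show "(\<Prod>A * g) x = 0 x" using \<open>d < card A\<close> by (simp add: r_def poly_monom zero_power)
qed

text \<open>Scaling by 0 is permitted and \<open>0 ^ 0 = 1\<close>, so a function of degree 0 takes
  everywhere its value at the origin, where \<alpha> vanishes.\<close>

lemma homogeneous_0_linear_mult:
  assumes "\<alpha> \<in> dual_space" "homogeneous 0 (\<alpha> * g)"
  shows "\<alpha> * g = 0"
proof
  fix x
  have "(\<alpha> * g) (0 *s x) = (\<alpha> * g) x" using assms(2) unfolding homogeneous_def by (metis power_0 mult_1)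
  then show "(\<alpha> * g) x = 0 x" using assms(1) by (simp add: dual_zero)
qed

text \<open>For \<open>c \<noteq> 0\<close>, one factor c and then \<alpha> are cancelled from the
  scaling identity. The scalar 0 needs a separate argument.\<close>

lemma homogeneous_linear_factor:
  assumes "\<alpha> \<in> dual_space" "\<alpha> \<noteq> 0" "g \<in> sym_algebra" and hom: "homogeneous (Suc d) (\<alpha> * g)"
  shows "homogeneous d g"
proof -
  have nz: "g (c *s x) = c ^ d * g x" if "c \<noteq> 0" for c x
  proof -
    define k where "k = g \<circ> (\<lambda>x. c *s x)"
    define l where "l = (\<lambda>x. c ^ d) * g"
    have "k \<in> sym_algebra"
      unfolding k_def by (rule sym_algebra_comp_linear[OF assms(3)])
        (auto simp: dual_space_iff vector_add_ldistrib mult.left_commute)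
    moreover have "l \<in> sym_algebra" unfolding l_def by (intro sym_algebra.intros assms(3))
    moreover have "\<alpha> * k = \<alpha> * l"
    proof
      fix x
      have "c * \<alpha> x * g (c *s x) = c * c ^ d * (\<alpha> x * g x)"
        using hom assms(1) unfolding homogeneous_def
        by (metis dual_scale power_Suc times_fun_apply)
      then have "\<alpha> x * g (c *s x) = c ^ d * (\<alpha> x * g x)" using that by (simp add: mult.assoc)
      then show "(\<alpha> * k) x = (\<alpha> * l) x" by (simp add: k_def l_def)
    qed
    ultimately have "k = l" using linear_mult_cancel assms(1,2) by blast
    then show ?thesis by (simp add: k_def l_def fun_eq_iff)
  qed
  have "g (c *s x) = c ^ d * g x" for c x
  proof -
    obtain q where q: "\<forall>t. g (0 + t *s x) = poly q t" using sym_algebra_on_line[OF assms(3)] by blast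
    \<comment> \<open>Both sides are polynomial in the scaling factor and agree away from 0, hence
      also at 0.\<close>
    define r where "r = q - monom (g x) d"
    have "poly r t = 0" if "t \<noteq> 0" for t
      using nz[of t x] that q by (simp add: r_def poly_monom mult.commute)
    then have "r = 0" by (rule poly_eq_0_if_zero_except_one_point)
    then have "poly r c = 0" by simp
    then show ?thesis using q by (simp add: r_def poly_monom mult.commute)
  qed
  then show ?thesis using assms(3) by (simp add: homogeneous_def)
qed

section \<open>Linear combinations\<close>

lemma lin_comb_apply: "lin_comb I c b w x = (\<Sum>i\<in>I. c i x * b i w x)"
  by (simp add: lin_comb_def sum_fun_apply)

lemma lin_comb_cong:
  "(\<And>i. i \<in> I \<Longrightarrow> c i = c' i) \<Longrightarrow> (\<And>i. i \<in> I \<Longrightarrow> b i = b' i) \<Longrightarrow> lin_comb I c b = lin_comb I c' b'"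
  unfolding lin_comb_def by (intro ext sum.cong) simp_all

lemma lin_comb_zero: "lin_comb I (\<lambda>i. 0) b = 0"
  by (intro ext) (simp add: lin_comb_apply)

lemma lin_comb_add: "lin_comb I c b + lin_comb I d b = lin_comb I (\<lambda>i. c i + d i) b"
  by (intro ext) (simp add: lin_comb_apply distrib_right sum.distrib)

lemma lin_comb_diff: "lin_comb I c b - lin_comb I d b = lin_comb I (\<lambda>i. c i - d i) b"
  by (intro ext) (simp add: lin_comb_apply left_diff_distrib sum_subtractf)

lemma lin_comb_unit: "finite I \<Longrightarrow> i \<in> I \<Longrightarrow> lin_comb I (\<lambda>j. if j = i then 1 else 0) b = b i"
  by (intro ext) (simp add: lin_comb_apply if_distribR if_distrib cong: if_cong)

lemma lin_comb_lin_comb: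
  "lin_comb I c (\<lambda>i. lin_comb J (d i) b) = lin_comb J (\<lambda>j. \<Sum>i\<in>I. c i * d i j) b"
proof (intro ext)
  fix w x
  have "lin_comb I c (\<lambda>i. lin_comb J (d i) b) w x = (\<Sum>i\<in>I. \<Sum>j\<in>J. c i x * d i j x * b j w x)"
    by (simp add: lin_comb_apply sum_distrib_left mult.assoc)
  also have "\<dots> = (\<Sum>j\<in>J. \<Sum>i\<in>I. c i x * d i j x * b j w x)" by (rule sum.swap)
  also have "\<dots> = lin_comb J (\<lambda>j. \<Sum>i\<in>I. c i * d i j) b w x"
    by (simp add: lin_comb_apply sum_fun_apply sum_distrib_right)
  finally show "lin_comb I c (\<lambda>i. lin_comb J (d i) b) w x
    = lin_comb J (\<lambda>j. \<Sum>i\<in>I. c i * d i j) b w x" .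
qed

text \<open>The rank \<open>\<mu>\<close> need not order \<open>I\<close> totally: distinct indices
  of equal rank simply have coefficient 0. Spanning is solved upwards in rank; for independence, the
  coefficient is read off at an index of maximal rank in the support.\<close>

lemma sym_basis_unitriangular:
  fixes \<mu> :: "'i \<Rightarrow> nat"
  assumes I: "finite I" and basis: "sym_basis M I b" and M: "\<And>u. u \<in> I \<Longrightarrow> b' u \<in> M"
    and exp: "\<And>u. u \<in> I \<Longrightarrow> b' u = lin_comb I (a u) b"
    and a_sym: "\<And>u v. u \<in> I \<Longrightarrow> v \<in> I \<Longrightarrow> a u v \<in> sym_algebra"
    and a_diag: "\<And>u. u \<in> I \<Longrightarrow> a u u = 1"
    and a_tri: "\<And>u v. u \<in> I \<Longrightarrow> v \<in> I \<Longrightarrow> a u v \<noteq> 0 \<Longrightarrow> v = u \<or> \<mu> v < \<mu> u"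
  shows "sym_basis M I b'"
proof -
  have span_b: "\<exists>c \<in> I \<rightarrow> sym_algebra. f = lin_comb I c b" if "f \<in> M" for f
    using basis that unfolding sym_basis_def by simp
  have indep_b: "c i = 0" if "\<And>i. i \<in> I \<Longrightarrow> c i \<in> sym_algebra" "lin_comb I c b = 0" "i \<in> I" for c i
  proof -
    have "c \<in> I \<rightarrow> sym_algebra" using that(1) by blast
    then show ?thesis using basis that(2,3) unfolding sym_basis_def by blast
  qed
  have "\<exists>d. (\<forall>w\<in>I. d w \<in> sym_algebra) \<and> b u = lin_comb I d b'" if "u \<in> I" for u
    using that
  proof (induction "\<mu> u" arbitrary: u rule: less_induct)
    case less
    then have "\<forall>v. \<exists>d. v \<in> I \<and> \<mu> v < \<mu> u \<longrightarrow> (\<forall>w\<in>I. d w \<in> sym_algebra) \<and> b v = lin_comb I d b'"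
      by metis
    then obtain D where D: "\<And>v w. v \<in> I \<Longrightarrow> \<mu> v < \<mu> u \<Longrightarrow> w \<in> I \<Longrightarrow> D v w \<in> sym_algebra"
      "\<And>v. v \<in> I \<Longrightarrow> \<mu> v < \<mu> u \<Longrightarrow> b v = lin_comb I (D v) b'" by metis
    let ?J = "{v \<in> I. \<mu> v < \<mu> u}"
    have "b u = b' u - lin_comb ?J (a u) b"
    proof (intro ext)
      fix w x
      have "b' u w x = (\<Sum>v\<in>I. a u v x * b v w x)" unfolding exp[OF less.prems] lin_comb_apply ..
      also have "\<dots> = (\<Sum>v\<in>insert u ?J. a u v x * b v w x)"
      proof (rule sum.mono_neutral_right[OF I])
        show "insert u ?J \<subseteq> I" using less.prems by blast
        show "\<forall>v\<in>I - insert u ?J. a u v x * b v w x = 0"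
        proof
          fix v assume "v \<in> I - insert u ?J"
          then have "a u v = 0" using a_tri[OF less.prems, of v] by blast
          then show "a u v x * b v w x = 0" by simp
        qed
      qed
      also have "\<dots> = b u w x + lin_comb ?J (a u) b w x"
        using I a_diag[OF less.prems] by (simp add: lin_comb_apply)
      finally show "b u w x = (b' u - lin_comb ?J (a u) b) w x" by simp
    qed
    also have "b' u = lin_comb I (\<lambda>j. if j = u then 1 else 0) b'" using lin_comb_unit I less.prems by metis
    also have "lin_comb ?J (a u) b = lin_comb ?J (a u) (\<lambda>v. lin_comb I (D v) b')"
      using D(2) by (intro lin_comb_cong) simp_all
    also have "\<dots> = lin_comb I (\<lambda>j. \<Sum>v\<in>?J. a u v * D v j) b'" by (rule lin_comb_lin_comb)
    finally have eq: "b u = lin_comb I (\<lambda>j. (if j = u then 1 else 0) - (\<Sum>v\<in>?J. a u v * D v j)) b'"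
      unfolding lin_comb_diff .
    have mem: "(if j = u then 1 else 0) - (\<Sum>v\<in>?J. a u v * D v j) \<in> sym_algebra" if "j \<in> I" for j
    proof (rule sym_algebra_diff)
      show "(if j = u then 1 else 0) \<in> sym_algebra" using sym_algebra_one sym_algebra_zero by metis
      show "(\<Sum>v\<in>?J. a u v * D v j) \<in> sym_algebra"
        using a_sym[OF less.prems] D(1) that by (intro sym_algebra_sum sym_algebra.mult) simp_all
    qed
    show ?case by (rule exI, rule conjI[OF ballI[OF mem] eq])
  qed
  then obtain d where d: "\<And>u w. u \<in> I \<Longrightarrow> w \<in> I \<Longrightarrow> d u w \<in> sym_algebra"
    "\<And>u. u \<in> I \<Longrightarrow> b u = lin_comb I (d u) b'" by metis
  have span: "\<exists>c \<in> I \<rightarrow> sym_algebra. f = lin_comb I c b'" if "f \<in> M" for f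
  proof -
    obtain c where c: "c \<in> I \<rightarrow> sym_algebra" "f = lin_comb I c b"
      using span_b[OF \<open>f \<in> M\<close>] by blast
    have "f = lin_comb I c (\<lambda>u. lin_comb I (d u) b')"
      unfolding c(2) using d(2) by (intro lin_comb_cong) simp_all
    then have eq: "f = lin_comb I (\<lambda>j. \<Sum>i\<in>I. c i * d i j) b'" unfolding lin_comb_lin_comb .
    have "(\<lambda>j. \<Sum>i\<in>I. c i * d i j) \<in> I \<rightarrow> sym_algebra"
      using c(1) d(1) by (intro Pi_I sym_algebra_sum sym_algebra.mult) auto
    then show ?thesis using eq by blast
  qed
  have indep: "\<forall>i\<in>I. c i = 0" if c: "c \<in> I \<rightarrow> sym_algebra" "lin_comb I c b' = 0" for c
  proof (rule ccontr)
    assume "\<not> (\<forall>i\<in>I. c i = 0)"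
    then have ne: "{i \<in> I. c i \<noteq> 0} \<noteq> {}" by blast
    have "finite {i \<in> I. c i \<noteq> 0}" using I by simp
    from finite_imageI[OF this, of \<mu>] have "Max (\<mu> ` {i \<in> I. c i \<noteq> 0}) \<in> \<mu> ` {i \<in> I. c i \<noteq> 0}"
      and le: "\<And>k. k \<in> I \<Longrightarrow> c k \<noteq> 0 \<Longrightarrow> \<mu> k \<le> Max (\<mu> ` {i \<in> I. c i \<noteq> 0})"
      using ne by (auto intro!: Max_in Max_ge)
    then obtain i where i: "i \<in> I" "c i \<noteq> 0" "\<And>k. k \<in> I \<Longrightarrow> c k \<noteq> 0 \<Longrightarrow> \<mu> k \<le> \<mu> i" by auto
    have "lin_comb I c b' = lin_comb I c (\<lambda>u. lin_comb I (a u) b)"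
      using exp by (intro lin_comb_cong) simp_all
    then have zero: "lin_comb I (\<lambda>j. \<Sum>k\<in>I. c k * a k j) b = 0"
      using c(2) unfolding lin_comb_lin_comb by simp
    have "(\<Sum>k\<in>I. c k * a k j) \<in> sym_algebra" if "j \<in> I" for j
      using c(1) a_sym that by (intro sym_algebra_sum sym_algebra.mult) auto
    from indep_b[OF this zero i(1)] have "(\<Sum>k\<in>I. c k * a k i) = 0" .
    \<comment> \<open>For \<open>k \<noteq> i\<close> a nonzero term needs
      \<open>c k \<noteq> 0\<close>, so \<open>\<mu> k \<le> \<mu> i\<close> by maximality, and
      \<open>a k i \<noteq> 0\<close>, so \<open>\<mu> i < \<mu> k\<close>.\<close>
    also have "(\<Sum>k\<in>I. c k * a k i) = (\<Sum>k\<in>{i}. c k * a k i)"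
    proof (rule sum.mono_neutral_right[OF I])
      show "{i} \<subseteq> I" using i(1) by simp
      show "\<forall>k\<in>I - {i}. c k * a k i = 0"
      proof
        fix k assume "k \<in> I - {i}"
        then have "c k = 0 \<or> a k i = 0" using i(3)[of k] a_tri[of k i] i(1) by fastforce
        then show "c k * a k i = 0" by (metis mult_zero_left mult_zero_right)
      qed
    qed
    also have "\<dots> = c i * a i i" by simp
    finally have "c i * a i i = 0" .
    then show False using i(2) a_diag[OF i(1)] by (metis mult_1_right)
  qed
  show ?thesis unfolding sym_basis_def using indep by (intro conjI ballI impI Pi_I M span) blast+
qed

section \<open>Root systems and their Weyl groups\<close>

locale based_root_system =
  fixes \<Phi> B :: "('k::field_char_0 ^ 'n::finite \<Rightarrow> 'k) set"
  assumes root_system: "root_system \<Phi>" and root_base: "root_base \<Phi> B"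
begin

abbreviation W where "W \<equiv> weyl_group \<Phi>"
abbreviation pos where "pos \<equiv> pos_roots \<Phi> B"
abbreviation \<sigma> where "\<sigma> \<equiv> root_refl \<Phi>"
abbreviation len where "len \<equiv> weyl_length \<Phi> B"

definition coroot where "coroot \<beta> = (THE h. is_coroot \<Phi> \<beta> h)"

lemma finite_roots: "finite \<Phi>"
  and root_dual: "\<beta> \<in> \<Phi> \<Longrightarrow> \<beta> \<in> dual_space"
  and zero_not_root: "0 \<notin> \<Phi>"
  and root_multiple: "\<beta> \<in> \<Phi> \<Longrightarrow> (\<lambda>x. c * \<beta> x) \<in> \<Phi> \<Longrightarrow> c = 1 \<or> c = - 1"
proof -
  note rs = root_system[unfolded root_system_def]
  show "finite \<Phi>" "0 \<notin> \<Phi>" using rs by simp_all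
  show "\<beta> \<in> \<Phi> \<Longrightarrow> \<beta> \<in> dual_space" using rs by (elim conjE subsetD)
  have "\<forall>\<alpha>\<in>\<Phi>. \<forall>c. (\<lambda>x. c * \<alpha> x) \<in> \<Phi> \<longrightarrow> c = 1 \<or> c = - 1"
    using rs by (elim conjE)
  then show "\<beta> \<in> \<Phi> \<Longrightarrow> (\<lambda>x. c * \<beta> x) \<in> \<Phi> \<Longrightarrow> c = 1 \<or> c = - 1" by simp
qed

text \<open>The roots span the dual space, so each coordinate is a combination of roots.\<close>

lemma roots_separate:
  assumes "\<And>\<beta>. \<beta> \<in> \<Phi> \<Longrightarrow> \<beta> x = \<beta> y" shows "x = y"
proof -
  have "x $ i = y $ i" for i
  proof -
    obtain c where "(\<lambda>x. x $ i) = (\<lambda>x. \<Sum>\<beta>\<in>\<Phi>. c \<beta> * \<beta> x)"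
      using root_system dual_coordinate[of i] unfolding root_system_def by metis
    then have "x $ i = (\<Sum>\<beta>\<in>\<Phi>. c \<beta> * \<beta> x)" "y $ i = (\<Sum>\<beta>\<in>\<Phi>. c \<beta> * \<beta> y)"
      by (simp_all add: fun_eq_iff)
    moreover have "(\<Sum>\<beta>\<in>\<Phi>. c \<beta> * \<beta> x) = (\<Sum>\<beta>\<in>\<Phi>. c \<beta> * \<beta> y)"
      using assms by (intro sum.cong) auto
    ultimately show ?thesis by simp
  qed
  then show ?thesis by (simp add: vec_eq_iff)
qed

text \<open>
  The product of two reflections along \<open>\<beta>\<close> is the transvection \<open>x \<mapsto> x + \<beta> x *s (h - h')\<close>, which
  has infinite order unless \<open>h = h'\<close>, yet permutes the finite set of roots.
\<close>

lemma coroot_unique: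
  assumes "\<beta> \<in> \<Phi>" "is_coroot \<Phi> \<beta> h" "is_coroot \<Phi> \<beta> h'"
  shows "h = h'"
proof (rule roots_separate)
  fix \<phi> assume "\<phi> \<in> \<Phi>"
  define d where "d = h - h'"
  have \<beta>: "\<beta> \<in> dual_space" "\<beta> h = 2" "\<beta> h' = 2" "\<beta> d = 0"
    using assms root_dual by (auto simp: is_coroot_def d_def dual_diff)
  have closed: "(\<lambda>x. \<psi> (x + \<beta> x *s d)) \<in> \<Phi>" if "\<psi> \<in> \<Phi>" for \<psi>
  proof -
    have "\<psi> \<circ> reflection \<beta> h \<circ> reflection \<beta> h' \<in> \<Phi>"
      using that assms(2,3) unfolding is_coroot_def by blast
    moreover have "\<psi> \<circ> reflection \<beta> h \<circ> reflection \<beta> h' = (\<lambda>x. \<psi> (x + \<beta> x *s d))"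
      using \<beta> by (simp add: fun_eq_iff reflection_def d_def dual_diff dual_scale
          vector_ssub_ldistrib algebra_simps)
    ultimately show ?thesis by simp
  qed
  have mem: "(\<lambda>x. \<phi> x + of_nat n * \<phi> d * \<beta> x) \<in> \<Phi>" for n
  proof (induction n)
    case 0
    then show ?case using \<open>\<phi> \<in> \<Phi>\<close> by simp
  next
    case (Suc n)
    from closed[OF this] show ?case
      using \<beta> root_dual[OF \<open>\<phi> \<in> \<Phi>\<close>] by (simp add: dual_add dual_scale algebra_simps)
  qed
  show "\<phi> h = \<phi> h'"
  proof (rule ccontr)
    assume "\<phi> h \<noteq> \<phi> h'"
    then have "\<phi> d \<noteq> 0" using root_dual[OF \<open>\<phi> \<in> \<Phi>\<close>] by (simp add: d_def dual_diff)
    then have "inj (\<lambda>n::nat. (\<lambda>x. \<phi> x + of_nat n * \<phi> d * \<beta> x))"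
      using \<beta>(2) by (intro injI) (auto dest!: fun_cong[of _ _ h])
    moreover have "range (\<lambda>n::nat. (\<lambda>x. \<phi> x + of_nat n * \<phi> d * \<beta> x)) \<subseteq> \<Phi>" using mem by auto
    ultimately show False using finite_roots by (meson finite_imageD finite_subset infinite_UNIV_nat)
  qed
qed

lemma coroot:
  assumes "\<beta> \<in> \<Phi>"
  shows is_coroot_coroot: "is_coroot \<Phi> \<beta> (coroot \<beta>)"
    and coroot_integral: "\<And>\<phi>. \<phi> \<in> \<Phi> \<Longrightarrow> \<phi> (coroot \<beta>) \<in> \<int>"
proof -
  obtain h where h: "is_coroot \<Phi> \<beta> h" "\<forall>\<phi>\<in>\<Phi>. \<phi> h \<in> \<int>"
    using root_system assms unfolding root_system_def by blast
  then have "coroot \<beta> = h"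
    unfolding coroot_def using coroot_unique[OF assms] by blast
  then show "is_coroot \<Phi> \<beta> (coroot \<beta>)" "\<And>\<phi>. \<phi> \<in> \<Phi> \<Longrightarrow> \<phi> (coroot \<beta>) \<in> \<int>" using h by auto
qed

lemma root_coroot: "\<beta> \<in> \<Phi> \<Longrightarrow> \<beta> (coroot \<beta>) = 2"
  using is_coroot_coroot by (simp add: is_coroot_def)

lemma refl_apply: "\<sigma> \<beta> x = x - \<beta> x *s coroot \<beta>"
  by (simp add: root_refl_def reflection_def coroot_def)

lemma refl_eqI:
  assumes "\<beta> \<in> \<Phi>" "is_coroot \<Phi> \<beta> h" shows "\<sigma> \<beta> = reflection \<beta> h"
  using coroot_unique[OF assms(1) is_coroot_coroot assms(2)] assms(1)
  by (simp add: fun_eq_iff refl_apply reflection_def)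

lemma root_comp_refl: "\<beta> \<in> \<Phi> \<Longrightarrow> \<phi> \<in> \<Phi> \<Longrightarrow> \<phi> \<circ> \<sigma> \<beta> \<in> \<Phi>"
proof -
  assume "\<beta> \<in> \<Phi>" "\<phi> \<in> \<Phi>"
  then have "\<phi> \<circ> reflection \<beta> (coroot \<beta>) \<in> \<Phi>"
    using is_coroot_coroot unfolding is_coroot_def by blast
  then show ?thesis by (simp only: root_refl_def coroot_def)
qed

lemma root_refl_neg: "\<beta> \<in> \<Phi> \<Longrightarrow> \<beta> (\<sigma> \<beta> x) = - \<beta> x"
  by (simp add: refl_apply root_dual dual_diff dual_scale root_coroot)

lemma refl_fixes: "\<beta> x = 0 \<Longrightarrow> \<sigma> \<beta> x = x"
  by (simp add: refl_apply)

lemma refl_refl: "\<beta> \<in> \<Phi> \<Longrightarrow> \<sigma> \<beta> (\<sigma> \<beta> x) = x"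
proof -
  assume "\<beta> \<in> \<Phi>"
  have "\<sigma> \<beta> (\<sigma> \<beta> x) = \<sigma> \<beta> x - \<beta> (\<sigma> \<beta> x) *s coroot \<beta>" by (rule refl_apply)
  also have "\<dots> = \<sigma> \<beta> x + \<beta> x *s coroot \<beta>" using \<open>\<beta> \<in> \<Phi>\<close> by (simp add: root_refl_neg)
  also have "\<dots> = x" by (simp add: refl_apply)
  finally show ?thesis .
qed

lemma refl_comp_refl: "\<beta> \<in> \<Phi> \<Longrightarrow> \<sigma> \<beta> \<circ> \<sigma> \<beta> = id"
  by (simp add: fun_eq_iff refl_refl)

lemma uminus_root: "\<beta> \<in> \<Phi> \<Longrightarrow> - \<beta> \<in> \<Phi>"
proof -
  assume "\<beta> \<in> \<Phi>"
  then have "\<beta> \<circ> \<sigma> \<beta> = - \<beta>" by (simp add: fun_eq_iff root_refl_neg)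
  then show ?thesis using root_comp_refl[of \<beta> \<beta>] \<open>\<beta> \<in> \<Phi>\<close> by simp
qed

lemma refl_add: "\<beta> \<in> \<Phi> \<Longrightarrow> \<sigma> \<beta> (x + y) = \<sigma> \<beta> x + \<sigma> \<beta> y"
  by (simp add: refl_apply root_dual dual_add vec.scale_left_distrib)

lemma refl_scale: "\<beta> \<in> \<Phi> \<Longrightarrow> \<sigma> \<beta> (c *s x) = c *s \<sigma> \<beta> x"
  by (simp add: refl_apply root_dual dual_scale vec.scale_right_diff_distrib)

section \<open>The Weyl group as a finite group of linear maps permuting the roots\<close>

lemma refl_in_weyl: "\<beta> \<in> \<Phi> \<Longrightarrow> \<sigma> \<beta> \<in> W"
  using weyl_group.step[OF weyl_group.one, of \<beta> \<Phi>] by simp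

lemma weyl_comp: "w' \<in> W \<Longrightarrow> w \<in> W \<Longrightarrow> w \<circ> w' \<in> W"
proof (induction rule: weyl_group.induct)
  case (step w' \<beta>)
  then have "w \<circ> w' \<circ> \<sigma> \<beta> \<in> W" using weyl_group.step by blast
  then show ?case unfolding o_assoc .
qed simp

lemma weyl_inverse_exists: "w \<in> W \<Longrightarrow> \<exists>w'\<in>W. w' \<circ> w = id \<and> w \<circ> w' = id"
proof (induction rule: weyl_group.induct)
  case one
  then show ?case using weyl_group.one by (metis comp_id)
next
  case (step w \<beta>)
  then obtain w' where w': "w' \<in> W" "w' \<circ> w = id" "w \<circ> w' = id" by blast
  have "\<sigma> \<beta> \<circ> w' \<in> W" using w'(1) step refl_in_weyl weyl_comp by blast
  moreover have "(\<sigma> \<beta> \<circ> w') \<circ> (w \<circ> \<sigma> \<beta>) = id" "(w \<circ> \<sigma> \<beta>) \<circ> (\<sigma> \<beta> \<circ> w') = id"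
    using w'(2,3) step.hyps(2) by (simp_all add: fun_eq_iff refl_refl)
  ultimately show ?case by blast
qed

lemma weyl_bij: "w \<in> W \<Longrightarrow> bij w"
  using weyl_inverse_exists o_bij by blast

lemma weyl_inv: "w \<in> W \<Longrightarrow> inv w \<in> W"
  using weyl_inverse_exists by (metis inv_unique_comp)

lemma weyl_inv_left: "w \<in> W \<Longrightarrow> inv w (w x) = x"
  and weyl_inv_right: "w \<in> W \<Longrightarrow> w (inv w x) = x"
  using inv_f_f[OF bij_is_inj[OF weyl_bij]] surj_f_inv_f[OF bij_is_surj[OF weyl_bij]] by blast+

lemma weyl_inv_inv: "w \<in> W \<Longrightarrow> inv (inv w) = w"
  using weyl_bij inv_inv_eq by blast

lemma weyl_add: "w \<in> W \<Longrightarrow> w (x + y) = w x + w y"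
  and weyl_scale: "w \<in> W \<Longrightarrow> w (c *s x) = c *s w x"
proof -
  have "(\<forall>x y. w (x + y) = w x + w y) \<and> (\<forall>c x. w (c *s x) = c *s w x)" if "w \<in> W"
    using that by induction (auto simp: refl_add refl_scale)
  then show "w \<in> W \<Longrightarrow> w (x + y) = w x + w y" "w \<in> W \<Longrightarrow> w (c *s x) = c *s w x" by auto
qed

lemma weyl_diff: "w \<in> W \<Longrightarrow> w (x - y) = w x - w y"
  by (metis add_diff_cancel_right' diff_add_cancel weyl_add)

lemma dual_comp_weyl: "w \<in> W \<Longrightarrow> \<phi> \<in> dual_space \<Longrightarrow> \<phi> \<circ> w \<in> dual_space"
  by (simp add: dual_space_iff weyl_add weyl_scale)

lemma root_comp_weyl: "w \<in> W \<Longrightarrow> \<phi> \<in> \<Phi> \<Longrightarrow> \<phi> \<circ> w \<in> \<Phi>"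
proof (induction arbitrary: \<phi> rule: weyl_group.induct)
  case (step w \<beta>)
  then have "\<phi> \<circ> w \<circ> \<sigma> \<beta> \<in> \<Phi>" using root_comp_refl by blast
  then show ?case unfolding o_assoc .
qed simp

lemma sym_algebra_comp_weyl: "w \<in> W \<Longrightarrow> p \<in> sym_algebra \<Longrightarrow> p \<circ> w \<in> sym_algebra"
  by (rule sym_algebra_comp_linear, assumption, rule dual_comp_weyl)

lemma homogeneous_comp_weyl: "w \<in> W \<Longrightarrow> homogeneous d p \<Longrightarrow> homogeneous d (p \<circ> w)"
  by (simp add: homogeneous_def sym_algebra_comp_weyl weyl_scale)

text \<open>\<open>inv w\<close> carries the coroot of \<gamma> to a vector with the defining
  properties of the coroot of \<open>\<gamma> \<circ> w\<close>, and coroots are unique. This is the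
  means of trading left for right multiplication by reflections.\<close>

lemma refl_conjugate:
  assumes "w \<in> W" "\<gamma> \<in> \<Phi>"
  shows "\<sigma> \<gamma> \<circ> w = w \<circ> \<sigma> (\<gamma> \<circ> w)"
proof -
  define h where "h = inv w (coroot \<gamma>)"
  have \<gamma>w: "\<gamma> \<circ> w \<in> \<Phi>" using assms root_comp_weyl by blast
  define t where "t = inv w \<circ> (\<sigma> \<gamma> \<circ> w)"
  have t: "reflection (\<gamma> \<circ> w) h = t"
    using assms by (simp add: fun_eq_iff reflection_def refl_apply h_def t_def weyl_diff weyl_scale
        weyl_inv weyl_inv_left)
  have "t \<in> W" unfolding t_def using assms refl_in_weyl weyl_comp weyl_inv by blast
  have invol: "\<phi> \<circ> t \<circ> t = \<phi>" for \<phi> :: "'k ^ 'n \<Rightarrow> 'k"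
    using assms by (simp add: fun_eq_iff t_def weyl_inv_right weyl_inv_left refl_refl)
  have "(\<lambda>\<phi>. \<phi> \<circ> t) ` \<Phi> = \<Phi>"
  proof
    show sub: "(\<lambda>\<phi>. \<phi> \<circ> t) ` \<Phi> \<subseteq> \<Phi>" using \<open>t \<in> W\<close> root_comp_weyl by blast
    show "\<Phi> \<subseteq> (\<lambda>\<phi>. \<phi> \<circ> t) ` \<Phi>"
    proof
      fix \<phi> assume "\<phi> \<in> \<Phi>"
      then have "\<phi> \<circ> t \<in> \<Phi>" using sub by blast
      from imageI[OF this, of "\<lambda>\<phi>. \<phi> \<circ> t"] show "\<phi> \<in> (\<lambda>\<phi>. \<phi> \<circ> t) ` \<Phi>"
        unfolding invol .
    qed
  qed
  moreover have "(\<gamma> \<circ> w) h = 2" using assms by (simp add: h_def weyl_inv_right root_coroot)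
  ultimately have "is_coroot \<Phi> (\<gamma> \<circ> w) h" unfolding is_coroot_def t by blast
  then have "\<sigma> (\<gamma> \<circ> w) = t" using refl_eqI[OF \<gamma>w] t by metis
  then show ?thesis using assms by (simp add: fun_eq_iff t_def weyl_inv_right)
qed

text \<open>Conjugating \<open>\<sigma> \<beta>\<close> by itself sends \<beta> to
  \<open>- \<beta>\<close>.\<close>

lemma refl_uminus:
  assumes "\<beta> \<in> \<Phi>" shows "\<sigma> (- \<beta>) = \<sigma> \<beta>"
proof -
  have neg: "\<beta> \<circ> \<sigma> \<beta> = - \<beta>" using assms by (simp add: fun_eq_iff root_refl_neg)
  have "\<sigma> \<beta> \<circ> \<sigma> \<beta> = \<sigma> \<beta> \<circ> \<sigma> (- \<beta>)"
    using refl_conjugate[OF refl_in_weyl assms] assms neg by simp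
  then have "\<sigma> \<beta> \<circ> (\<sigma> \<beta> \<circ> \<sigma> \<beta>) = \<sigma> \<beta> \<circ> (\<sigma> \<beta> \<circ> \<sigma> (- \<beta>))" by simp
  then show ?thesis using refl_comp_refl[OF assms] by (simp add: o_assoc)
qed

text \<open>The action on the finite set of roots is faithful, because roots separate
  points.\<close>

lemma finite_weyl: "finite W"
proof -
  define r where "r = (\<lambda>w :: 'k ^ 'n \<Rightarrow> 'k ^ 'n. restrict (\<lambda>\<phi>. \<phi> \<circ> w) \<Phi>)"
  have "inj_on r W"
  proof (rule inj_onI)
    fix v w assume "v \<in> W" "w \<in> W" "r v = r w"
    then have "\<phi> \<circ> v = \<phi> \<circ> w" if "\<phi> \<in> \<Phi>" for \<phi> using that by (metis r_def restrict_apply')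
    then have "v x = w x" for x by (intro roots_separate) (metis comp_apply)
    then show "v = w" by blast
  qed
  moreover have "r ` W \<subseteq> \<Phi> \<rightarrow>\<^sub>E \<Phi>" using root_comp_weyl by (auto simp: r_def)
  moreover have "finite (\<Phi> \<rightarrow>\<^sub>E \<Phi>)" using finite_roots by (simp add: finite_PiE)
  ultimately show ?thesis by (meson finite_imageD finite_subset)
qed

section \<open>Positive roots and simple reflections\<close>

lemma base_subset: "B \<subseteq> \<Phi>"
  and base_independent: "(\<lambda>x. \<Sum>\<alpha>\<in>B. c \<alpha> * \<alpha> x) = 0 \<Longrightarrow> \<alpha> \<in> B \<Longrightarrow> c \<alpha> = 0"
proof -
  note rb = root_base[unfolded root_base_def]
  show "B \<subseteq> \<Phi>" using rb by (elim conjE)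
  have "\<forall>c. (\<lambda>x. \<Sum>\<alpha>\<in>B. c \<alpha> * \<alpha> x) = 0 \<longrightarrow> (\<forall>\<alpha>\<in>B. c \<alpha> = 0)" using rb by (elim conjE)
  then show "(\<lambda>x. \<Sum>\<alpha>\<in>B. c \<alpha> * \<alpha> x) = 0 \<Longrightarrow> \<alpha> \<in> B \<Longrightarrow> c \<alpha> = 0" by simp
qed

lemma finite_base: "finite B"
  using base_subset finite_roots finite_subset by blast

lemma base_coeff_eq:
  assumes "\<And>x. (\<Sum>\<alpha>\<in>B. c \<alpha> * \<alpha> x) = (\<Sum>\<alpha>\<in>B. d \<alpha> * \<alpha> x)" "\<alpha> \<in> B"
  shows "c \<alpha> = d \<alpha>"
proof -
  have "(\<lambda>x. \<Sum>\<alpha>\<in>B. (c \<alpha> - d \<alpha>) * \<alpha> x) = 0"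
    using assms(1) by (simp add: fun_eq_iff left_diff_distrib sum_subtractf)
  from base_independent[OF this assms(2)] show ?thesis by simp
qed

lemma pos_subset: "pos \<subseteq> \<Phi>"
  by (auto simp: pos_roots_def)

lemma pos_dual: "pos \<subseteq> dual_space"
  using pos_subset root_dual by blast

lemma finite_pos: "finite pos"
  using pos_subset finite_roots finite_subset by blast

lemma zero_not_pos: "0 \<notin> pos"
  using pos_subset zero_not_root by blast

lemma pos_or_neg: "\<beta> \<in> \<Phi> \<Longrightarrow> \<beta> \<in> pos \<or> - \<beta> \<in> pos"
proof -
  assume "\<beta> \<in> \<Phi>"
  moreover have "\<forall>\<beta>\<in>\<Phi>. \<exists>m :: _ \<Rightarrow> nat.
        \<beta> = (\<lambda>x. \<Sum>\<alpha>\<in>B. of_nat (m \<alpha>) * \<alpha> x) \<or> - \<beta> = (\<lambda>x. \<Sum>\<alpha>\<in>B. of_nat (m \<alpha>) * \<alpha> x)"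
    using root_base[unfolded root_base_def] by (elim conjE)
  ultimately show ?thesis using uminus_root[of \<beta>] unfolding pos_roots_def mem_Collect_eq
    by (metis (no_types))
qed

lemma pos_not_neg:
  assumes "\<beta> \<in> pos" shows "- \<beta> \<notin> pos"
proof
  assume "- \<beta> \<in> pos"
  obtain m where m: "\<beta> = (\<lambda>x. \<Sum>\<alpha>\<in>B. of_nat (m \<alpha>) * \<alpha> x)"
    using assms by (auto simp: pos_roots_def)
  obtain m' where m': "- \<beta> = (\<lambda>x. \<Sum>\<alpha>\<in>B. of_nat (m' \<alpha>) * \<alpha> x)"
    using \<open>- \<beta> \<in> pos\<close> by (auto simp: pos_roots_def)
  have "(\<Sum>\<alpha>\<in>B. of_nat (m \<alpha>) * \<alpha> x) = (\<Sum>\<alpha>\<in>B. - of_nat (m' \<alpha>) * \<alpha> x)" for x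
  proof -
    have "\<beta> x = (\<Sum>\<alpha>\<in>B. of_nat (m \<alpha>) * \<alpha> x)" using fun_cong[OF m] .
    moreover have "- \<beta> x = (\<Sum>\<alpha>\<in>B. of_nat (m' \<alpha>) * \<alpha> x)" using fun_cong[OF m', of x] by simp
    ultimately show ?thesis unfolding mult_minus_left sum_negf by (metis minus_minus)
  qed
  then have "(of_nat (m \<alpha>) :: 'k) = - of_nat (m' \<alpha>)" if "\<alpha> \<in> B" for \<alpha>
    using base_coeff_eq[of "\<lambda>\<alpha>. of_nat (m \<alpha>)" "\<lambda>\<alpha>. - of_nat (m' \<alpha>)"] that by blast
  then have "(of_nat (m \<alpha> + m' \<alpha>) :: 'k) = 0" if "\<alpha> \<in> B" for \<alpha> using that by simp
  then have "m \<alpha> = 0" if "\<alpha> \<in> B" for \<alpha> using that by (metis add_is_0 of_nat_eq_0_iff)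
  then have "\<beta> = 0" using m by (simp add: fun_eq_iff)
  then show False using assms zero_not_pos by blast
qed

lemma not_pos_iff: "\<beta> \<in> \<Phi> \<Longrightarrow> \<beta> \<notin> pos \<longleftrightarrow> - \<beta> \<in> pos"
  using pos_or_neg pos_not_neg by blast

lemma base_pos: "B \<subseteq> pos"
proof
  fix \<alpha> assume "\<alpha> \<in> B"
  then have "\<alpha> x = (\<Sum>\<beta>\<in>B. of_nat (if \<beta> = \<alpha> then 1 else 0) * \<beta> x)" for x
    using finite_base by (simp add: if_distrib if_distribR cong: if_cong)
  then have "\<alpha> = (\<lambda>x. \<Sum>\<beta>\<in>B. of_nat (if \<beta> = \<alpha> then 1 else 0) * \<beta> x)" by blast
  then have "\<exists>m :: _ \<Rightarrow> nat. \<alpha> = (\<lambda>x. \<Sum>\<beta>\<in>B. of_nat (m \<beta>) * \<beta> x)"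
    by (rule exI[where x = "\<lambda>\<beta>. if \<beta> = \<alpha> then 1 else 0"])
  then show "\<alpha> \<in> pos" using base_subset \<open>\<alpha> \<in> B\<close> unfolding pos_roots_def by blast
qed

lemma base_root: "\<alpha> \<in> B \<Longrightarrow> \<alpha> \<in> \<Phi>"
  using base_subset by blast

lemma pos_root: "\<beta> \<in> pos \<Longrightarrow> \<beta> \<in> \<Phi>"
  using pos_subset by blast

text \<open>A root vanishing on the kernel of \<alpha> is a multiple of \<alpha>, and reducedness
  leaves only the factors 1 and -1. The factor is found by evaluating at the coroot, where \<alpha>
  takes the value 2.\<close>

lemma roots_independent:
  assumes "\<alpha> \<in> \<Phi>" "\<beta> \<in> \<Phi>" "\<beta> \<noteq> \<alpha>" "\<beta> \<noteq> - \<alpha>"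
  shows "\<exists>y. \<alpha> y = 0 \<and> \<beta> y \<noteq> 0"
proof (rule ccontr)
  assume "\<not> ?thesis"
  then have ker: "\<beta> y = 0" if "\<alpha> y = 0" for y using that by blast
  define c where "c = \<beta> (coroot \<alpha>) / 2"
  have "\<beta> x = c * \<alpha> x" for x
  proof -
    have "\<alpha> (x - (\<alpha> x / 2) *s coroot \<alpha>) = 0"
      using assms by (simp add: root_dual dual_diff dual_scale root_coroot)
    then have "\<beta> (x - (\<alpha> x / 2) *s coroot \<alpha>) = 0" by (rule ker)
    then show ?thesis using assms by (simp add: root_dual dual_diff dual_scale c_def)
  qed
  then have "\<beta> = (\<lambda>x. c * \<alpha> x)" by blast
  then have "c = 1 \<or> c = - 1" using root_multiple assms by blast
  then show False using \<open>\<beta> = (\<lambda>x. c * \<alpha> x)\<close> assms(3,4) by (auto simp: fun_eq_iff)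
qed

text \<open>\<open>\<sigma> \<alpha>\<close> alters only the \<alpha>-coefficient. If the image were
  negative, the other coefficients of \<beta> would be both nonnegative and nonpositive, leaving a
  multiple of \<alpha>, hence \<alpha> itself.\<close>

lemma simple_refl_pos:
  assumes "\<alpha> \<in> B" "\<beta> \<in> pos" "\<beta> \<noteq> \<alpha>"
  shows "\<beta> \<circ> \<sigma> \<alpha> \<in> pos"
proof (rule ccontr)
  assume "\<beta> \<circ> \<sigma> \<alpha> \<notin> pos"
  then have neg: "- (\<beta> \<circ> \<sigma> \<alpha>) \<in> pos"
    using not_pos_iff root_comp_refl assms base_root pos_root by blast
  obtain m where m: "\<beta> = (\<lambda>x. \<Sum>\<gamma>\<in>B. of_nat (m \<gamma>) * \<gamma> x)"
    using assms(2) by (auto simp: pos_roots_def)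
  obtain m' where m': "- (\<beta> \<circ> \<sigma> \<alpha>) = (\<lambda>x. \<Sum>\<gamma>\<in>B. of_nat (m' \<gamma>) * \<gamma> x)"
    using neg by (auto simp: pos_roots_def)
  define n where "n = \<beta> (coroot \<alpha>)"
  \<comment> \<open>\<open>c\<close> lists the coefficients of \<beta> minus its image, and
    \<open>d\<close> those of \<open>n\<close> times \<alpha>. Away from \<alpha> the comparison
    says that a sum of two natural numbers is 0.\<close>
  define c :: "('k ^ 'n \<Rightarrow> 'k) \<Rightarrow> 'k" where "c = (\<lambda>\<gamma>. of_nat (m \<gamma>) + of_nat (m' \<gamma>))"
  define d :: "('k ^ 'n \<Rightarrow> 'k) \<Rightarrow> 'k" where "d = (\<lambda>\<gamma>. if \<gamma> = \<alpha> then n else 0)"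
  have "(\<Sum>\<gamma>\<in>B. c \<gamma> * \<gamma> x) = (\<Sum>\<gamma>\<in>B. d \<gamma> * \<gamma> x)" for x
  proof -
    have "(\<Sum>\<gamma>\<in>B. c \<gamma> * \<gamma> x) = \<beta> x - \<beta> (\<sigma> \<alpha> x)"
      using fun_cong[OF m, of x] fun_cong[OF m', of x]
      by (simp add: c_def distrib_right sum.distrib)
    also have "\<dots> = n * \<alpha> x"
      using assms(2) by (simp add: refl_apply pos_root root_dual dual_diff dual_scale n_def)
    also have "\<dots> = (\<Sum>\<gamma>\<in>B. d \<gamma> * \<gamma> x)"
      using finite_base assms(1)
      by (simp add: d_def if_distrib if_distribR sum.delta' cong: if_cong)
    finally show ?thesis .
  qed
  then have "c \<gamma> = d \<gamma>" if "\<gamma> \<in> B" for \<gamma> using base_coeff_eq that by blast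
  then have "(of_nat (m \<gamma> + m' \<gamma>) :: 'k) = 0" if "\<gamma> \<in> B" "\<gamma> \<noteq> \<alpha>" for \<gamma>
    using that by (metis c_def d_def of_nat_add)
  then have zero: "m \<gamma> = 0" if "\<gamma> \<in> B" "\<gamma> \<noteq> \<alpha>" for \<gamma>
    using that by (metis add_is_0 of_nat_eq_0_iff)
  have "\<beta> x = of_nat (m \<alpha>) * \<alpha> x" for x
  proof -
    have "\<beta> x = (\<Sum>\<gamma>\<in>B. of_nat (m \<gamma>) * \<gamma> x)" using fun_cong[OF m] .
    also have "\<dots> = (\<Sum>\<gamma>\<in>{\<alpha>}. of_nat (m \<gamma>) * \<gamma> x)"
      using finite_base assms(1) zero by (intro sum.mono_neutral_right) auto
    finally show ?thesis by simp
  qed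
  then have \<beta>: "\<beta> = (\<lambda>x. of_nat (m \<alpha>) * \<alpha> x)" by blast
  then have "(of_nat (m \<alpha>) :: 'k) = 1 \<or> (of_nat (m \<alpha>) :: 'k) = - 1"
    using root_multiple assms pos_root base_root by blast
  then have "\<beta> = \<alpha> \<or> \<beta> = - \<alpha>" using \<beta> by (auto simp: fun_eq_iff)
  then show False using assms base_pos pos_not_neg by auto
qed

text \<open>
  The form \<open>(x, y) \<mapsto> \<Sum>\<phi>\<in>\<Phi>. \<phi> x * \<phi> y\<close> is Weyl invariant and takes integral values on coroots,
  positive on the diagonal; it replaces a Euclidean inner product over the field \<open>'k\<close>.
\<close>

definition form :: "'k ^ 'n \<Rightarrow> 'k ^ 'n \<Rightarrow> 'k" where
  "form x y = (\<Sum>\<phi>\<in>\<Phi>. \<phi> x * \<phi> y)"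

lemma form_refl:
  assumes "\<alpha> \<in> \<Phi>" shows "form (\<sigma> \<alpha> x) (\<sigma> \<alpha> y) = form x y"
proof -
  have "bij_betw (\<lambda>\<phi>. \<phi> \<circ> \<sigma> \<alpha>) \<Phi> \<Phi>"
  proof (rule bij_betw_byWitness[where f' = "\<lambda>\<phi>. \<phi> \<circ> \<sigma> \<alpha>"])
    show "(\<lambda>\<phi>. \<phi> \<circ> \<sigma> \<alpha>) ` \<Phi> \<subseteq> \<Phi>" "(\<lambda>\<phi>. \<phi> \<circ> \<sigma> \<alpha>) ` \<Phi> \<subseteq> \<Phi>"
      using root_comp_refl assms by blast+
    show "\<forall>\<phi>\<in>\<Phi>. \<phi> \<circ> \<sigma> \<alpha> \<circ> \<sigma> \<alpha> = \<phi>" "\<forall>\<phi>\<in>\<Phi>. \<phi> \<circ> \<sigma> \<alpha> \<circ> \<sigma> \<alpha> = \<phi>"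
      unfolding comp_assoc refl_comp_refl[OF assms] by simp_all
  qed
  then have "(\<Sum>\<phi>\<in>\<Phi>. (\<phi> \<circ> \<sigma> \<alpha>) x * (\<phi> \<circ> \<sigma> \<alpha>) y) = (\<Sum>\<phi>\<in>\<Phi>. \<phi> x * \<phi> y)"
    by (rule sum.reindex_bij_betw)
  then show ?thesis by (simp add: form_def)
qed

text \<open>Invariance under \<open>\<sigma> \<alpha>\<close>, which negates the coroot
  \<open>h\<close> and sends \<open>y\<close> to \<open>y - \<alpha> y *s h\<close>. It is the
  familiar identity \<alpha>(y) = 2 (h, y) / (h, h), without division.\<close>

lemma form_coroot:
  assumes "\<alpha> \<in> \<Phi>"
  shows "2 * form (coroot \<alpha>) y = \<alpha> y * form (coroot \<alpha>) (coroot \<alpha>)"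
proof -
  let ?h = "coroot \<alpha>"
  have "form ?h y = form (\<sigma> \<alpha> ?h) (\<sigma> \<alpha> y)" using form_refl assms by simp
  also have "\<dots> = (\<Sum>\<phi>\<in>\<Phi>. (- \<phi> ?h) * (\<phi> y - \<alpha> y * \<phi> ?h))"
    unfolding form_def
    by (intro sum.cong)
      (use assms in \<open>simp_all add: refl_apply root_dual dual_diff dual_scale root_coroot\<close>)
  also have "\<dots> = \<alpha> y * form ?h ?h - form ?h y"
    by (simp add: form_def sum_distrib_left sum_subtractf[symmetric] algebra_simps)
  finally show ?thesis by (simp add: algebra_simps)
qed

text \<open>The Gram matrix of the coroots lifts to an integer matrix \<open>F\<close>, symmetric
  and with positive diagonal. By \<open>form_coroot\<close> both pairings have the sign of the
  common entry \<open>F \<alpha> \<beta>\<close>.\<close>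

lemma coroot_same_sign:
  assumes "\<alpha> \<in> \<Phi>" "\<beta> \<in> \<Phi>"
  shows "\<exists>a b. \<alpha> (coroot \<beta>) = of_int a \<and> \<beta> (coroot \<alpha>) = of_int b \<and> (a > 0 \<longrightarrow> b > 0)"
proof -
  define c :: "('k ^ 'n \<Rightarrow> 'k) \<Rightarrow> ('k ^ 'n \<Rightarrow> 'k) \<Rightarrow> int"
    where "c = (\<lambda>\<phi> \<gamma>. SOME n. \<phi> (coroot \<gamma>) = of_int n)"
  have c: "\<phi> (coroot \<gamma>) = of_int (c \<phi> \<gamma>)" if "\<phi> \<in> \<Phi>" "\<gamma> \<in> \<Phi>" for \<phi> \<gamma>
    using coroot_integral[OF that(2,1)] unfolding c_def by (metis (mono_tags, lifting) Ints_cases someI_ex)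
  define F where "F = (\<lambda>\<gamma> \<delta>. \<Sum>\<phi>\<in>\<Phi>. c \<phi> \<gamma> * c \<phi> \<delta>)"
  have F: "form (coroot \<gamma>) (coroot \<delta>) = of_int (F \<gamma> \<delta>)" if "\<gamma> \<in> \<Phi>" "\<delta> \<in> \<Phi>" for \<gamma> \<delta>
    using that c by (simp add: form_def F_def)
  have sym: "F \<alpha> \<beta> = F \<beta> \<alpha>" by (simp add: F_def mult.commute)
  have diag: "F \<gamma> \<gamma> > 0" if "\<gamma> \<in> \<Phi>" for \<gamma>
  proof -
    have "(of_int (c \<gamma> \<gamma>) :: 'k) = of_int 2" using c[OF that that] root_coroot[OF that] by simp
    then have "c \<gamma> \<gamma> = 2" by (simp only: of_int_eq_iff)
    then have "c \<gamma> \<gamma> * c \<gamma> \<gamma> > 0" by simp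
    then show ?thesis
      unfolding F_def using finite_roots that by (intro sum_pos2[of _ \<gamma>]) auto
  qed
  have proportional: "2 * F \<gamma> \<delta> = c \<gamma> \<delta> * F \<gamma> \<gamma>" if "\<gamma> \<in> \<Phi>" "\<delta> \<in> \<Phi>" for \<gamma> \<delta>
  proof -
    have "(of_int (2 * F \<gamma> \<delta>) :: 'k) = of_int (c \<gamma> \<delta> * F \<gamma> \<gamma>)"
      using form_coroot[OF that(1), of "coroot \<delta>"] F c that by simp
    then show ?thesis by (simp only: of_int_eq_iff)
  qed
  have "c \<beta> \<alpha> > 0" if "c \<alpha> \<beta> > 0"
  proof -
    have "F \<alpha> \<beta> > 0" using proportional[of \<alpha> \<beta>] diag[of \<alpha>] that assms by (metis mult_pos_pos zero_less_mult_pos zero_less_numeral)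
    then show ?thesis
      using proportional[of \<beta> \<alpha>] diag[of \<beta>] sym assms by (metis mult_pos_pos zero_less_mult_pos2 zero_less_numeral)
  qed
  then show ?thesis using c assms by blast
qed

text \<open>\<beta> takes the value 2 at its own coroot and is a nonnegative combination of simple
  roots, so some simple root is positive there; \<open>coroot_same_sign\<close> exchanges the two
  roots.\<close>

lemma simple_with_positive_pairing:
  assumes "\<beta> \<in> pos"
  shows "\<exists>\<alpha>\<in>B. \<exists>n>0. \<beta> (coroot \<alpha>) = of_nat n"
proof (rule ccontr)
  assume none: "\<not> ?thesis"
  obtain m where m: "\<beta> = (\<lambda>x. \<Sum>\<gamma>\<in>B. of_nat (m \<gamma>) * \<gamma> x)"
    using assms by (auto simp: pos_roots_def)
  have "\<exists>a. \<alpha> (coroot \<beta>) = of_int a \<and> a \<le> 0" if "\<alpha> \<in> B" for \<alpha>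
  proof -
    obtain a b where ab: "\<alpha> (coroot \<beta>) = of_int a" "\<beta> (coroot \<alpha>) = of_int b" "a > 0 \<longrightarrow> b > 0"
      using coroot_same_sign[OF base_root pos_root[OF assms]] \<open>\<alpha> \<in> B\<close> by blast
    have "\<not> b > 0"
    proof
      assume "b > 0"
      then have "nat b > 0" "\<beta> (coroot \<alpha>) = of_nat (nat b)" using ab(2) by simp_all
      then show False using none that by blast
    qed
    then show ?thesis using ab by force
  qed
  then obtain a where a: "\<alpha> (coroot \<beta>) = of_int (a \<alpha>)" "a \<alpha> \<le> 0" if "\<alpha> \<in> B" for \<alpha> by metis
  have "(of_int 2 :: 'k) = \<beta> (coroot \<beta>)" using assms by (simp add: root_coroot pos_root)
  also have "\<dots> = (\<Sum>\<gamma>\<in>B. of_nat (m \<gamma>) * \<gamma> (coroot \<beta>))" using fun_cong[OF m] .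
  also have "\<dots> = of_int (\<Sum>\<gamma>\<in>B. int (m \<gamma>) * a \<gamma>)" using a(1) by simp
  finally have "2 = (\<Sum>\<gamma>\<in>B. int (m \<gamma>) * a \<gamma>)" by (simp only: of_int_eq_iff)
  moreover have "(\<Sum>\<gamma>\<in>B. int (m \<gamma>) * a \<gamma>) \<le> 0"
    using a(2) by (intro sum_nonpos) (simp add: mult_nonneg_nonpos)
  ultimately show False by simp
qed

section \<open>Generation of the Weyl group by simple reflections\<close>

definition word :: "('k ^ 'n \<Rightarrow> 'k) list \<Rightarrow> 'k ^ 'n \<Rightarrow> 'k ^ 'n" where
  "word \<alpha>s = foldr (\<circ>) (map \<sigma> \<alpha>s) id"

lemma word_Nil: "word [] = id"
  and word_Cons: "word (\<alpha> # \<alpha>s) = \<sigma> \<alpha> \<circ> word \<alpha>s"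
  by (simp_all add: word_def)

lemma word_append: "word (\<alpha>s @ \<beta>s) = word \<alpha>s \<circ> word \<beta>s"
  by (induction \<alpha>s) (simp_all add: word_Nil word_Cons comp_assoc)

lemma word_in_weyl: "set \<alpha>s \<subseteq> B \<Longrightarrow> word \<alpha>s \<in> W"
proof (induction \<alpha>s)
  case Nil
  show ?case unfolding word_Nil by (rule weyl_group.one)
next
  case (Cons a \<alpha>s)
  then show ?case unfolding word_Cons using weyl_comp refl_in_weyl base_root by (metis insert_subset list.simps(15))
qed

text \<open>Induction on the height, the sum of the coefficients. A simple \<alpha> with positive
  pairing \<open>n\<close> turns \<beta> into the positive root \<beta> - n \<alpha> of smaller
  height, whose reflection is conjugate to \<open>\<sigma> \<beta>\<close> under
  \<open>\<sigma> \<alpha>\<close>.\<close>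

lemma refl_pos_word:
  assumes "\<beta> \<in> \<Phi>" "\<beta> = (\<lambda>x. \<Sum>\<gamma>\<in>B. of_nat (m \<gamma>) * \<gamma> x)"
  shows "\<exists>\<alpha>s. set \<alpha>s \<subseteq> B \<and> \<sigma> \<beta> = word \<alpha>s"
  using assms
proof (induction "\<Sum>\<gamma>\<in>B. m \<gamma>" arbitrary: \<beta> m rule: less_induct)
  case less
  have \<beta>: "\<beta> \<in> pos" using less.prems by (auto simp: pos_roots_def)
  show ?case
  proof (cases "\<beta> \<in> B")
    case True
    then show ?thesis by (intro exI[of _ "[\<beta>]"]) (simp add: word_Nil word_Cons)
  next
    case False
    obtain \<alpha> n where \<alpha>: "\<alpha> \<in> B" "n > 0" "\<beta> (coroot \<alpha>) = of_nat n"
      using simple_with_positive_pairing[OF \<beta>] by blast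
    have "\<beta> \<circ> \<sigma> \<alpha> \<in> pos" using simple_refl_pos \<alpha>(1) \<beta> False by blast
    then obtain m' where m': "\<beta> \<circ> \<sigma> \<alpha> = (\<lambda>x. \<Sum>\<gamma>\<in>B. of_nat (m' \<gamma>) * \<gamma> x)" and
      root: "\<beta> \<circ> \<sigma> \<alpha> \<in> \<Phi>" by (auto simp: pos_roots_def)
    define c :: "('k ^ 'n \<Rightarrow> 'k) \<Rightarrow> nat" where "c = (\<lambda>\<gamma>. m' \<gamma> + (if \<gamma> = \<alpha> then n else 0))"
    have "(\<Sum>\<gamma>\<in>B. of_nat (m \<gamma>) * \<gamma> x) = (\<Sum>\<gamma>\<in>B. of_nat (c \<gamma>) * \<gamma> x)" for x
    proof -
      have "(\<Sum>\<gamma>\<in>B. of_nat (c \<gamma>) * \<gamma> x) = (\<beta> \<circ> \<sigma> \<alpha>) x + of_nat n * \<alpha> x"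
      proof -
        have "(\<Sum>\<gamma>\<in>B. of_nat (if \<gamma> = \<alpha> then n else 0) * \<gamma> x) = of_nat n * \<alpha> x"
          using finite_base \<alpha>(1) by (simp add: if_distrib if_distribR cong: if_cong)
        then show ?thesis unfolding m' c_def of_nat_add distrib_right sum.distrib by simp
      qed
      also have "\<dots> = \<beta> x"
        using less.prems(1) \<alpha>(3) by (simp add: refl_apply root_dual dual_diff dual_scale)
      finally show ?thesis using fun_cong[OF less.prems(2), of x] by simp
    qed
    then have "(of_nat (m \<gamma>) :: 'k) = of_nat (c \<gamma>)" if "\<gamma> \<in> B" for \<gamma>
      using base_coeff_eq[of "\<lambda>\<gamma>. of_nat (m \<gamma>)" "\<lambda>\<gamma>. of_nat (c \<gamma>)"] that by blast
    then have "(\<Sum>\<gamma>\<in>B. m \<gamma>) = (\<Sum>\<gamma>\<in>B. c \<gamma>)" by (intro sum.cong) auto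
    also have "\<dots> = (\<Sum>\<gamma>\<in>B. m' \<gamma>) + n"
      using finite_base \<alpha>(1) by (simp add: c_def sum.distrib)
    finally have "(\<Sum>\<gamma>\<in>B. m' \<gamma>) < (\<Sum>\<gamma>\<in>B. m \<gamma>)" using \<alpha>(2) by simp
    from less.hyps[OF this root m'] obtain \<alpha>s
      where \<alpha>s: "set \<alpha>s \<subseteq> B" "\<sigma> (\<beta> \<circ> \<sigma> \<alpha>) = word \<alpha>s" by blast
    have "\<sigma> \<beta> \<circ> \<sigma> \<alpha> = \<sigma> \<alpha> \<circ> word \<alpha>s"
      using refl_conjugate[OF refl_in_weyl less.prems(1)] \<alpha>(1) \<alpha>s(2) base_root by metis
    then have "\<sigma> \<beta> = \<sigma> \<alpha> \<circ> word \<alpha>s \<circ> \<sigma> \<alpha>"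
      using refl_comp_refl[OF base_root[OF \<alpha>(1)]] by (metis comp_assoc comp_id)
    then have "\<sigma> \<beta> = word (\<alpha> # \<alpha>s @ [\<alpha>])"
      by (simp add: word_Cons word_append word_Nil o_assoc)
    then show ?thesis using \<alpha>s(1) \<alpha>(1) by (intro exI[of _ "\<alpha> # \<alpha>s @ [\<alpha>]"]) simp
  qed
qed

lemma weyl_word: "w \<in> W \<Longrightarrow> \<exists>\<alpha>s. set \<alpha>s \<subseteq> B \<and> w = word \<alpha>s"
proof (induction rule: weyl_group.induct)
  case one
  then show ?case by (intro exI[of _ "[]"]) (simp add: word_Nil)
next
  case (step w \<beta>)
  have pos: "\<exists>\<beta>s. set \<beta>s \<subseteq> B \<and> \<sigma> \<gamma> = word \<beta>s" if "\<gamma> \<in> pos" for \<gamma>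
    using that refl_pos_word unfolding pos_roots_def by blast
  have "\<exists>\<beta>s. set \<beta>s \<subseteq> B \<and> \<sigma> \<beta> = word \<beta>s"
    using pos_or_neg[OF step.hyps(2)] pos refl_uminus[OF step.hyps(2)] by metis
  then obtain \<alpha>s \<beta>s where "set \<alpha>s \<subseteq> B" "w = word \<alpha>s" "set \<beta>s \<subseteq> B" "\<sigma> \<beta> = word \<beta>s"
    using step.IH by blast
  then show ?case by (intro exI[of _ "\<alpha>s @ \<beta>s"]) (simp add: word_append)
qed

section \<open>Length and Bruhat order\<close>

lemma len_eq_Least: "len w = (LEAST k. \<exists>\<alpha>s. length \<alpha>s = k \<and> set \<alpha>s \<subseteq> B \<and> w = word \<alpha>s)"
  by (simp add: weyl_length_def word_def)

lemma reduced_word: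
  assumes "w \<in> W" obtains \<alpha>s where "length \<alpha>s = len w" "set \<alpha>s \<subseteq> B" "w = word \<alpha>s"
proof -
  have "\<exists>k \<alpha>s. length \<alpha>s = k \<and> set \<alpha>s \<subseteq> B \<and> w = word \<alpha>s" using weyl_word[OF assms] by blast
  from LeastI_ex[OF this] show ?thesis using that unfolding len_eq_Least by metis
qed

lemma len_word_le: "set \<alpha>s \<subseteq> B \<Longrightarrow> len (word \<alpha>s) \<le> length \<alpha>s"
  unfolding len_eq_Least by (rule Least_le) metis

lemma len_id: "len id = 0"
  using len_word_le[of "[]"] by (simp add: word_Nil)

lemma len_0_imp_id: "w \<in> W \<Longrightarrow> len w = 0 \<Longrightarrow> w = id"
  by (rule reduced_word[of w]) (auto simp: word_Nil)

lemma len_comp_le: "v \<in> W \<Longrightarrow> w \<in> W \<Longrightarrow> len (v \<circ> w) \<le> len v + len w"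
proof -
  assume "v \<in> W" "w \<in> W"
  then obtain \<alpha>s \<beta>s where *: "length \<alpha>s = len v" "set \<alpha>s \<subseteq> B" "v = word \<alpha>s"
    "length \<beta>s = len w" "set \<beta>s \<subseteq> B" "w = word \<beta>s" by (metis reduced_word)
  then have "len (word (\<alpha>s @ \<beta>s)) \<le> length (\<alpha>s @ \<beta>s)" by (intro len_word_le) simp
  then show ?thesis using * by (simp only: word_append length_append)
qed

lemma refl_comp_in_weyl: "\<beta> \<in> \<Phi> \<Longrightarrow> w \<in> W \<Longrightarrow> \<sigma> \<beta> \<circ> w \<in> W"
  using weyl_comp refl_in_weyl by blast

lemma refl_refl_comp: "\<beta> \<in> \<Phi> \<Longrightarrow> \<sigma> \<beta> \<circ> (\<sigma> \<beta> \<circ> w) = w"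
  by (simp add: fun_eq_iff refl_refl)

lemma len_simple: "\<alpha> \<in> B \<Longrightarrow> len (\<sigma> \<alpha>) \<le> 1"
  using len_word_le[of "[\<alpha>]"] by (simp add: word_Nil word_Cons)

lemma len_simple_comp_le: "\<alpha> \<in> B \<Longrightarrow> w \<in> W \<Longrightarrow> len (\<sigma> \<alpha> \<circ> w) \<le> Suc (len w)"
  using len_comp_le[of "\<sigma> \<alpha>" w] len_simple[of \<alpha>] refl_in_weyl[of \<alpha>] base_root[of \<alpha>] by simp

lemma len_le_simple_comp: "\<alpha> \<in> B \<Longrightarrow> w \<in> W \<Longrightarrow> len w \<le> Suc (len (\<sigma> \<alpha> \<circ> w))"
  using len_simple_comp_le[OF _ refl_comp_in_weyl[OF base_root], of \<alpha> \<alpha> w]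
  by (simp only: refl_refl_comp base_root)

text \<open>The exchange property. As letters are passed from the left, \<beta> is replaced by its
  image and stays positive until it meets a letter equal to itself. Since it ends up not positive,
  this must happen, and that letter cancels.\<close>

lemma word_exchange:
  assumes "set \<alpha>s \<subseteq> B" "\<beta> \<in> pos" "\<beta> \<circ> word \<alpha>s \<notin> pos"
  shows "\<exists>\<alpha>s'. length \<alpha>s' < length \<alpha>s \<and> set \<alpha>s' \<subseteq> B \<and> \<sigma> \<beta> \<circ> word \<alpha>s = word \<alpha>s'"
  using assms
proof (induction \<alpha>s arbitrary: \<beta>)
  case Nil
  then show ?case by (simp add: word_Nil)
next
  case (Cons \<alpha> \<alpha>s)
  have \<alpha>: "\<alpha> \<in> B" "set \<alpha>s \<subseteq> B" using Cons.prems(1) by auto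
  show ?case
  proof (cases "\<beta> = \<alpha>")
    case True
    then have "\<sigma> \<beta> \<circ> word (\<alpha> # \<alpha>s) = word \<alpha>s"
      unfolding word_Cons using refl_refl_comp base_root \<alpha>(1) by metis
    then show ?thesis using \<alpha>(2) by (intro exI[of _ \<alpha>s]) simp
  next
    case False
    have "\<beta> \<circ> \<sigma> \<alpha> \<in> pos" using simple_refl_pos \<alpha>(1) Cons.prems(2) False by metis
    moreover have "\<beta> \<circ> \<sigma> \<alpha> \<circ> word \<alpha>s \<notin> pos"
      using Cons.prems(3) unfolding word_Cons o_assoc .
    ultimately obtain \<alpha>s' where \<alpha>s': "length \<alpha>s' < length \<alpha>s" "set \<alpha>s' \<subseteq> B"
      "\<sigma> (\<beta> \<circ> \<sigma> \<alpha>) \<circ> word \<alpha>s = word \<alpha>s'" using Cons.IH[OF \<alpha>(2)] by metis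
    have "\<sigma> \<beta> \<circ> \<sigma> \<alpha> = \<sigma> \<alpha> \<circ> \<sigma> (\<beta> \<circ> \<sigma> \<alpha>)"
      using refl_conjugate[OF refl_in_weyl[OF base_root[OF \<alpha>(1)]] pos_root[OF Cons.prems(2)]] .
    then have "\<sigma> \<beta> \<circ> word (\<alpha> # \<alpha>s) = word (\<alpha> # \<alpha>s')"
      unfolding word_Cons \<alpha>s'(3)[symmetric] o_assoc by simp
    then show ?thesis using \<alpha> \<alpha>s' by (intro exI[of _ "\<alpha> # \<alpha>s'"]) simp
  qed
qed

lemma len_refl_less:
  assumes "w \<in> W" "\<beta> \<in> pos" "\<beta> \<circ> w \<notin> pos"
  shows "len (\<sigma> \<beta> \<circ> w) < len w"
proof -
  obtain \<alpha>s where \<alpha>s: "length \<alpha>s = len w" "set \<alpha>s \<subseteq> B" "w = word \<alpha>s" using assms(1) reduced_word by metis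
  obtain \<alpha>s' where "length \<alpha>s' < length \<alpha>s" "set \<alpha>s' \<subseteq> B" "\<sigma> \<beta> \<circ> w = word \<alpha>s'"
    using word_exchange[OF \<alpha>s(2) assms(2)] assms(3) \<alpha>s(3) by metis
  then show ?thesis using len_word_le \<alpha>s(1) by (metis le_less_trans)
qed

lemma comp_refl_uminus: "\<beta> \<in> \<Phi> \<Longrightarrow> \<beta> \<circ> (\<sigma> \<beta> \<circ> w) = - (\<beta> \<circ> w)"
  by (simp add: fun_eq_iff root_refl_neg)

lemma len_refl_greater:
  assumes "w \<in> W" "\<beta> \<in> pos" "\<beta> \<circ> w \<in> pos"
  shows "len w < len (\<sigma> \<beta> \<circ> w)"
proof -
  have "\<beta> \<in> \<Phi>" using assms pos_root by metis
  then have "\<beta> \<circ> (\<sigma> \<beta> \<circ> w) \<notin> pos" using comp_refl_uminus pos_not_neg assms(3) by metis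
  from len_refl_less[OF refl_comp_in_weyl[OF \<open>\<beta> \<in> \<Phi>\<close> assms(1)] assms(2) this] show ?thesis
    unfolding refl_refl_comp[OF \<open>\<beta> \<in> \<Phi>\<close>] .
qed

lemma len_refl_less_iff:
  "w \<in> W \<Longrightarrow> \<beta> \<in> pos \<Longrightarrow> len (\<sigma> \<beta> \<circ> w) < len w \<longleftrightarrow> \<beta> \<circ> w \<notin> pos"
  and len_refl_greater_iff:
  "w \<in> W \<Longrightarrow> \<beta> \<in> pos \<Longrightarrow> len w < len (\<sigma> \<beta> \<circ> w) \<longleftrightarrow> \<beta> \<circ> w \<in> pos"
  using len_refl_less[of w \<beta>] len_refl_greater[of w \<beta>] by (metis less_asym)+

text \<open>Words bound the change of length by one, and the sign of
  \<open>\<alpha> \<circ> w\<close> rules out no change.\<close>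

lemma len_simple_cases:
  assumes "\<alpha> \<in> B" "w \<in> W"
  obtains "len w = Suc (len (\<sigma> \<alpha> \<circ> w))" | "len (\<sigma> \<alpha> \<circ> w) = Suc (len w)"
proof -
  have "\<alpha> \<in> pos" using assms base_pos by blast
  then have "len (\<sigma> \<alpha> \<circ> w) \<noteq> len w" using len_refl_less[of w \<alpha>] len_refl_greater[of w \<alpha>] assms(2) by linarith
  then show ?thesis using that len_le_simple_comp[OF assms] len_simple_comp_le[OF assms] by linarith
qed

lemma left_descent_exists:
  assumes "w \<in> W" "len w \<noteq> 0"
  shows "\<exists>\<alpha>\<in>B. len w = Suc (len (\<sigma> \<alpha> \<circ> w))"
proof -
  obtain \<alpha>s where \<alpha>s: "length \<alpha>s = len w" "set \<alpha>s \<subseteq> B" "w = word \<alpha>s" using assms(1) reduced_word by metis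
  then obtain \<alpha> \<beta>s where eq: "\<alpha>s = \<alpha> # \<beta>s" using assms(2) by (cases \<alpha>s) auto
  then have \<alpha>: "\<alpha> \<in> B" "set \<beta>s \<subseteq> B" using \<alpha>s(2) by auto
  have "\<sigma> \<alpha> \<circ> w = word \<beta>s" unfolding \<alpha>s(3) eq word_Cons using refl_refl_comp base_root \<alpha>(1) by metis
  then have "len (\<sigma> \<alpha> \<circ> w) \<le> length \<beta>s" using len_word_le \<alpha>(2) by metis
  then have "len w = Suc (len (\<sigma> \<alpha> \<circ> w))"
    using len_le_simple_comp[OF \<alpha>(1) assms(1)] \<alpha>s(1) eq by simp
  then show ?thesis using \<alpha>(1) by blast
qed

section \<open>Inversions and length\<close>

definition inversions :: "('k ^ 'n \<Rightarrow> 'k ^ 'n) \<Rightarrow> ('k ^ 'n \<Rightarrow> 'k) set" where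
  "inversions u = {\<beta> \<in> pos. \<beta> \<circ> u \<notin> pos}"

lemma inversions_eq:
  assumes "u \<in> W"
  shows "{\<beta> \<in> pos. act (inv u) \<beta> \<in> uminus ` pos} = inversions u"
proof -
  have "act (inv u) \<beta> \<in> uminus ` pos \<longleftrightarrow> \<beta> \<circ> u \<notin> pos" if "\<beta> \<in> pos" for \<beta>
  proof -
    have "\<beta> \<circ> u \<in> \<Phi>" using assms that pos_root root_comp_weyl by metis
    then have "\<beta> \<circ> u \<notin> pos \<longleftrightarrow> - (\<beta> \<circ> u) \<in> pos" by (rule not_pos_iff)
    then show ?thesis unfolding act_def weyl_inv_inv[OF assms] by (metis (no_types) image_iff minus_minus)
  qed
  then show ?thesis unfolding inversions_def by blast
qed

lemma inversions_subset: "inversions u \<subseteq> pos"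
  by (auto simp: inversions_def)

lemma finite_inversions: "finite (inversions u)"
  using inversions_subset finite_pos finite_subset by blast

text \<open>\<open>\<sigma> \<alpha>\<close> permutes the positive roots other than \<alpha>, while
  \<alpha> itself changes sign. The bijection serves both to count inversions and to compute the
  diagonal value of a divided difference.\<close>

lemma inversions_descent:
  assumes "\<alpha> \<in> B" "u \<in> W" "len u = Suc (len (\<sigma> \<alpha> \<circ> u))"
  shows "\<alpha> \<in> inversions u"
    and "bij_betw (\<lambda>\<beta>. \<beta> \<circ> \<sigma> \<alpha>) (inversions (\<sigma> \<alpha> \<circ> u)) (inversions u - {\<alpha>})"
proof -
  have \<alpha>: "\<alpha> \<in> pos" "\<alpha> \<in> \<Phi>" using assms(1) base_pos base_root by blast+
  have neg: "\<alpha> \<circ> u \<notin> pos" using len_refl_less_iff[OF assms(2) \<alpha>(1)] assms(3) by simp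
  then show "\<alpha> \<in> inversions u" using \<alpha>(1) by (simp add: inversions_def)
  have "- (\<alpha> \<circ> u) \<in> pos" using not_pos_iff[OF root_comp_weyl[OF assms(2) \<alpha>(2)]] neg by metis
  then have pos': "\<alpha> \<circ> (\<sigma> \<alpha> \<circ> u) \<in> pos" using comp_refl_uminus[OF \<alpha>(2)] by metis
  have invol: "\<beta> \<circ> \<sigma> \<alpha> \<circ> \<sigma> \<alpha> = \<beta>" for \<beta> :: "'k ^ 'n \<Rightarrow> 'k"
    by (simp add: fun_eq_iff refl_refl \<alpha>(2))
  have swap: "\<beta> \<circ> \<sigma> \<alpha> \<circ> (\<sigma> \<alpha> \<circ> u) = \<beta> \<circ> u" "\<beta> \<circ> \<sigma> \<alpha> \<circ> u = \<beta> \<circ> (\<sigma> \<alpha> \<circ> u)" for \<beta> :: "'k ^ 'n \<Rightarrow> 'k"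
    by (simp_all add: fun_eq_iff refl_refl \<alpha>(2))
  have ne: "\<beta> \<circ> \<sigma> \<alpha> \<noteq> \<alpha>" if "\<beta> \<in> pos" for \<beta>
  proof
    assume "\<beta> \<circ> \<sigma> \<alpha> = \<alpha>"
    then have "\<beta> = \<alpha> \<circ> \<sigma> \<alpha>" using invol by metis
    also have "\<dots> = - \<alpha>" by (simp add: fun_eq_iff root_refl_neg \<alpha>(2))
    finally show False using that \<alpha>(1) pos_not_neg by metis
  qed
  show "bij_betw (\<lambda>\<beta>. \<beta> \<circ> \<sigma> \<alpha>) (inversions (\<sigma> \<alpha> \<circ> u)) (inversions u - {\<alpha>})"
  proof (rule bij_betw_byWitness[where f' = "\<lambda>\<beta>. \<beta> \<circ> \<sigma> \<alpha>"])
    show "(\<lambda>\<beta>. \<beta> \<circ> \<sigma> \<alpha>) ` inversions (\<sigma> \<alpha> \<circ> u) \<subseteq> inversions u - {\<alpha>}"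
    proof (rule image_subsetI)
      fix \<beta> assume "\<beta> \<in> inversions (\<sigma> \<alpha> \<circ> u)"
      then have \<beta>: "\<beta> \<in> pos" "\<beta> \<circ> (\<sigma> \<alpha> \<circ> u) \<notin> pos" unfolding inversions_def by blast+
      then have "\<beta> \<noteq> \<alpha>" using pos' by metis
      then have "\<beta> \<circ> \<sigma> \<alpha> \<in> pos" using simple_refl_pos assms(1) \<beta>(1) by metis
      then show "\<beta> \<circ> \<sigma> \<alpha> \<in> inversions u - {\<alpha>}"
        using \<beta> ne[OF \<beta>(1)] swap(2)[of \<beta>] unfolding inversions_def by simp
    qed
    show "(\<lambda>\<beta>. \<beta> \<circ> \<sigma> \<alpha>) ` (inversions u - {\<alpha>}) \<subseteq> inversions (\<sigma> \<alpha> \<circ> u)"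
    proof (rule image_subsetI)
      fix \<beta> assume "\<beta> \<in> inversions u - {\<alpha>}"
      then have \<beta>: "\<beta> \<in> pos" "\<beta> \<circ> u \<notin> pos" "\<beta> \<noteq> \<alpha>" unfolding inversions_def by blast+
      then have "\<beta> \<circ> \<sigma> \<alpha> \<in> pos" using simple_refl_pos assms(1) by metis
      moreover have "\<beta> \<circ> \<sigma> \<alpha> \<circ> (\<sigma> \<alpha> \<circ> u) \<notin> pos" unfolding swap(1) using \<beta>(2) .
      ultimately show "\<beta> \<circ> \<sigma> \<alpha> \<in> inversions (\<sigma> \<alpha> \<circ> u)"
        unfolding inversions_def by blast
    qed
  qed (simp_all only: invol, simp_all)
qed

lemma card_inversions: "u \<in> W \<Longrightarrow> card (inversions u) = len u"
proof (induction "len u" arbitrary: u)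
  case 0
  then have "u = id" using len_0_imp_id by metis
  then have "inversions u = {}" by (simp add: inversions_def)
  then show ?case using 0 by simp
next
  case (Suc n)
  then obtain \<alpha> where \<alpha>: "\<alpha> \<in> B" "len u = Suc (len (\<sigma> \<alpha> \<circ> u))"
    using left_descent_exists[of u] by auto
  have "\<sigma> \<alpha> \<circ> u \<in> W" using refl_comp_in_weyl base_root \<alpha>(1) Suc.prems by metis
  then have "card (inversions (\<sigma> \<alpha> \<circ> u)) = len (\<sigma> \<alpha> \<circ> u)"
    using Suc.hyps \<alpha>(2) by (metis Suc_inject)
  moreover have "card (inversions (\<sigma> \<alpha> \<circ> u)) = card (inversions u - {\<alpha>})"
    using inversions_descent(2)[OF \<alpha>(1) Suc.prems \<alpha>(2)] by (rule bij_betw_same_card)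
  moreover have "card (inversions u) = Suc (card (inversions u - {\<alpha>}))"
    using inversions_descent(1)[OF \<alpha>(1) Suc.prems \<alpha>(2)] finite_inversions
    by (metis card.remove)
  ultimately show ?case using \<alpha>(2) by simp
qed

lemma prod_inversions_in_sym: "\<Prod>(inversions u) \<in> sym_algebra"
  using inversions_subset pos_dual by (intro sym_algebra_prod sym_algebra.linear) blast

lemma homogeneous_prod_inversions: "u \<in> W \<Longrightarrow> homogeneous (len u) (\<Prod>(inversions u))"
  using homogeneous_prod_linear[OF finite_inversions subset_trans[OF inversions_subset pos_dual], of u]
  by (simp only: card_inversions)

section \<open>Bruhat order in terms of left multiplication\<close>

abbreviation bruhat where "bruhat \<equiv> bruhat_le \<Phi> B"

text \<open>The order is generated by reflections on the right under a length condition. Conjugation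
  by \<open>u\<close> moves the reflection to the left, where the length condition is the positivity
  of a root.\<close>

lemma bruhat_step_iff:
  assumes "u \<in> W"
  shows "(\<exists>\<beta>\<in>pos. v = u \<circ> \<sigma> \<beta> \<and> len u < len v) \<longleftrightarrow> (\<exists>\<gamma>\<in>pos. v = \<sigma> \<gamma> \<circ> u \<and> \<gamma> \<circ> u \<in> pos)"
proof
  assume "\<exists>\<gamma>\<in>pos. v = \<sigma> \<gamma> \<circ> u \<and> \<gamma> \<circ> u \<in> pos"
  then obtain \<gamma> where \<gamma>: "\<gamma> \<in> pos" "v = \<sigma> \<gamma> \<circ> u" "\<gamma> \<circ> u \<in> pos" by blast
  then have "v = u \<circ> \<sigma> (\<gamma> \<circ> u)" "len u < len v"
    using refl_conjugate[OF assms pos_root[OF \<gamma>(1)]] len_refl_greater[OF assms \<gamma>(1,3)] by simp_all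
  then show "\<exists>\<beta>\<in>pos. v = u \<circ> \<sigma> \<beta> \<and> len u < len v" using \<gamma>(3) by blast
next
  assume "\<exists>\<beta>\<in>pos. v = u \<circ> \<sigma> \<beta> \<and> len u < len v"
  then obtain \<beta> where \<beta>: "\<beta> \<in> pos" "v = u \<circ> \<sigma> \<beta>" "len u < len v" by blast
  \<comment> \<open>The image of \<beta> under \<open>u\<close> could a priori be negative; the
    increase in length is what excludes this.\<close>
  define \<delta> where "\<delta> = \<beta> \<circ> inv u"
  have \<delta>: "\<delta> \<in> \<Phi>" "\<delta> \<circ> u = \<beta>"
    using root_comp_weyl[OF weyl_inv[OF assms] pos_root[OF \<beta>(1)]]
    by (simp_all add: \<delta>_def fun_eq_iff weyl_inv_left[OF assms])
  have v: "v = \<sigma> \<delta> \<circ> u" using refl_conjugate[OF assms \<delta>(1)] \<delta>(2) \<beta>(2) by simp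
  have "\<delta> \<in> pos"
  proof (rule ccontr)
    assume "\<delta> \<notin> pos"
    then have neg: "- \<delta> \<in> pos" using not_pos_iff \<delta>(1) by metis
    have "(- \<delta>) \<circ> u = - \<beta>" using \<delta>(2) by (simp add: fun_eq_iff)
    then have "(- \<delta>) \<circ> u \<notin> pos" using \<beta>(1) pos_not_neg by metis
    then have "len (\<sigma> (- \<delta>) \<circ> u) < len u" using len_refl_less[OF assms neg] by metis
    then show False using v \<beta>(3) refl_uminus[OF \<delta>(1)] by simp
  qed
  then show "\<exists>\<gamma>\<in>pos. v = \<sigma> \<gamma> \<circ> u \<and> \<gamma> \<circ> u \<in> pos" using v \<delta>(2) \<beta>(1) by metis
qed

lemma bruhat_refl: "bruhat u u"
  by (simp add: bruhat_le_def)

lemma bruhat_trans: "bruhat u v \<Longrightarrow> bruhat v w \<Longrightarrow> bruhat u w"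
  unfolding bruhat_le_def by (rule rtranclp_trans)

lemma bruhat_refl_comp:
  assumes "u \<in> W" "\<gamma> \<in> pos" "\<gamma> \<circ> u \<in> pos" shows "bruhat u (\<sigma> \<gamma> \<circ> u)"
proof -
  have step: "\<exists>\<beta>\<in>pos. \<sigma> \<gamma> \<circ> u = u \<circ> \<sigma> \<beta> \<and> len u < len (\<sigma> \<gamma> \<circ> u)"
    unfolding bruhat_step_iff[OF assms(1)] using assms(2,3) by blast
  show ?thesis unfolding bruhat_le_def by (rule r_into_rtranclp) (rule step)
qed

lemma bruhat_induct [consumes 2, case_names base step]:
  assumes "bruhat u v" "u \<in> W"
    and "P u"
    and "\<And>v \<gamma>. \<lbrakk>v \<in> W; bruhat u v; \<gamma> \<in> pos; \<gamma> \<circ> v \<in> pos; P v\<rbrakk> \<Longrightarrow> P (\<sigma> \<gamma> \<circ> v)"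
  shows "v \<in> W \<and> P v"
  using assms(1) unfolding bruhat_le_def
proof (induction rule: rtranclp_induct)
  case base
  then show ?case using assms by blast
next
  case (step v w)
  then obtain \<gamma> where "\<gamma> \<in> pos" "w = \<sigma> \<gamma> \<circ> v" "\<gamma> \<circ> v \<in> pos"
    using bruhat_step_iff[of v w] by blast
  moreover have "bruhat u v" using step.hyps(1) unfolding bruhat_le_def .
  ultimately show ?case using assms(4) step.IH refl_comp_in_weyl pos_root by metis
qed

lemma bruhat_len:
  assumes "bruhat u v" "u \<in> W" shows "v = u \<or> len u < len v"
proof -
  have "v \<in> W \<and> (v = u \<or> len u < len v)"
    using assms
  proof (induction rule: bruhat_induct)
    case (step v \<gamma>)
    then have "len v < len (\<sigma> \<gamma> \<circ> v)" using len_refl_greater by metis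
    then show ?case using step(5) by (metis less_trans)
  qed simp
  then show ?thesis by blast
qed

lemma bruhat_descent:
  assumes "\<alpha> \<in> B" "u \<in> W" "len u = Suc (len (\<sigma> \<alpha> \<circ> u))"
  shows "bruhat (\<sigma> \<alpha> \<circ> u) u"
proof -
  have \<alpha>: "\<alpha> \<in> \<Phi>" "\<alpha> \<in> pos" using assms(1) base_root base_pos by blast+
  have su: "\<sigma> \<alpha> \<circ> u \<in> W" using refl_comp_in_weyl \<alpha>(1) assms(2) by metis
  have "len (\<sigma> \<alpha> \<circ> u) < len (\<sigma> \<alpha> \<circ> (\<sigma> \<alpha> \<circ> u))"
    unfolding refl_refl_comp[OF \<alpha>(1)] using assms(3) by simp
  then have "\<alpha> \<circ> (\<sigma> \<alpha> \<circ> u) \<in> pos" unfolding len_refl_greater_iff[OF su \<alpha>(2)] .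
  from bruhat_refl_comp[OF su \<alpha>(2) this] show ?thesis unfolding refl_refl_comp[OF \<alpha>(1)] .
qed

text \<open>A case of the lifting property, needed for the support of divided differences. A step
  along \<gamma> other than \<alpha> is carried by \<open>\<sigma> \<alpha>\<close> to a step along
  the still positive root \<open>\<gamma> \<circ> \<sigma> \<alpha>\<close>. A step along \<alpha>
  is undone, leaving \<open>v\<close>, which lies above \<open>u\<close> and so above
  \<open>\<sigma> \<alpha> \<circ> u\<close>.\<close>

lemma bruhat_lift:
  assumes "\<alpha> \<in> B" "u \<in> W" "len u = Suc (len (\<sigma> \<alpha> \<circ> u))" "bruhat u v"
  shows "bruhat (\<sigma> \<alpha> \<circ> u) (\<sigma> \<alpha> \<circ> v)"
proof -
  have \<alpha>: "\<alpha> \<in> \<Phi>" "\<alpha> \<in> pos" using assms(1) base_root base_pos by blast+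
  have below: "bruhat (\<sigma> \<alpha> \<circ> u) u" using bruhat_descent assms by metis
  have "v \<in> W \<and> bruhat (\<sigma> \<alpha> \<circ> u) (\<sigma> \<alpha> \<circ> v)"
    using assms(4,2)
  proof (induction rule: bruhat_induct)
    case base
    then show ?case by (rule bruhat_refl)
  next
    case (step v \<gamma>)
    show ?case
    proof (cases "\<gamma> = \<alpha>")
      case True
      then show ?thesis using refl_refl_comp[OF \<alpha>(1)] bruhat_trans[OF below step(2)] by metis
    next
      case False
      let ?v = "\<sigma> \<alpha> \<circ> v"
      have \<gamma>': "\<gamma> \<circ> \<sigma> \<alpha> \<in> pos" using simple_refl_pos assms(1) step(3) False by metis
      have "\<gamma> \<circ> \<sigma> \<alpha> \<circ> ?v = \<gamma> \<circ> v" by (simp add: fun_eq_iff refl_refl \<alpha>(1))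
      then have "\<gamma> \<circ> \<sigma> \<alpha> \<circ> ?v \<in> pos" using step(4) by metis
      from bruhat_refl_comp[OF refl_comp_in_weyl[OF \<alpha>(1) step(1)] \<gamma>' this]
      have "bruhat ?v (\<sigma> (\<gamma> \<circ> \<sigma> \<alpha>) \<circ> ?v)" .
      moreover have "\<sigma> (\<gamma> \<circ> \<sigma> \<alpha>) \<circ> ?v = \<sigma> \<alpha> \<circ> (\<sigma> \<gamma> \<circ> v)"
      proof -
        have "\<sigma> \<gamma> \<circ> \<sigma> \<alpha> = \<sigma> \<alpha> \<circ> \<sigma> (\<gamma> \<circ> \<sigma> \<alpha>)"
          using refl_conjugate[OF refl_in_weyl[OF \<alpha>(1)] pos_root[OF step(3)]] .
        then have "\<sigma> \<gamma> (\<sigma> \<alpha> x) = \<sigma> \<alpha> (\<sigma> (\<gamma> \<circ> \<sigma> \<alpha>) x)" for x by (metis comp_apply)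
        then have "\<sigma> (\<gamma> \<circ> \<sigma> \<alpha>) (\<sigma> \<alpha> x) = \<sigma> \<alpha> (\<sigma> \<gamma> x)" for x using refl_refl[OF \<alpha>(1)] by metis
        then show ?thesis by (intro ext) (simp only: comp_apply)
      qed
      ultimately show ?thesis using step(5) bruhat_trans by metis
    qed
  qed
  then show ?thesis by blast
qed

section \<open>The ring of classes\<close>

abbreviation H where "H \<equiv> graph_cohomology \<Phi> B"

lemma root_nonzero: "\<beta> \<in> \<Phi> \<Longrightarrow> \<beta> \<noteq> 0"
  using zero_not_root by metis

lemma edge_divisible_iff:
  assumes "w \<in> W" "\<beta> \<in> pos" "\<delta> \<in> \<Phi>" "\<delta> \<circ> w = \<beta>" and f: "\<And>v. v \<in> W \<Longrightarrow> f v \<in> sym_algebra"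
  shows "(\<exists>g\<in>sym_algebra. f (w \<circ> \<sigma> \<beta>) - f w = act w \<beta> * g) \<longleftrightarrow>
         (\<forall>x. \<delta> x = 0 \<longrightarrow> f (\<sigma> \<delta> \<circ> w) x = f w x)"
proof -
  have eq: "w \<circ> \<sigma> \<beta> = \<sigma> \<delta> \<circ> w" using refl_conjugate[OF assms(1,3)] assms(4) by metis
  have act: "act w \<beta> = \<delta>"
    unfolding assms(4)[symmetric] act_def using weyl_inv_right[OF assms(1)] by (simp add: fun_eq_iff)
  have "\<sigma> \<delta> \<circ> w \<in> W" using refl_comp_in_weyl assms(1,3) by metis
  then have "f (\<sigma> \<delta> \<circ> w) - f w \<in> sym_algebra" using f assms(1) sym_algebra_diff by metis
  from divisible_by_linear_iff[OF this root_dual root_nonzero, OF assms(3,3)]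
  show ?thesis unfolding eq act by simp
qed

text \<open>
  Moving reflections to the left turns the divisibility condition along the edges into agreement
  on the hyperplane of the reflecting root, a form that no longer mentions positivity.
\<close>

lemma H_iff:
  "f \<in> H \<longleftrightarrow> (\<forall>w\<in>W. f w \<in> sym_algebra) \<and> (\<forall>w. w \<notin> W \<longrightarrow> f w = 0) \<and>
     (\<forall>w\<in>W. \<forall>\<gamma>\<in>\<Phi>. \<forall>x. \<gamma> x = 0 \<longrightarrow> f (\<sigma> \<gamma> \<circ> w) x = f w x)"
proof (cases "\<forall>w\<in>W. f w \<in> sym_algebra")
  case True
  then have f: "\<And>v. v \<in> W \<Longrightarrow> f v \<in> sym_algebra" by blast
  have "(\<forall>\<beta>\<in>pos. \<exists>g\<in>sym_algebra. f (w \<circ> \<sigma> \<beta>) - f w = act w \<beta> * g) \<longleftrightarrow>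
        (\<forall>\<gamma>\<in>\<Phi>. \<forall>x. \<gamma> x = 0 \<longrightarrow> f (\<sigma> \<gamma> \<circ> w) x = f w x)" (is "?L = ?R") if w: "w \<in> W" for w
  proof
    assume R: ?R
    show ?L
    proof
      fix \<beta> assume \<beta>: "\<beta> \<in> pos"
      have "\<beta> \<circ> inv w \<in> \<Phi>" using root_comp_weyl weyl_inv w pos_root \<beta> by metis
      moreover have "\<beta> \<circ> inv w \<circ> w = \<beta>" using weyl_inv_left[OF w] by (simp add: fun_eq_iff)
      ultimately show "\<exists>g\<in>sym_algebra. f (w \<circ> \<sigma> \<beta>) - f w = act w \<beta> * g"
        using edge_divisible_iff[where f = f, OF w \<beta> _ _ f] R by metis
    qed
  next
    assume L: ?L
    have pos: "\<forall>x. \<gamma> x = 0 \<longrightarrow> f (\<sigma> \<gamma> \<circ> w) x = f w x" if "\<gamma> \<in> \<Phi>" "\<gamma> \<circ> w \<in> pos" for \<gamma>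
      using edge_divisible_iff[where f = f, OF w that(2,1) HOL.refl f] bspec[OF L that(2)] by blast
    show ?R
    proof
      fix \<gamma> assume \<gamma>: "\<gamma> \<in> \<Phi>"
      show "\<forall>x. \<gamma> x = 0 \<longrightarrow> f (\<sigma> \<gamma> \<circ> w) x = f w x"
      proof (cases "\<gamma> \<circ> w \<in> pos")
        case True
        then show ?thesis using pos \<gamma> by metis
      next
        case False
        have "- (\<gamma> \<circ> w) \<in> pos" using not_pos_iff[OF root_comp_weyl[OF w \<gamma>]] False by metis
        moreover have "(- \<gamma>) \<circ> w = - (\<gamma> \<circ> w)" by (simp add: fun_eq_iff)
        ultimately have "(- \<gamma>) \<circ> w \<in> pos" by metis
        from pos[OF uminus_root[OF \<gamma>] this] show ?thesis unfolding refl_uminus[OF \<gamma>] by simp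
      qed
    qed
  qed
  then show ?thesis using True unfolding graph_cohomology_def by simp
next
  case False
  then show ?thesis unfolding graph_cohomology_def mem_Collect_eq by blast
qed

lemma H_sym: "f \<in> H \<Longrightarrow> w \<in> W \<Longrightarrow> f w \<in> sym_algebra"
  and H_outside: "f \<in> H \<Longrightarrow> w \<notin> W \<Longrightarrow> f w = 0"
  and H_edge: "f \<in> H \<Longrightarrow> w \<in> W \<Longrightarrow> \<gamma> \<in> \<Phi> \<Longrightarrow> \<gamma> x = 0 \<Longrightarrow> f (\<sigma> \<gamma> \<circ> w) x = f w x"
  unfolding H_iff by simp_all

lemma H_I:
  assumes "\<And>w. w \<in> W \<Longrightarrow> f w \<in> sym_algebra" "\<And>w. w \<notin> W \<Longrightarrow> f w = 0"
    and "\<And>w \<gamma> x. w \<in> W \<Longrightarrow> \<gamma> \<in> \<Phi> \<Longrightarrow> \<gamma> x = 0 \<Longrightarrow> f (\<sigma> \<gamma> \<circ> w) x = f w x"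
  shows "f \<in> H"
  unfolding H_iff using assms by simp

lemma H_ext:
  assumes "f \<in> H" "g \<in> H" "\<And>w. w \<in> W \<Longrightarrow> f w = g w" shows "f = g"
proof
  show "f w = g w" for w using assms H_outside by (cases "w \<in> W") simp_all
qed

lemma H_zero: "0 \<in> H"
  by (rule H_I) (simp_all add: sym_algebra_zero)

lemma H_diff:
  assumes "f \<in> H" "g \<in> H" shows "f - g \<in> H"
proof (rule H_I)
  show "(f - g) w \<in> sym_algebra" if "w \<in> W" for w
    using H_sym[OF assms(1) that] H_sym[OF assms(2) that] by (simp add: sym_algebra_diff)
  show "(f - g) w = 0" if "w \<notin> W" for w
    using H_outside[OF assms(1) that] H_outside[OF assms(2) that] by simp
  show "(f - g) (\<sigma> \<gamma> \<circ> w) x = (f - g) w x" if "w \<in> W" "\<gamma> \<in> \<Phi>" "\<gamma> x = 0" for w \<gamma> x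
    using H_edge[OF assms(1) that] H_edge[OF assms(2) that] by simp
qed

lemma lin_comb_in_H:
  assumes c: "\<And>i. i \<in> I \<Longrightarrow> c i \<in> sym_algebra" and b: "\<And>i. i \<in> I \<Longrightarrow> b i \<in> H"
  shows "lin_comb I c b \<in> H"
proof (rule H_I)
  fix w assume "w \<in> W"
  then show "lin_comb I c b w \<in> sym_algebra"
    unfolding lin_comb_def using c b H_sym by (intro sym_algebra_sum sym_algebra.mult) metis+
next
  fix w assume "w \<notin> W"
  then show "lin_comb I c b w = 0"
    unfolding lin_comb_def using b H_outside by (intro sum.neutral ballI) (metis mult_zero_right)
next
  fix w \<gamma> x assume "w \<in> W" "\<gamma> \<in> \<Phi>" "\<gamma> x = 0"
  then show "lin_comb I c b (\<sigma> \<gamma> \<circ> w) x = lin_comb I c b w x"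
    unfolding lin_comb_apply using b H_edge by (intro sum.cong) metis+
qed

section \<open>Twisting by Weyl group elements\<close>

lemma twist_apply: "w \<in> W \<Longrightarrow> twist f w v x = f (w \<circ> v) (w x)"
  unfolding twist_def act_def by (simp add: weyl_inv_inv)

text \<open>Twisting is a right action, so along a word the first letter acts first.\<close>

lemma twist_comp:
  assumes "v \<in> W" "w \<in> W"
  shows "twist f (v \<circ> w) = twist (twist f v) w"
proof (intro ext)
  fix u x
  have "v \<circ> w \<in> W" using assms weyl_comp by blast
  then show "twist f (v \<circ> w) u x = twist (twist f v) w u x"
    unfolding twist_apply[OF \<open>v \<circ> w \<in> W\<close>] twist_apply[OF assms(2)] twist_apply[OF assms(1)]
    by (simp only: comp_apply comp_assoc)
qed

lemma comp_in_weyl_iff: "w \<in> W \<Longrightarrow> w \<circ> v \<in> W \<longleftrightarrow> v \<in> W"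
proof
  assume "w \<in> W" "w \<circ> v \<in> W"
  then have "inv w \<circ> (w \<circ> v) \<in> W" using weyl_comp weyl_inv by blast
  moreover have "inv w \<circ> (w \<circ> v) = v" using weyl_inv_left[OF \<open>w \<in> W\<close>] by (simp add: fun_eq_iff)
  ultimately show "v \<in> W" by metis
next
  show "w \<in> W \<Longrightarrow> v \<in> W \<Longrightarrow> w \<circ> v \<in> W" using weyl_comp by blast
qed

lemma twist_eq_comp: "w \<in> W \<Longrightarrow> twist f w v = f (w \<circ> v) \<circ> w"
  by (simp add: fun_eq_iff twist_apply)

text \<open>Left multiplication by \<open>w\<close> sends the edge of \<gamma> at \<open>v\<close>
  to the edge of \<open>\<gamma> \<circ> inv w\<close> at \<open>w \<circ> v\<close>, and
  \<open>w\<close> maps the kernel of the first root to that of the second.\<close>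

lemma twist_in_H:
  assumes "f \<in> H" "w \<in> W" shows "twist f w \<in> H"
proof (rule H_I)
  fix v assume "v \<in> W"
  then show "twist f w v \<in> sym_algebra"
    unfolding twist_eq_comp[OF assms(2)]
    using sym_algebra_comp_weyl[OF assms(2)] H_sym[OF assms(1)] comp_in_weyl_iff[OF assms(2)] by metis
next
  fix v assume "v \<notin> W"
  then have "f (w \<circ> v) = 0" using H_outside[OF assms(1)] comp_in_weyl_iff[OF assms(2)] by metis
  then show "twist f w v = 0" unfolding twist_eq_comp[OF assms(2)] by (simp add: fun_eq_iff)
next
  fix v \<gamma> x assume v: "v \<in> W" and \<gamma>: "\<gamma> \<in> \<Phi>" "\<gamma> x = 0"
  define \<delta> where "\<delta> = \<gamma> \<circ> inv w"
  have \<delta>: "\<delta> \<in> \<Phi>" "\<delta> \<circ> w = \<gamma>"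
    using root_comp_weyl[OF weyl_inv[OF assms(2)] \<gamma>(1)]
    by (simp_all add: \<delta>_def fun_eq_iff weyl_inv_left[OF assms(2)])
  have "\<sigma> \<delta> \<circ> w = w \<circ> \<sigma> \<gamma>" using refl_conjugate[OF assms(2) \<delta>(1)] \<delta>(2) by simp
  then have "w \<circ> (\<sigma> \<gamma> \<circ> v) = \<sigma> \<delta> \<circ> (w \<circ> v)" by (metis comp_assoc)
  moreover have "\<delta> (w x) = 0" using \<delta>(2) \<gamma>(2) by (metis comp_apply)
  moreover have "w \<circ> v \<in> W" using v comp_in_weyl_iff[OF assms(2)] by metis
  ultimately show "twist f w (\<sigma> \<gamma> \<circ> v) x = twist f w v x"
    unfolding twist_apply[OF assms(2)] using H_edge[OF assms(1) _ \<delta>(1)] by metis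
qed

text \<open>
  At an element \<open>v\<close> all of whose Bruhat neighbours below lie outside the support, a class is
  divisible by each of the pairwise coprime inversions of \<open>v\<close>, hence by their product.
\<close>

lemma divisible_by_inversions:
  assumes "f \<in> H" "v \<in> W" and below: "\<And>w. w \<in> W \<Longrightarrow> len w < len v \<Longrightarrow> f w = 0"
  shows "\<exists>g\<in>sym_algebra. f v = \<Prod>(inversions v) * g"
proof (rule divisible_by_prod_linear)
  show "finite (inversions v)" by (rule finite_inversions)
  show "inversions v \<subseteq> dual_space" using inversions_subset pos_dual by (rule subset_trans)
  show "0 \<notin> inversions v" using inversions_subset zero_not_pos by (metis subsetD)
  show "f v \<in> sym_algebra" using H_sym assms by metis
  show "\<exists>y. \<alpha> y = 0 \<and> \<beta> y \<noteq> 0" if "\<alpha> \<in> inversions v" "\<beta> \<in> inversions v" "\<alpha> \<noteq> \<beta>" for \<alpha> \<beta>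
  proof -
    have "\<alpha> \<in> pos" "\<beta> \<in> pos" using that inversions_subset by (metis subsetD)+
    then show ?thesis using roots_independent pos_root pos_not_neg that(3) by metis
  qed
  show "f v x = 0" if "\<beta> \<in> inversions v" "\<beta> x = 0" for \<beta> x
  proof -
    have \<beta>: "\<beta> \<in> pos" "\<beta> \<circ> v \<notin> pos" using that(1) unfolding inversions_def by blast+
    have "f (\<sigma> \<beta> \<circ> v) = 0"
      using below[OF refl_comp_in_weyl[OF pos_root[OF \<beta>(1)] assms(2)]] len_refl_less[OF assms(2) \<beta>] .
    then show ?thesis using H_edge[OF assms(1,2) pos_root[OF \<beta>(1)] that(2)] by simp
  qed
qed

text \<open>At an element \<open>v\<close> of minimal length in the support, the value would be
  divisible by \<open>len v\<close> linear forms although its degree is smaller. Both the uniqueness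
  of Schubert classes and the vanishing at ascents rest on this.\<close>

lemma class_eq_0_if_support_long:
  assumes "f \<in> H" and hom: "\<And>v. v \<in> W \<Longrightarrow> homogeneous d (f v)"
    and supp: "\<And>v. v \<in> W \<Longrightarrow> f v \<noteq> 0 \<Longrightarrow> d < len v"
  shows "f = 0"
proof (rule H_ext[OF assms(1) H_zero])
  fix v assume "v \<in> W"
  then show "f v = 0 v"
  proof (induction "len v" arbitrary: v rule: less_induct)
    case less
    have below: "f w = 0" if "w \<in> W" "len w < len v" for w using less.hyps[OF that(2,1)] by simp
    obtain g where g: "g \<in> sym_algebra" "f v = \<Prod>(inversions v) * g"
      using divisible_by_inversions[OF assms(1) less.prems below] by metis
    show ?case
    proof (rule ccontr)
      assume "f v \<noteq> 0 v"
      then have "d < card (inversions v)" using supp[OF less.prems] card_inversions[OF less.prems] by simp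
      moreover have "homogeneous d (\<Prod>(inversions v) * g)" using hom[OF less.prems] g(2) by metis
      ultimately have "\<Prod>(inversions v) * g = 0"
        using homogeneous_prod_linear_mult_eq_0[OF finite_inversions subset_trans[OF inversions_subset pos_dual] g(1)]
        by metis
      then show False using g(2) \<open>f v \<noteq> 0 v\<close> by simp
    qed
  qed
qed

section \<open>Left divided differences\<close>

text \<open>The quotient exists pointwise because \<open>\<sigma> \<alpha>\<close> fixes the kernel
  of \<alpha>, where the edge condition applies. The work lies in the edge conditions of the
  quotient.\<close>

lemma left_divided_difference:
  assumes "f \<in> H" "\<alpha> \<in> \<Phi>"
  obtains g where "g \<in> H" "\<And>v. f v - twist f (\<sigma> \<alpha>) v = \<alpha> * g v"
proof -
  let ?s = "\<sigma> \<alpha>"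
  have s: "?s \<in> W" using refl_in_weyl assms(2) by metis
  note \<alpha> = root_dual[OF assms(2)] root_nonzero[OF assms(2)]
  have tw: "twist f ?s v x = f (?s \<circ> v) (?s x)" for v x using twist_apply[OF s] .
  have "\<exists>g\<in>sym_algebra. f v - twist f ?s v = \<alpha> * g" if v: "v \<in> W" for v
  proof -
    have "f v - twist f ?s v \<in> sym_algebra"
      using H_sym[OF assms(1) v] H_sym[OF twist_in_H[OF assms(1) s] v] by (rule sym_algebra_diff)
    moreover have "(f v - twist f ?s v) x = 0" if "\<alpha> x = 0" for x
      using H_edge[OF assms(1) v assms(2) that] refl_fixes[of \<alpha> x] that tw by simp
    ultimately show ?thesis using divisible_by_linear_iff[OF _ \<alpha>] by metis
  qed
  then obtain g0 where g0: "\<And>v. v \<in> W \<Longrightarrow> g0 v \<in> sym_algebra"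
    "\<And>v. v \<in> W \<Longrightarrow> f v - twist f ?s v = \<alpha> * g0 v" by metis
  define g where "g = (\<lambda>v. if v \<in> W then g0 v else 0)"
  have g_sym: "g v \<in> sym_algebra" if "v \<in> W" for v using g0(1) that by (simp add: g_def)
  have eq: "f v - twist f ?s v = \<alpha> * g v" for v
  proof (cases "v \<in> W")
    case True
    then show ?thesis using g0(2) by (simp add: g_def)
  next
    case False
    then have "f v = 0" "twist f ?s v = 0" "g v = 0"
      using H_outside[OF assms(1)] H_outside[OF twist_in_H[OF assms(1) s]] by (simp_all add: g_def)
    then show ?thesis by simp
  qed
  then have eq_at: "f v x - f (?s \<circ> v) (?s x) = \<alpha> x * g v x" for v x
    unfolding tw[symmetric] by (metis fun_diff_def times_fun_apply)
  have "g \<in> H"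
  proof (rule H_I)
    show "g v \<in> sym_algebra" if "v \<in> W" for v using g_sym that .
    show "g v = 0" if "v \<notin> W" for v using that by (simp add: g_def)
    fix v \<gamma> x assume v: "v \<in> W" and \<gamma>: "\<gamma> \<in> \<Phi>" "\<gamma> x = 0"
    have sv: "?s \<circ> v \<in> W" using refl_comp_in_weyl assms(2) v by metis
    have \<gamma>v: "\<sigma> \<gamma> \<circ> v \<in> W" using refl_comp_in_weyl \<gamma>(1) v by metis
    show "g (\<sigma> \<gamma> \<circ> v) x = g v x"
    proof (cases "\<gamma> = \<alpha> \<or> \<gamma> = - \<alpha>")
      case True
      then have \<gamma>s: "\<sigma> \<gamma> = ?s" using refl_uminus[OF assms(2)] by metis
      have x: "\<alpha> x = 0" using True \<gamma>(2) by auto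
      \<comment> \<open>Here \<alpha> vanishes on the hyperplane, so a second quotient
        \<open>k\<close> is taken, of the difference of \<open>f\<close> across the edge. The
        difference of \<open>g\<close> across the edge is then \<open>k - (k \<circ> ?s)\<close>,
        which vanishes at points fixed by \<open>?s\<close>.\<close>
      have "f (?s \<circ> v) - f v \<in> sym_algebra"
        using H_sym[OF assms(1) sv] H_sym[OF assms(1) v] by (rule sym_algebra_diff)
      moreover have "(f (?s \<circ> v) - f v) y = 0" if "\<alpha> y = 0" for y
        using H_edge[OF assms(1) v assms(2) that] by simp
      ultimately obtain k where k: "k \<in> sym_algebra" "f (?s \<circ> v) - f v = \<alpha> * k"
        using divisible_by_linear_iff[OF _ \<alpha>] by metis
      have k_at: "f (?s \<circ> v) y - f v y = \<alpha> y * k y" for y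
        using k(2) by (metis fun_diff_def times_fun_apply)
      have "\<alpha> * (g (?s \<circ> v) - g v) = \<alpha> * (k - (k \<circ> ?s))"
      proof
        fix y
        have "\<alpha> y * g (?s \<circ> v) y = f (?s \<circ> v) y - f v (?s y)"
          using eq_at[of "?s \<circ> v" y] unfolding refl_refl_comp[OF assms(2)] by simp
        moreover have "\<alpha> y * g v y = f v y - f (?s \<circ> v) (?s y)" using eq_at[of v y] by simp
        ultimately have "\<alpha> y * g (?s \<circ> v) y - \<alpha> y * g v y =
            (f (?s \<circ> v) y - f v y) + (f (?s \<circ> v) (?s y) - f v (?s y))" by simp
        also have "\<dots> = \<alpha> y * k y - \<alpha> y * k (?s y)"
          unfolding k_at root_refl_neg[OF assms(2)] by simp
        finally show "(\<alpha> * (g (?s \<circ> v) - g v)) y = (\<alpha> * (k - (k \<circ> ?s))) y"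
          by (simp add: right_diff_distrib)
      qed
      then have "g (?s \<circ> v) - g v = k - (k \<circ> ?s)"
        using linear_mult_cancel[OF sym_algebra_diff[OF g_sym[OF sv] g_sym[OF v]]
            sym_algebra_diff[OF k(1) sym_algebra_comp_weyl[OF s k(1)]] \<alpha>] by metis
      from fun_cong[OF this, of x] show ?thesis
        unfolding \<gamma>s using refl_fixes[of \<alpha> x] x by simp
    next
      case False
      \<comment> \<open>\<alpha> does not vanish identically on the kernel of \<gamma>, so it can be
        cancelled there.\<close>
      then obtain y where y: "\<gamma> y = 0" "\<alpha> y \<noteq> 0"
        using roots_independent[OF \<gamma>(1) assms(2)] by (metis minus_minus)
      have "\<alpha> z * (g (\<sigma> \<gamma> \<circ> v) - g v) z = 0" if z: "\<gamma> z = 0" for z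
      proof -
        define \<delta> where "\<delta> = \<gamma> \<circ> ?s"
        have \<delta>: "\<delta> \<in> \<Phi>" using root_comp_refl[OF assms(2) \<gamma>(1)] by (simp only: \<delta>_def)
        have "\<delta> \<circ> ?s = \<gamma>" by (simp add: \<delta>_def fun_eq_iff refl_refl[OF assms(2)])
        then have "\<sigma> \<delta> \<circ> ?s = ?s \<circ> \<sigma> \<gamma>" using refl_conjugate[OF s \<delta>] by simp
        then have comm: "?s \<circ> (\<sigma> \<gamma> \<circ> v) = \<sigma> \<delta> \<circ> (?s \<circ> v)" by (metis comp_assoc)
        have "\<delta> (?s z) = 0" using z by (simp add: \<delta>_def refl_refl[OF assms(2)])
        then have "f (?s \<circ> (\<sigma> \<gamma> \<circ> v)) (?s z) = f (?s \<circ> v) (?s z)"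
          unfolding comm using H_edge[OF assms(1) sv \<delta>] by metis
        moreover have "f (\<sigma> \<gamma> \<circ> v) z = f v z" using H_edge[OF assms(1) v \<gamma>(1) z] .
        ultimately have "\<alpha> z * g (\<sigma> \<gamma> \<circ> v) z = \<alpha> z * g v z"
          unfolding eq_at[symmetric] by simp
        then show ?thesis by (simp add: right_diff_distrib)
      qed
      then have "(g (\<sigma> \<gamma> \<circ> v) - g v) x = 0"
        using vanishes_cancel_linear[OF sym_algebra_diff[OF g_sym[OF \<gamma>v] g_sym[OF v]] \<alpha>(1)
            root_dual[OF \<gamma>(1)] y _ \<gamma>(2)] by blast
      then show ?thesis by simp
    qed
  qed
  then show ?thesis using that eq by blast
qed

section \<open>Schubert classes\<close>

abbreviation schubert where "schubert \<equiv> is_schubert_class \<Phi> B"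

lemma schubert_iff:
  assumes "u \<in> W"
  shows "schubert u f \<longleftrightarrow> f \<in> H \<and> (\<forall>v\<in>W. homogeneous (len u) (f v)) \<and>
    (\<forall>v\<in>W. f v \<noteq> 0 \<longrightarrow> bruhat u v) \<and> f u = \<Prod>(inversions u)"
  unfolding is_schubert_class_def inversions_eq[OF assms] ..

lemma schubertD:
  assumes "u \<in> W" "schubert u f"
  shows schubert_in_H: "f \<in> H"
    and schubert_homogeneous: "\<And>v. v \<in> W \<Longrightarrow> homogeneous (len u) (f v)"
    and schubert_support: "\<And>v. v \<in> W \<Longrightarrow> f v \<noteq> 0 \<Longrightarrow> bruhat u v"
    and schubert_diagonal: "f u = \<Prod>(inversions u)"
  using assms(2) unfolding schubert_iff[OF assms(1)] by blast+

lemma schubert_zero: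
  assumes "u \<in> W" "schubert u f" "v \<in> W" "v \<noteq> u" "len v \<le> len u"
  shows "f v = 0"
  using schubert_support[OF assms(1-3)] bruhat_len[OF _ assms(1), of v] assms(4,5) by fastforce

text \<open>Two candidates agree at \<open>u\<close> and vanish at all other elements of length at
  most \<open>len u\<close>, so their difference lives on lengths exceeding its degree.\<close>

lemma schubert_unique:
  assumes "u \<in> W" "schubert u f" "schubert u g"
  shows "f = g"
proof -
  note f = schubertD[OF assms(1,2)] and g = schubertD[OF assms(1,3)]
  have "f - g = 0"
  proof (rule class_eq_0_if_support_long)
    show "f - g \<in> H" using f(1) g(1) by (rule H_diff)
    show "homogeneous (len u) ((f - g) v)" if "v \<in> W" for v
      using homogeneous_diff[OF f(2) g(2), OF that that] by simp
    show "len u < len v" if "v \<in> W" "(f - g) v \<noteq> 0" for v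
    proof (rule ccontr)
      assume "\<not> len u < len v"
      then have "f v = g v"
        using schubert_zero[OF assms(1,2) that(1)] schubert_zero[OF assms(1,3) that(1)] f(4) g(4)
        by (cases "v = u") (metis, metis not_less)
      then show False using that(2) by simp
    qed
  qed
  then show ?thesis by simp
qed

lemma divided_difference_support:
  assumes "u \<in> W" "schubert u f" "\<alpha> \<in> \<Phi>"
    and eq: "\<And>v. f v - twist f (\<sigma> \<alpha>) v = \<alpha> * g v" and "g \<in> H" "v \<in> W" "g v \<noteq> 0"
  shows "bruhat u v \<or> bruhat u (\<sigma> \<alpha> \<circ> v)"
proof (rule ccontr)
  assume none: "\<not> ?thesis"
  have "f v = 0" using schubert_support[OF assms(1,2,6)] none by metis
  moreover have "f (\<sigma> \<alpha> \<circ> v) = 0"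
    using schubert_support[OF assms(1,2) refl_comp_in_weyl[OF assms(3,6)]] none by metis
  then have "twist f (\<sigma> \<alpha>) v = 0"
    unfolding twist_eq_comp[OF refl_in_weyl[OF assms(3)]] by (simp add: fun_eq_iff)
  ultimately have "\<alpha> * g v = 0" using eq[of v] by simp
  then have "g v = 0"
    using linear_mult_eq_0[OF H_sym[OF assms(5,6)] root_dual[OF assms(3)] root_nonzero[OF assms(3)]] by metis
  then show False using assms(7) by metis
qed

lemma divided_difference_homogeneous:
  assumes "u \<in> W" "schubert u f" "\<alpha> \<in> \<Phi>"
    and eq: "\<And>v. f v - twist f (\<sigma> \<alpha>) v = \<alpha> * g v" and "v \<in> W"
  shows "homogeneous (len u) (\<alpha> * g v)"
proof -
  have "homogeneous (len u) (f (\<sigma> \<alpha> \<circ> v) \<circ> \<sigma> \<alpha>)"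
    using homogeneous_comp_weyl[OF refl_in_weyl[OF assms(3)]]
      schubert_homogeneous[OF assms(1,2) refl_comp_in_weyl[OF assms(3,5)]] by metis
  then show ?thesis
    using homogeneous_diff[OF schubert_homogeneous[OF assms(1,2,5)]] eq[of v]
    unfolding twist_eq_comp[OF refl_in_weyl[OF assms(3)]] by metis
qed

text \<open>Dividing by \<alpha> lowers the degree by one, and \<open>bruhat_lift\<close> bounds the
  support. The value at \<open>\<sigma> \<alpha> \<circ> u\<close> comes from the value of
  \<open>f\<close> at \<open>u\<close> alone, since \<open>f\<close> vanishes at the shorter
  element.\<close>

lemma divided_difference_schubert_descent:
  assumes "u \<in> W" "schubert u f" "\<alpha> \<in> B" "len u = Suc (len (\<sigma> \<alpha> \<circ> u))"
    and eq: "\<And>v. f v - twist f (\<sigma> \<alpha>) v = \<alpha> * g v" and "g \<in> H"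
  shows "schubert (\<sigma> \<alpha> \<circ> u) g"
proof -
  let ?s = "\<sigma> \<alpha>"
  note f = schubertD[OF assms(1,2)]
  have \<alpha>: "\<alpha> \<in> \<Phi>" "\<alpha> \<in> dual_space" "\<alpha> \<noteq> 0"
    using base_root[OF assms(3)] root_dual root_nonzero by metis+
  have su: "?s \<circ> u \<in> W" using refl_comp_in_weyl \<alpha>(1) assms(1) by metis
  have hom: "homogeneous (len (?s \<circ> u)) (g v)" if v: "v \<in> W" for v
    using divided_difference_homogeneous[OF assms(1,2) \<alpha>(1) eq v] unfolding assms(4)
    by (rule homogeneous_linear_factor[OF \<alpha>(2,3) H_sym[OF assms(6) v]])
  have supp: "bruhat (?s \<circ> u) v" if v: "v \<in> W" "g v \<noteq> 0" for v
    using divided_difference_support[OF assms(1,2) \<alpha>(1) eq assms(6) v]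
  proof
    assume "bruhat u v"
    then show ?thesis using bruhat_descent[OF assms(3,1,4)] bruhat_trans by metis
  next
    assume "bruhat u (?s \<circ> v)"
    from bruhat_lift[OF assms(3,1,4) this] show ?thesis unfolding refl_refl_comp[OF \<alpha>(1)] .
  qed
  have "\<alpha> * g (?s \<circ> u) = \<alpha> * \<Prod>(inversions (?s \<circ> u))"
  proof
    fix x
    have "f (?s \<circ> u) = 0"
    proof (rule schubert_zero[OF assms(1,2) su])
      show "?s \<circ> u \<noteq> u" using assms(4) by (metis n_not_Suc_n)
    qed (use assms(4) in simp)
    then have "\<alpha> x * g (?s \<circ> u) x = - f u (?s x)"
      using fun_cong[OF eq[of "?s \<circ> u"], of x] twist_apply[OF refl_in_weyl[OF \<alpha>(1)], of f "?s \<circ> u" x]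
      unfolding refl_refl_comp[OF \<alpha>(1)] by simp
    also have "f u (?s x) = (\<Prod>\<beta>\<in>inversions u. \<beta> (?s x))" unfolding f(4) prod_fun_apply ..
    \<comment> \<open>The inversion \<alpha> is split off because it changes sign under
      \<open>?s\<close>, cancelling the minus; the others match the inversions of
      \<open>?s \<circ> u\<close>.\<close>
    also have "\<dots> = \<alpha> (?s x) * (\<Prod>\<beta>\<in>inversions u - {\<alpha>}. \<beta> (?s x))"
      using prod.remove[OF finite_inversions inversions_descent(1)[OF assms(3,1,4)]] .
    also have "(\<Prod>\<beta>\<in>inversions u - {\<alpha>}. \<beta> (?s x)) = (\<Prod>\<beta>\<in>inversions (?s \<circ> u). (\<beta> \<circ> ?s) (?s x))"
      using prod.reindex_bij_betw[OF inversions_descent(2)[OF assms(3,1,4)], of "\<lambda>\<beta>. \<beta> (?s x)"] by simp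
    also have "\<dots> = (\<Prod>(inversions (?s \<circ> u))) x" unfolding prod_fun_apply using refl_refl[OF \<alpha>(1)] by simp
    finally show "(\<alpha> * g (?s \<circ> u)) x = (\<alpha> * \<Prod>(inversions (?s \<circ> u))) x"
      unfolding times_fun_apply root_refl_neg[OF \<alpha>(1)] mult_minus_left minus_minus .
  qed
  then have "g (?s \<circ> u) = \<Prod>(inversions (?s \<circ> u))"
    by (rule linear_mult_cancel[OF H_sym[OF assms(6) su] prod_inversions_in_sym \<alpha>(2,3)])
  then show ?thesis unfolding schubert_iff[OF su] using assms(6) hom supp by blast
qed

text \<open>The quotient has degree \<open>len u - 1\<close> but is supported on lengths at least
  \<open>len u\<close>: if \<open>\<sigma> \<alpha> \<circ> v\<close> is strictly above
  \<open>u\<close>, removing \<open>\<sigma> \<alpha>\<close> costs at most one, and if it equals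
  \<open>u\<close>, then \<open>v\<close> is the longer element
  \<open>\<sigma> \<alpha> \<circ> u\<close>.\<close>

lemma divided_difference_schubert_ascent:
  assumes "u \<in> W" "schubert u f" "\<alpha> \<in> B" "len (\<sigma> \<alpha> \<circ> u) = Suc (len u)"
    and eq: "\<And>v. f v - twist f (\<sigma> \<alpha>) v = \<alpha> * g v" and "g \<in> H"
  shows "g = 0"
proof -
  have \<alpha>: "\<alpha> \<in> \<Phi>" "\<alpha> \<in> dual_space" "\<alpha> \<noteq> 0"
    using base_root[OF assms(3)] root_dual root_nonzero by metis+
  note hom = divided_difference_homogeneous[OF assms(1,2) \<alpha>(1) eq]
  have long: "len u \<le> len v" if v: "v \<in> W" "g v \<noteq> 0" for v
    using divided_difference_support[OF assms(1,2) \<alpha>(1) eq assms(6) v]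
  proof
    assume "bruhat u v"
    then show ?thesis using bruhat_len[OF _ assms(1)] by (metis less_imp_le order_refl)
  next
    assume "bruhat u (\<sigma> \<alpha> \<circ> v)"
    from bruhat_len[OF this assms(1)] show ?thesis
    proof
      assume "\<sigma> \<alpha> \<circ> v = u"
      then have "v = \<sigma> \<alpha> \<circ> u" using refl_refl_comp[OF \<alpha>(1)] by metis
      then show ?thesis using assms(4) by simp
    next
      assume "len u < len (\<sigma> \<alpha> \<circ> v)"
      then show ?thesis using len_simple_comp_le[OF assms(3) v(1)] by simp
    qed
  qed
  show ?thesis
  proof (cases "len u")
    \<comment> \<open>There is no degree below 0 to work with; a multiple of \<alpha> of degree 0 is
      already zero.\<close>
    case 0
    have "g v = 0" if "v \<in> W" for v
    proof -
      have "\<alpha> * g v = 0" using homogeneous_0_linear_mult[OF \<alpha>(2)] hom[OF that] 0 by metis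
      then show ?thesis using linear_mult_eq_0[OF H_sym[OF assms(6) that] \<alpha>(2,3)] by metis
    qed
    then show ?thesis using H_ext[OF assms(6) H_zero] by (metis zero_fun_apply)
  next
    case (Suc d)
    show ?thesis
    proof (rule class_eq_0_if_support_long[OF assms(6)])
      show "homogeneous d (g v)" if "v \<in> W" for v
        using hom[OF that] unfolding Suc
        by (rule homogeneous_linear_factor[OF \<alpha>(2,3) H_sym[OF assms(6) that]])
      show "d < len v" if "v \<in> W" "g v \<noteq> 0" for v using long[OF that] Suc by simp
    qed
  qed
qed

text \<open>A nonnegative combination of negative roots has nonpositive coefficients. Hence an
  element that no simple reflection lengthens has every positive root as an inversion.\<close>

lemma pos_comp_not_pos:
  assumes "u \<in> W" "\<And>\<alpha>. \<alpha> \<in> B \<Longrightarrow> \<alpha> \<circ> u \<notin> pos" "\<beta> \<in> pos"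
  shows "\<beta> \<circ> u \<notin> pos"
proof -
  obtain m where m: "\<beta> = (\<lambda>x. \<Sum>\<alpha>\<in>B. of_nat (m \<alpha>) * \<alpha> x)"
    using assms(3) unfolding pos_roots_def by blast
  have ex: "\<exists>k :: _ \<Rightarrow> nat. - (\<alpha> \<circ> u) = (\<lambda>x. \<Sum>\<gamma>\<in>B. of_nat (k \<gamma>) * \<gamma> x)" if "\<alpha> \<in> B" for \<alpha>
  proof -
    have "- (\<alpha> \<circ> u) \<in> pos"
      using not_pos_iff[OF root_comp_weyl[OF assms(1) base_root[OF that]]] assms(2)[OF that] by metis
    then show ?thesis unfolding pos_roots_def mem_Collect_eq by (elim conjE)
  qed
  define k where
    "k = (\<lambda>\<alpha>. SOME k :: _ \<Rightarrow> nat. - (\<alpha> \<circ> u) = (\<lambda>x. \<Sum>\<gamma>\<in>B. of_nat (k \<gamma>) * \<gamma> x))"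
  have k: "- (\<alpha> \<circ> u) = (\<lambda>x. \<Sum>\<gamma>\<in>B. of_nat (k \<alpha> \<gamma>) * \<gamma> x)" if "\<alpha> \<in> B" for \<alpha>
    using someI_ex[OF ex[OF that]] unfolding k_def .
  have "- (\<beta> \<circ> u) = (\<lambda>x. \<Sum>\<gamma>\<in>B. of_nat (\<Sum>\<alpha>\<in>B. m \<alpha> * k \<alpha> \<gamma>) * \<gamma> x)"
  proof
    fix x
    have "- \<beta> (u x) = (\<Sum>\<alpha>\<in>B. of_nat (m \<alpha>) * - \<alpha> (u x))"
      using fun_cong[OF m, of "u x"] by (simp add: sum_negf)
    also have "\<dots> = (\<Sum>\<alpha>\<in>B. of_nat (m \<alpha>) * (\<Sum>\<gamma>\<in>B. of_nat (k \<alpha> \<gamma>) * \<gamma> x))"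
    proof (rule sum.cong)
      fix \<alpha> assume "\<alpha> \<in> B"
      from fun_cong[OF k[OF this], of x]
      show "of_nat (m \<alpha>) * - \<alpha> (u x) = of_nat (m \<alpha>) * (\<Sum>\<gamma>\<in>B. of_nat (k \<alpha> \<gamma>) * \<gamma> x)" by simp
    qed simp
    also have "\<dots> = (\<Sum>\<alpha>\<in>B. \<Sum>\<gamma>\<in>B. of_nat (m \<alpha> * k \<alpha> \<gamma>) * \<gamma> x)"
      by (simp add: sum_distrib_left mult.assoc)
    also have "\<dots> = (\<Sum>\<gamma>\<in>B. \<Sum>\<alpha>\<in>B. of_nat (m \<alpha> * k \<alpha> \<gamma>) * \<gamma> x)" by (rule sum.swap)
    also have "\<dots> = (\<Sum>\<gamma>\<in>B. of_nat (\<Sum>\<alpha>\<in>B. m \<alpha> * k \<alpha> \<gamma>) * \<gamma> x)"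
      by (simp add: sum_distrib_right)
    finally show "(- (\<beta> \<circ> u)) x = (\<Sum>\<gamma>\<in>B. of_nat (\<Sum>\<alpha>\<in>B. m \<alpha> * k \<alpha> \<gamma>) * \<gamma> x)" by simp
  qed
  then have "\<exists>c :: _ \<Rightarrow> nat. - (\<beta> \<circ> u) = (\<lambda>x. \<Sum>\<gamma>\<in>B. of_nat (c \<gamma>) * \<gamma> x)"
    by (rule exI[where x = "\<lambda>\<gamma>. \<Sum>\<alpha>\<in>B. m \<alpha> * k \<alpha> \<gamma>"])
  moreover have "- (\<beta> \<circ> u) \<in> \<Phi>" using uminus_root root_comp_weyl assms(1,3) pos_root by metis
  ultimately have "- (\<beta> \<circ> u) \<in> pos" unfolding pos_roots_def mem_Collect_eq by blast
  then show ?thesis using pos_not_neg by metis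
qed

text \<open>Makes all edge conditions hold at once for a class concentrated at a single
  element.\<close>

lemma prod_pos_vanishes:
  assumes "\<gamma> \<in> \<Phi>" "\<gamma> x = 0" shows "(\<Prod>pos) x = 0"
proof -
  have "\<exists>\<beta>\<in>pos. \<beta> x = 0"
  proof (cases "\<gamma> \<in> pos")
    case False
    then have "- \<gamma> \<in> pos" using not_pos_iff assms(1) by metis
    then show ?thesis using assms(2) by (intro bexI[of _ "- \<gamma>"]) simp_all
  qed (use assms(2) in blast)
  then show ?thesis unfolding prod_fun_apply using finite_pos by (meson prod_zero)
qed

text \<open>
  If no simple reflection lengthens \<open>u\<close>, the class concentrated at \<open>u\<close> with value the product of
  all positive roots is a Schubert class; the others arise from it by divided differences.
\<close>

lemma schubert_exists: "u \<in> W \<Longrightarrow> \<exists>f. schubert u f"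
proof (induction "card pos - len u" arbitrary: u rule: less_induct)
  case less
  show ?case
  proof (cases "\<exists>\<alpha>\<in>B. len (\<sigma> \<alpha> \<circ> u) = Suc (len u)")
    case True
    then obtain \<alpha> where \<alpha>: "\<alpha> \<in> B" "len (\<sigma> \<alpha> \<circ> u) = Suc (len u)" by blast
    have root: "\<alpha> \<in> \<Phi>" using \<alpha>(1) base_root by metis
    have su: "\<sigma> \<alpha> \<circ> u \<in> W" using refl_comp_in_weyl root less.prems by metis
    \<comment> \<open>This bound keeps the truncated subtraction in the induction measure strictly
      decreasing.\<close>
    have "len (\<sigma> \<alpha> \<circ> u) \<le> card pos"
      using card_mono[OF finite_pos inversions_subset] card_inversions[OF su] by metis
    then have "card pos - len (\<sigma> \<alpha> \<circ> u) < card pos - len u" using \<alpha>(2) by simp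
    from less.hyps[OF this su] obtain f where f: "schubert (\<sigma> \<alpha> \<circ> u) f" by blast
    obtain g where g: "g \<in> H" "\<And>v. f v - twist f (\<sigma> \<alpha>) v = \<alpha> * g v"
      using left_divided_difference[OF schubert_in_H[OF su f] root] by metis
    \<comment> \<open>Seen from the longer element, \<open>\<sigma> \<alpha>\<close> is a descent
      leading back to \<open>u\<close>.\<close>
    have "len (\<sigma> \<alpha> \<circ> u) = Suc (len (\<sigma> \<alpha> \<circ> (\<sigma> \<alpha> \<circ> u)))"
      unfolding refl_refl_comp[OF root] by (rule \<alpha>(2))
    from divided_difference_schubert_descent[OF su f \<alpha>(1) this g(2,1)]
    show ?thesis unfolding refl_refl_comp[OF root] by blast
  next
    case False
    have "\<alpha> \<circ> u \<notin> pos" if "\<alpha> \<in> B" for \<alpha>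
    proof -
      have "len (\<sigma> \<alpha> \<circ> u) < len u"
        using len_simple_cases[OF that less.prems] False that by (metis lessI)
      then show ?thesis using len_refl_less_iff[OF less.prems] base_pos that by (metis subsetD)
    qed
    then have inv: "inversions u = pos"
      unfolding inversions_def using pos_comp_not_pos[OF less.prems] by blast
    define f :: "('k ^ 'n \<Rightarrow> 'k ^ 'n) \<Rightarrow> 'k ^ 'n \<Rightarrow> 'k" where "f = (\<lambda>v. if v = u then \<Prod>pos else 0)"
    have f_u: "f u = \<Prod>pos" and f_other: "v \<noteq> u \<Longrightarrow> f v = 0" for v by (simp_all add: f_def)
    have hom: "homogeneous (len u) (f v)" for v
    proof (cases "v = u")
      case True
      then show ?thesis using homogeneous_prod_inversions[OF less.prems] inv f_u by metis
    next
      case False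
      have "homogeneous (len u) (0 :: 'k ^ 'n \<Rightarrow> 'k)"
        unfolding homogeneous_def by (simp add: sym_algebra_zero)
      then show ?thesis using f_other[OF False] by metis
    qed
    have "f \<in> H"
    proof (rule H_I)
      show "f v \<in> sym_algebra" for v using hom[of v] unfolding homogeneous_def by blast
      show "f v = 0" if "v \<notin> W" for v using f_other that less.prems by metis
      have zero: "f v x = 0" if "\<gamma> \<in> \<Phi>" "\<gamma> x = 0" for v \<gamma> x
        using prod_pos_vanishes[OF that] by (simp add: f_def)
      show "f (\<sigma> \<gamma> \<circ> v) x = f v x" if "\<gamma> \<in> \<Phi>" "\<gamma> x = 0" for v \<gamma> x
        using zero[OF that] by metis
    qed
    moreover have "bruhat u v" if "f v \<noteq> 0" for v using that f_other bruhat_refl by metis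
    moreover have "f u = \<Prod>(inversions u)" using f_u inv by metis
    ultimately have "schubert u f" unfolding schubert_iff[OF less.prems] using hom by blast
    then show ?thesis by blast
  qed
qed

abbreviation \<tau> where "\<tau> \<equiv> schubert_class \<Phi> B"

lemma schubert_class: "u \<in> W \<Longrightarrow> schubert u (\<tau> u)"
  unfolding schubert_class_def using theI'[of "schubert u"] schubert_exists schubert_unique by metis

lemma schubert_class_eqI: "u \<in> W \<Longrightarrow> schubert u f \<Longrightarrow> \<tau> u = f"
  using schubert_class schubert_unique by metis

lemma schubert_class_in_H: "u \<in> W \<Longrightarrow> \<tau> u \<in> H"
  using schubert_class schubert_in_H by metis

lemma twist_schubert_descent:
  assumes "u \<in> W" "\<alpha> \<in> B" "len u = Suc (len (\<sigma> \<alpha> \<circ> u))"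
  shows "twist (\<tau> u) (\<sigma> \<alpha>) v x = \<tau> u v x - \<alpha> x * \<tau> (\<sigma> \<alpha> \<circ> u) v x"
proof -
  have root: "\<alpha> \<in> \<Phi>" using assms(2) base_root by metis
  obtain g where g: "g \<in> H" "\<And>v. \<tau> u v - twist (\<tau> u) (\<sigma> \<alpha>) v = \<alpha> * g v"
    using left_divided_difference[OF schubert_class_in_H[OF assms(1)] root] by metis
  have eq: "\<tau> (\<sigma> \<alpha> \<circ> u) = g"
    using schubert_class_eqI[OF refl_comp_in_weyl[OF root assms(1)]]
      divided_difference_schubert_descent[OF assms(1) schubert_class[OF assms(1)] assms(2,3) g(2,1)] .
  show ?thesis unfolding eq using fun_cong[OF g(2)[of v], of x] by (simp add: algebra_simps)
qed

lemma twist_schubert_ascent: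
  assumes "u \<in> W" "\<alpha> \<in> B" "len (\<sigma> \<alpha> \<circ> u) = Suc (len u)"
  shows "twist (\<tau> u) (\<sigma> \<alpha>) = \<tau> u"
proof -
  have root: "\<alpha> \<in> \<Phi>" using assms(2) base_root by metis
  obtain g where g: "g \<in> H" "\<And>v. \<tau> u v - twist (\<tau> u) (\<sigma> \<alpha>) v = \<alpha> * g v"
    using left_divided_difference[OF schubert_class_in_H[OF assms(1)] root] by metis
  have "g = 0"
    by (rule divided_difference_schubert_ascent[OF assms(1) schubert_class[OF assms(1)] assms(2,3) g(2,1)])
  then have "\<tau> u v - twist (\<tau> u) (\<sigma> \<alpha>) v = 0" for v using g(2)[of v] by simp
  then show ?thesis by (intro ext) (metis right_minus_eq)
qed

section \<open>The Schubert basis\<close>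

text \<open>Evaluate at \<open>u\<close>: classes of shorter elements have coefficient 0 by
  induction, other classes of length at least \<open>len u\<close> vanish at \<open>u\<close>, and
  the diagonal value is a cancellable product of roots.\<close>

lemma schubert_independent:
  assumes c: "\<And>u. u \<in> W \<Longrightarrow> c u \<in> sym_algebra" and zero: "lin_comb W c \<tau> = 0"
  shows "u \<in> W \<Longrightarrow> c u = 0"
proof (induction "len u" arbitrary: u rule: less_induct)
  case less
  have "lin_comb W c \<tau> u = 0" using zero by simp
  then have "(\<Sum>v\<in>W. c v * \<tau> v u) = 0" unfolding lin_comb_def .
  also have "(\<Sum>v\<in>W. c v * \<tau> v u) = (\<Sum>v\<in>{u}. c v * \<tau> v u)"
  proof (rule sum.mono_neutral_right[OF finite_weyl])
    show "{u} \<subseteq> W" using less.prems by simp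
    show "\<forall>v\<in>W - {u}. c v * \<tau> v u = 0"
    proof
      fix v assume v: "v \<in> W - {u}"
      have "c v = 0 \<or> \<tau> v u = 0"
      proof (cases "len v < len u")
        case True
        then show ?thesis using less.hyps v by simp
      next
        case False
        have "v \<in> W" "u \<noteq> v" "len u \<le> len v" using v False by auto
        then show ?thesis using schubert_zero[OF _ schubert_class less.prems] by metis
      qed
      then show "c v * \<tau> v u = 0" by (metis mult_zero_left mult_zero_right)
    qed
  qed
  also have "\<dots> = c u * \<tau> u u" by simp
  finally have "\<Prod>(inversions u) * c u = 0"
    unfolding schubert_diagonal[OF less.prems schubert_class[OF less.prems]] by (metis mult.commute)
  then show ?case
    using prod_linear_mult_eq_0[OF finite_inversions c[OF less.prems]
        subset_trans[OF inversions_subset pos_dual]] inversions_subset zero_not_pos by blast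
qed

text \<open>Values are cleared length by length: at the lowest length \<open>n\<close> they are
  divisible by the diagonal values of the Schubert classes, and the latter do not interfere with
  each other there. No element is longer than \<open>card pos\<close>, so the process ends.\<close>

lemma schubert_spanning_from:
  assumes "f \<in> H" "\<And>v. v \<in> W \<Longrightarrow> len v < n \<Longrightarrow> f v = 0"
  shows "\<exists>c. (\<forall>u\<in>W. c u \<in> sym_algebra) \<and> f = lin_comb W c \<tau>"
  using assms
proof (induction "Suc (card pos) - n" arbitrary: n f rule: less_induct)
  case less
  show ?case
  proof (cases "n \<le> card pos")
    case False
    have "f v = 0" if "v \<in> W" for v
    proof -
      have "len v \<le> card pos"
        using card_mono[OF finite_pos inversions_subset] card_inversions[OF that] by metis
      then show ?thesis using less.prems(2)[OF that] False by simp
    qed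
    then have "f = 0" using H_ext[OF less.prems(1) H_zero] by (metis zero_fun_apply)
    then have "f = lin_comb W (\<lambda>u. 0) \<tau>" by (simp only: lin_comb_zero)
    then show ?thesis using sym_algebra_zero by (intro exI[where x = "\<lambda>u. 0"] conjI ballI)
  next
    case True
    have "\<exists>g\<in>sym_algebra. f v = \<Prod>(inversions v) * g" if "v \<in> W" "len v = n" for v
      using divisible_by_inversions[OF less.prems(1) that(1)] less.prems(2) that(2) by metis
    then obtain g where g: "\<And>v. v \<in> W \<Longrightarrow> len v = n \<Longrightarrow> g v \<in> sym_algebra"
      "\<And>v. v \<in> W \<Longrightarrow> len v = n \<Longrightarrow> f v = \<Prod>(inversions v) * g v" by metis
    define c where "c = (\<lambda>v. if len v = n then g v else 0)"
    have c: "c v \<in> sym_algebra" if "v \<in> W" for v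
      unfolding c_def using g(1) sym_algebra_zero that by metis
    have c_zero: "c v = 0" if "len v \<noteq> n" for v using that by (simp add: c_def)
    define f' where "f' = f - lin_comb W c \<tau>"
    have f'_H: "f' \<in> H"
      unfolding f'_def using less.prems(1) c schubert_class_in_H by (intro H_diff lin_comb_in_H)
    have f'_zero: "f' w = 0" if w: "w \<in> W" "len w < Suc n" for w
    proof -
      have "lin_comb W c \<tau> w = (\<Sum>v\<in>W. c v * \<tau> v w)" unfolding lin_comb_def ..
      also have "\<dots> = (\<Sum>v\<in>{w}. c v * \<tau> v w)"
      proof (rule sum.mono_neutral_right[OF finite_weyl])
        show "{w} \<subseteq> W" using w by simp
        show "\<forall>v\<in>W - {w}. c v * \<tau> v w = 0"
        proof
          fix v assume v: "v \<in> W - {w}"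
          have "c v = 0 \<or> \<tau> v w = 0"
          proof (cases "len v = n")
            case True
            have "v \<in> W" "w \<noteq> v" "len w \<le> len v" using v w(2) True by auto
            then show ?thesis using schubert_zero[OF _ schubert_class w(1)] by metis
          qed (use c_zero in blast)
          then show "c v * \<tau> v w = 0" by (metis mult_zero_left mult_zero_right)
        qed
      qed
      also have "\<dots> = c w * \<tau> w w" by simp
      also have "\<dots> = f w"
      proof (cases "len w = n")
        case True
        then show ?thesis
          using g(2)[OF w(1) True] schubert_diagonal[OF w(1) schubert_class[OF w(1)]]
          by (simp add: c_def mult.commute)
      next
        case False
        then show ?thesis using c_zero[OF False] less.prems(2)[OF w(1)] w(2) by (metis less_SucE mult_zero_left)
      qed
      finally show ?thesis by (simp add: f'_def)
    qed
    have "Suc (card pos) - Suc n < Suc (card pos) - n" using True by simp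
    from less.hyps[OF this f'_H f'_zero] obtain d
      where d: "\<forall>u\<in>W. d u \<in> sym_algebra" "f' = lin_comb W d \<tau>" by blast
    have "f = lin_comb W c \<tau> + lin_comb W d \<tau>" using d(2) unfolding f'_def by (metis add.commute diff_add_cancel)
    then have "f = lin_comb W (\<lambda>v. c v + d v) \<tau>" unfolding lin_comb_add .
    moreover have "\<forall>v\<in>W. c v + d v \<in> sym_algebra" using c d(1) sym_algebra.add by metis
    ultimately show ?thesis by (intro exI[where x = "\<lambda>v. c v + d v"] conjI)
  qed
qed

lemma schubert_basis: "sym_basis H W \<tau>"
  unfolding sym_basis_def
proof (intro conjI ballI impI)
  show "\<tau> \<in> W \<rightarrow> H" using schubert_class_in_H by blast
  fix f assume "f \<in> H"
  then obtain c where "\<forall>u\<in>W. c u \<in> sym_algebra" "f = lin_comb W c \<tau>"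
    using schubert_spanning_from[of f 0] by auto
  then show "\<exists>c\<in>W \<rightarrow> sym_algebra. f = lin_comb W c \<tau>" by blast
next
  fix c u assume "c \<in> W \<rightarrow> sym_algebra" "lin_comb W c \<tau> = 0" "u \<in> W"
  then show "c u = 0" using schubert_independent[of c u] by blast
qed

section \<open>Left weak order and the symmetrised classes\<close>

abbreviation weak where "weak \<equiv> left_weak_le \<Phi> B"

lemma weak_refl: "u \<in> W \<Longrightarrow> weak u u"
proof -
  assume "u \<in> W"
  then have "u \<circ> inv u = id" using weyl_inv_right by (simp add: fun_eq_iff)
  then show ?thesis by (simp add: left_weak_le_def len_id)
qed

text \<open>Equal lengths force \<open>u \<circ> inv v\<close> to have length 0. Length thereby
  becomes the rank in the triangularity argument.\<close>

lemma weak_len: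
  assumes "u \<in> W" "v \<in> W" "weak v u"
  shows "v = u \<or> len v < len u"
proof -
  have "v = u" if "len v = len u"
  proof -
    have "len (u \<circ> inv v) = 0" using assms(3) that unfolding left_weak_le_def by simp
    then have id: "u \<circ> inv v = id" using len_0_imp_id weyl_comp weyl_inv assms(1,2) by metis
    have "v x = u x" for x using fun_cong[OF id, of "v x"] weyl_inv_left[OF assms(2)] by simp
    then show ?thesis by blast
  qed
  then show ?thesis using assms(3) unfolding left_weak_le_def by linarith
qed

text \<open>Subadditivity of length always gives
  \<open>len u \<le> len (u \<circ> inv v) + len v\<close>. The reverse inequality loses at most
  one, exactly the difference in length between \<open>u\<close> and
  \<open>\<sigma> \<alpha> \<circ> u\<close>.\<close>

lemma weak_descent:
  assumes "u \<in> W" "v \<in> W" "\<alpha> \<in> B" "len u = Suc (len (\<sigma> \<alpha> \<circ> u))" "weak v (\<sigma> \<alpha> \<circ> u)"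
  shows "weak v u"
proof -
  have uv: "u \<circ> inv v \<in> W" using weyl_comp weyl_inv assms(1,2) by metis
  have "u \<circ> inv v \<circ> v = u" using weyl_inv_left[OF assms(2)] by (simp add: fun_eq_iff)
  then have "len u \<le> len (u \<circ> inv v) + len v" using len_comp_le[OF uv assms(2)] by metis
  moreover have "len (u \<circ> inv v) \<le> Suc (len (\<sigma> \<alpha> \<circ> u \<circ> inv v))"
    using len_le_simple_comp[OF assms(3) uv] unfolding o_assoc .
  ultimately show ?thesis using assms(4,5) unfolding left_weak_le_def by linarith
qed

text \<open>
  Twisting by a simple reflection subtracts from \<open>\<tau> u\<close> a multiple of the class one step below
  \<open>u\<close> in the left weak order, or does nothing; iterating over a word stays within the lower set
  of \<open>u\<close> and never changes the coefficient of \<open>\<tau> u\<close>.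
\<close>

lemma twist_schubert_expansion:
  assumes "set \<alpha>s \<subseteq> B" "u \<in> W"
  shows "\<exists>c. (\<forall>v\<in>W. c v \<in> sym_algebra) \<and> c u = 1 \<and> (\<forall>v\<in>W. c v \<noteq> 0 \<longrightarrow> weak v u) \<and>
             twist (\<tau> u) (word \<alpha>s) = lin_comb W c \<tau>"
  using assms
proof (induction \<alpha>s arbitrary: u)
  case Nil
  define c :: "('k ^ 'n \<Rightarrow> 'k ^ 'n) \<Rightarrow> 'k ^ 'n \<Rightarrow> 'k" where "c = (\<lambda>j. if j = u then 1 else 0)"
  have "twist (\<tau> u) (word []) v x = \<tau> u v x" for v x
    unfolding word_Nil twist_apply[OF weyl_group.one] by simp
  then have "twist (\<tau> u) (word []) = \<tau> u" by blast
  also have "\<tau> u = lin_comb W c \<tau>"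
    unfolding c_def using lin_comb_unit[OF finite_weyl Nil.prems(2), of \<tau>] by (rule sym)
  finally have "twist (\<tau> u) (word []) = lin_comb W c \<tau>" .
  moreover have "\<forall>v\<in>W. c v \<in> sym_algebra" unfolding c_def using sym_algebra_one sym_algebra_zero by metis
  moreover have "c u = 1" by (simp add: c_def)
  moreover have "\<forall>v\<in>W. c v \<noteq> 0 \<longrightarrow> weak v u" unfolding c_def using weak_refl[OF Nil.prems(2)] by metis
  ultimately show ?case by blast
next
  case (Cons \<alpha> \<alpha>s)
  let ?w = "word \<alpha>s"
  have \<alpha>: "\<alpha> \<in> B" "set \<alpha>s \<subseteq> B" using Cons.prems(1) by auto
  have root: "\<alpha> \<in> \<Phi>" using \<alpha>(1) base_root by metis
  have w: "?w \<in> W" using word_in_weyl \<alpha>(2) by metis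
  have su: "\<sigma> \<alpha> \<circ> u \<in> W" using refl_comp_in_weyl root Cons.prems(2) by metis
  have tw: "twist (\<tau> u) (word (\<alpha> # \<alpha>s)) = twist (twist (\<tau> u) (\<sigma> \<alpha>)) ?w"
    unfolding word_Cons using twist_comp[OF refl_in_weyl[OF root] w] .
  obtain c where c: "\<forall>v\<in>W. c v \<in> sym_algebra" "c u = 1" "\<forall>v\<in>W. c v \<noteq> 0 \<longrightarrow> weak v u"
    "twist (\<tau> u) ?w = lin_comb W c \<tau>" using Cons.IH[OF \<alpha>(2) Cons.prems(2)] by metis
  consider "len u = Suc (len (\<sigma> \<alpha> \<circ> u))" | "len (\<sigma> \<alpha> \<circ> u) = Suc (len u)"
    using len_simple_cases[OF \<alpha>(1) Cons.prems(2)] by metis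
  then show ?case
  proof cases
    case 1
    obtain d where d: "\<forall>v\<in>W. d v \<in> sym_algebra" "\<forall>v\<in>W. d v \<noteq> 0 \<longrightarrow> weak v (\<sigma> \<alpha> \<circ> u)"
      "twist (\<tau> (\<sigma> \<alpha> \<circ> u)) ?w = lin_comb W d \<tau>" using Cons.IH[OF \<alpha>(2) su] by metis
    \<comment> \<open>Twisting by \<open>?w\<close> also acts on the scalar \<alpha>, turning it
      into \<open>\<alpha> \<circ> ?w\<close>.\<close>
    define e where "e = (\<lambda>v. c v - (\<alpha> \<circ> ?w) * d v)"
    have "twist (\<tau> u) (word (\<alpha> # \<alpha>s)) = lin_comb W e \<tau>"
    proof (intro ext)
      fix v x
      have "twist (\<tau> u) (word (\<alpha> # \<alpha>s)) v x =
          twist (\<tau> u) ?w v x - \<alpha> (?w x) * twist (\<tau> (\<sigma> \<alpha> \<circ> u)) ?w v x"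
        unfolding tw twist_apply[OF w] by (rule twist_schubert_descent[OF Cons.prems(2) \<alpha>(1) 1])
      also have "\<dots> = lin_comb W c \<tau> v x - \<alpha> (?w x) * lin_comb W d \<tau> v x" unfolding c(4) d(3) ..
      also have "\<dots> = lin_comb W e \<tau> v x"
        by (simp add: lin_comb_apply e_def sum_distrib_left left_diff_distrib sum_subtractf mult.assoc)
      finally show "twist (\<tau> u) (word (\<alpha> # \<alpha>s)) v x = lin_comb W e \<tau> v x" .
    qed
    moreover have "\<forall>v\<in>W. e v \<in> sym_algebra"
    proof
      fix v assume v: "v \<in> W"
      have "\<alpha> \<circ> ?w \<in> sym_algebra"
        using sym_algebra_comp_weyl[OF w sym_algebra.linear[OF root_dual[OF root]]] .
      then show "e v \<in> sym_algebra"
        unfolding e_def using c(1) d(1) v sym_algebra_diff sym_algebra.mult by metis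
    qed
    moreover have "e u = 1"
    proof -
      \<comment> \<open>\<open>u\<close> is longer than \<open>\<sigma> \<alpha> \<circ> u\<close>,
        so the second expansion has no term at \<open>u\<close>.\<close>
      have "\<not> weak u (\<sigma> \<alpha> \<circ> u)"
      proof
        assume "weak u (\<sigma> \<alpha> \<circ> u)"
        from weak_len[OF su Cons.prems(2) this] show False using 1 by (metis lessI less_asym n_not_Suc_n)
      qed
      then have "d u = 0" using d(2) Cons.prems(2) by metis
      then show ?thesis unfolding e_def using c(2) by (metis diff_zero mult_zero_right)
    qed
    moreover have "\<forall>v\<in>W. e v \<noteq> 0 \<longrightarrow> weak v u"
    proof (intro ballI impI)
      fix v assume v: "v \<in> W" "e v \<noteq> 0"
      then have "c v \<noteq> 0 \<or> d v \<noteq> 0" unfolding e_def by (metis diff_zero mult_zero_right)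
      then show "weak v u"
        using c(3) d(2) v(1) weak_descent[OF Cons.prems(2) v(1) \<alpha>(1) 1] by metis
    qed
    ultimately show ?thesis by blast
  next
    case 2
    then have "twist (\<tau> u) (word (\<alpha> # \<alpha>s)) = twist (\<tau> u) ?w"
      unfolding tw using twist_schubert_ascent[OF Cons.prems(2) \<alpha>(1)] by metis
    then show ?thesis using c by metis
  qed
qed

abbreviation \<tau>sym where "\<tau>sym \<equiv> sym_schubert_class \<Phi> B"

lemma sym_schubert_expansion:
  assumes "u \<in> W"
  shows "\<exists>a. (\<forall>v\<in>W. a v \<in> sym_algebra) \<and> a u = 1 \<and> (\<forall>v\<in>W. a v \<noteq> 0 \<longrightarrow> weak v u) \<and>
             \<tau>sym u = lin_comb W a \<tau>"
proof -
  let ?P = "\<lambda>w c. (\<forall>v\<in>W. c v \<in> sym_algebra) \<and> c u = 1 \<and> (\<forall>v\<in>W. c v \<noteq> 0 \<longrightarrow> weak v u) \<and>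
    twist (\<tau> u) w = lin_comb W c \<tau>"
  define c where "c = (\<lambda>w. SOME c. ?P w c)"
  have P: "?P w (c w)" if "w \<in> W" for w
  proof -
    obtain \<alpha>s where "set \<alpha>s \<subseteq> B" "w = word \<alpha>s" using weyl_word \<open>w \<in> W\<close> by metis
    then have "\<exists>c. ?P w c" using twist_schubert_expansion[OF _ assms] by metis
    from someI_ex[OF this] show ?thesis unfolding c_def .
  qed
  have c: "\<And>w v. w \<in> W \<Longrightarrow> v \<in> W \<Longrightarrow> c w v \<in> sym_algebra" "\<And>w. w \<in> W \<Longrightarrow> c w u = 1"
    "\<And>w v. w \<in> W \<Longrightarrow> v \<in> W \<Longrightarrow> c w v \<noteq> 0 \<Longrightarrow> weak v u"
    "\<And>w. w \<in> W \<Longrightarrow> twist (\<tau> u) w = lin_comb W (c w) \<tau>"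
    using P by blast+
  define r :: 'k where "r = 1 / of_nat (card W)"
  \<comment> \<open>Characteristic 0 is what makes the average of the coefficients 1 at
    \<open>u\<close> equal to 1.\<close>
  have card: "(of_nat (card W) :: 'k) \<noteq> 0" using finite_weyl assms by auto
  define a where "a = (\<lambda>v. (\<lambda>x. r) * (\<Sum>w\<in>W. c w v))"
  have a_apply: "a v x = r * (\<Sum>w\<in>W. c w v x)" for v x by (simp add: a_def sum_fun_apply)
  have "\<tau>sym u = lin_comb W a \<tau>"
  proof (intro ext)
    fix v x
    have "\<tau>sym u v x = r * (\<Sum>w\<in>W. lin_comb W (c w) \<tau> v x)"
      unfolding sym_schubert_class_def r_def using c(4) by simp
    also have "(\<Sum>w\<in>W. lin_comb W (c w) \<tau> v x) = (\<Sum>i\<in>W. \<Sum>w\<in>W. c w i x * \<tau> i v x)"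
      unfolding lin_comb_apply by (rule sum.swap)
    also have "r * \<dots> = lin_comb W a \<tau> v x"
      unfolding lin_comb_apply a_apply by (simp add: sum_distrib_left sum_distrib_right mult.assoc)
    finally show "\<tau>sym u v x = lin_comb W a \<tau> v x" .
  qed
  moreover have "\<forall>v\<in>W. a v \<in> sym_algebra"
    unfolding a_def using c(1) by (intro ballI sym_algebra.mult sym_algebra.const sym_algebra_sum) simp
  moreover have "a u = 1"
  proof
    fix x
    have "(\<Sum>w\<in>W. c w u x) = (\<Sum>w\<in>W. 1)" using c(2) by (intro sum.cong) simp_all
    then show "a u x = 1 x" unfolding a_apply r_def using card by simp
  qed
  moreover have "\<forall>v\<in>W. a v \<noteq> 0 \<longrightarrow> weak v u"
  proof (intro ballI impI, rule ccontr)
    fix v assume v: "v \<in> W" "a v \<noteq> 0" "\<not> weak v u"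
    then have "c w v = 0" if "w \<in> W" for w using c(3)[OF that v(1)] by metis
    then have "(\<Sum>w\<in>W. c w v) = 0" by (intro sum.neutral ballI)
    then show False using v(2) unfolding a_def by (metis mult_zero_right)
  qed
  ultimately show ?thesis by blast
qed

text \<open>\<open>schubert_coeff\<close> is described among functions undefined outside
  \<open>W\<close>, so an expansion is first restricted to \<open>W\<close>; independence of the
  Schubert classes leaves no other candidate.\<close>

lemma schubert_coeff_eq:
  assumes "\<And>v. v \<in> W \<Longrightarrow> a v \<in> sym_algebra" "\<tau>sym u = lin_comb W a \<tau>" "v \<in> W"
  shows "schubert_coeff \<Phi> B u v = a v"
proof -
  have "schubert_coeff \<Phi> B u = restrict a W"
    unfolding schubert_coeff_def
  proof (rule the_equality)
    have "lin_comb W (restrict a W) \<tau> = lin_comb W a \<tau>" by (intro lin_comb_cong) simp_all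
    then show "restrict a W \<in> W \<rightarrow>\<^sub>E sym_algebra \<and> \<tau>sym u = lin_comb W (restrict a W) \<tau>"
      using assms(1,2) by (metis restrict_PiE_iff)
    fix d assume d: "d \<in> W \<rightarrow>\<^sub>E sym_algebra \<and> \<tau>sym u = lin_comb W d \<tau>"
    then have d_sym: "d v \<in> sym_algebra" if "v \<in> W" for v using that by (metis PiE_mem)
    have "lin_comb W d \<tau> - lin_comb W a \<tau> = 0" using d assms(2) by (metis right_minus_eq)
    then have "lin_comb W (\<lambda>v. d v - a v) \<tau> = 0" unfolding lin_comb_diff .
    then have "d v - a v = 0" if "v \<in> W" for v
      using schubert_independent[of "\<lambda>v. d v - a v"] sym_algebra_diff[OF d_sym assms(1)] that by metis
    then have eq: "d v = a v" if "v \<in> W" for v using that by (metis right_minus_eq)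
    show "d = restrict a W"
    proof
      fix v
      show "d v = restrict a W v"
      proof (cases "v \<in> W")
        case True
        then show ?thesis using eq by (metis restrict_apply')
      next
        case False
        then show ?thesis using PiE_arb[OF conjunct1[OF d]] by (metis restrict_def)
      qed
    qed
  qed
  then show ?thesis using assms(3) by (metis restrict_apply')
qed

lemma schubert_coeff_properties:
  assumes "u \<in> W"
  shows schubert_coeff_in_sym: "\<And>v. v \<in> W \<Longrightarrow> schubert_coeff \<Phi> B u v \<in> sym_algebra"
    and schubert_coeff_diag: "schubert_coeff \<Phi> B u u = 1"
    and schubert_coeff_weak: "\<And>v. v \<in> W \<Longrightarrow> schubert_coeff \<Phi> B u v \<noteq> 0 \<Longrightarrow> weak v u"
    and sym_schubert_eq: "\<tau>sym u = lin_comb W (schubert_coeff \<Phi> B u) \<tau>"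
proof -
  obtain a where a: "\<And>v. v \<in> W \<Longrightarrow> a v \<in> sym_algebra" "a u = 1" "\<And>v. v \<in> W \<Longrightarrow> a v \<noteq> 0 \<Longrightarrow> weak v u"
    "\<tau>sym u = lin_comb W a \<tau>" using sym_schubert_expansion[OF assms] by metis
  note eq = schubert_coeff_eq[OF a(1,4)]
  show "schubert_coeff \<Phi> B u v \<in> sym_algebra" if "v \<in> W" for v using eq a(1) that by metis
  show "schubert_coeff \<Phi> B u u = 1" using eq a(2) assms by metis
  show "weak v u" if "v \<in> W" "schubert_coeff \<Phi> B u v \<noteq> 0" for v using eq a(3) that by metis
  have "lin_comb W (schubert_coeff \<Phi> B u) \<tau> = lin_comb W a \<tau>" using eq by (intro lin_comb_cong) simp_all
  then show "\<tau>sym u = lin_comb W (schubert_coeff \<Phi> B u) \<tau>" using a(4) by metis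
qed

lemma sym_schubert_basis: "sym_basis H W \<tau>sym"
proof (rule sym_basis_unitriangular[OF finite_weyl schubert_basis, where a = "schubert_coeff \<Phi> B" and \<mu> = len])
  show "\<tau>sym u \<in> H" if "u \<in> W" for u
    unfolding sym_schubert_eq[OF that]
    using schubert_coeff_in_sym[OF that] schubert_class_in_H by (intro lin_comb_in_H)
  show "v = u \<or> len v < len u" if "u \<in> W" "v \<in> W" "schubert_coeff \<Phi> B u v \<noteq> 0" for u v
    using weak_len[OF that(1,2)] schubert_coeff_weak[OF that] by metis
qed (use schubert_coeff_properties in metis)+

end

theorem mainTheorem12:
  fixes \<Phi> B :: "('k::field_char_0 ^ 'n::finite \<Rightarrow> 'k) set"
  assumes "root_system \<Phi>"
    and "root_base \<Phi> B"
  shows "(\<forall>u\<in>weyl_group \<Phi>. \<forall>v\<in>weyl_group \<Phi>.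
            schubert_coeff \<Phi> B u v \<noteq> 0 \<longrightarrow> left_weak_le \<Phi> B v u) \<and>
         (\<forall>u\<in>weyl_group \<Phi>. schubert_coeff \<Phi> B u u = 1) \<and>
         sym_basis (graph_cohomology \<Phi> B) (weyl_group \<Phi>) (sym_schubert_class \<Phi> B)"
proof -
  interpret based_root_system \<Phi> B using assms by unfold_locales
  show ?thesis using schubert_coeff_weak schubert_coeff_diag sym_schubert_basis by blast
qed

end
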